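(* Let $r\ge 3$ be an integer, let $\varepsilon>0$ be constant and let $p=\frac{1+\varepsilon}{(r-1)\binom{n-1}{r-1}}$. Let $L_C$ and $L_P$ be the lengths of the longest loose cycle and of the longest loose path, respectively, in $H^r(n,p)$. Then with high probability $$\left(\frac{\varepsilon^2}{4(r-1)^2}+O(\varepsilon^3)\right)\cdot n\le L_C\le L_P+1\le \left(\frac{2\varepsilon^2}{(r-1)^2}+O(\varepsilon^3)\right)\cdot n,$$ where the $O(\varepsilon^3)$ terms are bounded in absolute value by $K\varepsilon^3$ for a constant $K=K(r)$ depending only on $r$.
   Context: "With high probability" means with probability tending to $1$ as $n\to\infty$ (with $r,\varepsilon$ fixed). $H^r(n,p)$ is the random $r$-uniform hypergraph on vertex set $[n]$ in which each $r$-subset of $[n]$ is an edge independently with probability $p$. A loose path of length $\ell$ in an $r$-uniform hypergraph is a sequence of distinct vertices $v_1,\dots,v_{\ell(r-1)+1}$ and a sequence of edges $e_1,\dots,e_\ell$ with $e_i=\{v_{(i-1)(r-1)+1},\dots,v_{(i-1)(r-1)+r}\}$ for $i\in[\ell]$. A loose cycle of length $\ell$ is defined similarly, except that $v_{\ell(r-1)+1}=v_1$ (and otherwise all vertices are distinct). If there is no loose cycle, $L_C=0$. *)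

theory Defs
  imports "HOL-Probability.Probability"
begin

text \<open>A hypergraph is given by its vertex set \<open>V\<close> and its edge set \<open>E\<close>.\<close>

definition complete_edges :: "nat \<Rightarrow> nat \<Rightarrow> nat set set" where
  "complete_edges r n = {e. e \<subseteq> {1..n} \<and> card e = r}"

text \<open>The law of the edge set of $H^r(n,p)$. Note that \<open>bernoulli_pmf p\<close> clips \<open>p\<close> to the
  interval from 0 to 1.\<close>

definition random_hypergraph :: "nat \<Rightarrow> nat \<Rightarrow> real \<Rightarrow> nat set set pmf" where
  "random_hypergraph r n p =
     map_pmf (\<lambda>X. {e \<in> complete_edges r n. X e})
       (Pi_pmf (complete_edges r n) False (\<lambda>_. bernoulli_pmf p))"

definition loose_path ::
  "nat \<Rightarrow> 'a set \<Rightarrow> 'a set set \<Rightarrow> nat \<Rightarrow> (nat \<Rightarrow> 'a) \<Rightarrow> (nat \<Rightarrow> 'a set) \<Rightarrow> bool" where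
  "loose_path r V E l v e \<longleftrightarrow>
     v ` {1..l * (r - 1) + 1} \<subseteq> V \<and>
     inj_on v {1..l * (r - 1) + 1} \<and>
     (\<forall>i\<in>{1..l}. e i = v ` {(i - 1) * (r - 1) + 1..(i - 1) * (r - 1) + r} \<and> e i \<in> E)"

text \<open>In an \<open>r\<close>-uniform hypergraph with \<open>r \<ge> 2\<close>, length 1 is impossible, since the single edge
  would have only \<open>r - 1\<close> vertices; length 2 is allowed (two edges sharing exactly two vertices,
  when \<open>r \<ge> 3\<close>).\<close>

definition loose_cycle ::
  "nat \<Rightarrow> 'a set \<Rightarrow> 'a set set \<Rightarrow> nat \<Rightarrow> (nat \<Rightarrow> 'a) \<Rightarrow> (nat \<Rightarrow> 'a set) \<Rightarrow> bool" where
  "loose_cycle r V E l v e \<longleftrightarrow>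
     l \<ge> 1 \<and>
     v ` {1..l * (r - 1) + 1} \<subseteq> V \<and>
     inj_on v {1..l * (r - 1)} \<and>
     v (l * (r - 1) + 1) = v 1 \<and>
     (\<forall>i\<in>{1..l}. e i = v ` {(i - 1) * (r - 1) + 1..(i - 1) * (r - 1) + r} \<and> e i \<in> E)"

text \<open>For finite \<open>V\<close> and \<open>r \<ge> 2\<close> both maxima range over finite sets. If \<open>V\<close> is nonempty, a single
  vertex is a loose path of length 0; the inserted 0 is the value of \<open>L_C\<close> when there is no
  loose cycle.\<close>

definition L_P :: "nat \<Rightarrow> 'a set \<Rightarrow> 'a set set \<Rightarrow> nat" where
  "L_P r V E = Max {l. \<exists>v e. loose_path r V E l v e}"

definition L_C :: "nat \<Rightarrow> 'a set \<Rightarrow> 'a set set \<Rightarrow> nat" where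
  "L_C r V E = Max (insert 0 {l. \<exists>v e. loose_cycle r V E l v e})"

end

theory Submission
  imports Defs
begin

text \<open>Write \<open>d = r - 1\<close>; the constant may be chosen so large that only small \<open>\<epsilon>\<close> matter.

  Upper bound: every edge of a long loose path, except for the \<open>k\<close> edges at either end, has two
  vertices from which edge-disjoint trails of length \<open>k\<close> lead away from it. By the BK inequality
  and Harris' inequality, a given edge has this property with probability at most
  \<open>p (r choose 2) \<rho>\<^sup>2\<close>, where \<open>\<rho>\<close> is the probability that a branching process survives for \<open>k\<close>
  generations; for large \<open>k\<close> it is \<open>2 \<epsilon> / d + O(\<epsilon>\<^sup>2)\<close>. So the expected number of such edges is
  \<open>(2 \<epsilon>\<^sup>2 / d\<^sup>2 + O(\<epsilon>\<^sup>3)) n\<close>, and a second use of the BK inequality shows that the variance is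
  linear in \<open>n\<close>.

  Lower bound: run a depth-first search for loose paths until \<open>\<tau> n M\<close> edges have been queried, where
  \<open>M = (n - 1) choose d\<close>. About \<open>(1 + \<epsilon>) \<tau> n\<close> vertices have then been discovered. All edges that
  join an exhausted vertex to \<open>d\<close> unseen ones have been queried, so at most about
  \<open>\<tau> (1 + d \<tau>) n\<close> vertices are exhausted. The others lie on the current path, whose length is thus
  about \<open>(\<epsilon> \<tau> - d \<tau>\<^sup>2) n / d\<close>, that is \<open>\<epsilon>\<^sup>2 n / (4 d\<^sup>2)\<close> for \<open>\<tau> = \<epsilon> / (2 d)\<close>. An edge through a few
  reserved vertices joins the two ends of the path to a cycle.\<close>

section \<open>Random subsets\<close>

text \<open>Only edges are tracked in the trails, because distinct edges are present independently:
  once the first edge is removed, an event of the same kind about the remaining edges is left. So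
  the branching recursion holds as an inequality for every \<open>n\<close>, without any local tree
  approximation. What remains is that trails may share edges. Harris' inequality handles this inside
  one trail, and the BK inequality handles the two trails at an edge.

  The constant 2 arises as follows: the expected number of edges is
  \<open>n (1 + \<epsilon>) / (r d)\<close>, so multiplying by
  \<open>(r choose 2) \<rho>\<^sup>2\<close> gives
  \<open>(1 + \<epsilon>) / 2 * \<rho>\<^sup>2 n\<close>, where \<open>\<rho>\<close> is about
  \<open>2 \<epsilon> / d\<close>. The depth \<open>k\<close> is fixed in terms of
  \<open>\<epsilon>\<close> before \<open>n\<close> grows, so the ends of a path and the range of
  dependence stay bounded.

  The loss \<open>d \<tau>\<^sup>2\<close> in the search comes from the exhausted vertices: about
  \<open>\<tau> n\<close> vertices have been seen, so each exhausted vertex accounts for roughly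
  \<open>(1 - d \<tau>) M\<close> queries. The search is adaptive, hence its positive answers are
  controlled by a martingale and second moments.\<close>

definition expect :: "'a set \<Rightarrow> real \<Rightarrow> ('a set \<Rightarrow> real) \<Rightarrow> real" where
  "expect A p f = (\<Sum>X\<in>Pow A. p ^ card X * (1 - p) ^ card (A - X) * f X)"

abbreviation probab :: "'a set \<Rightarrow> real \<Rightarrow> ('a set \<Rightarrow> bool) \<Rightarrow> real" where
  "probab A p P \<equiv> expect A p (\<lambda>X. of_bool (P X))"

lemma expect_empty [simp]: "expect {} p f = f {}"
  by (simp add: expect_def)

text \<open>Conditioning on whether \<open>x\<close> is present. Nearly all inductions over the
  ground set below rest on this identity, which is why expectations are finite weighted sums
  here.\<close>

lemma expect_insert:
  assumes "finite A" "x \<notin> A"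
  shows "expect (insert x A) p f = p * expect A p (\<lambda>X. f (insert x X)) + (1 - p) * expect A p f"
proof -
  have disj: "Pow A \<inter> insert x ` Pow A = {}" using assms by auto
  have inj: "inj_on (insert x) (Pow A)" using assms by (auto simp: inj_on_def)
  have "(\<Sum>X\<in>insert x ` Pow A. p ^ card X * (1 - p) ^ card (insert x A - X) * f X)
      = (\<Sum>X\<in>Pow A. p ^ card (insert x X) * (1 - p) ^ card (insert x A - insert x X) * f (insert x X))"
    using inj by (simp add: sum.reindex)
  also have "\<dots> = (\<Sum>X\<in>Pow A. p * (p ^ card X * (1 - p) ^ card (A - X) * f (insert x X)))"
  proof (rule sum.cong[OF refl])
    fix X assume "X \<in> Pow A"
    then have "finite X" "x \<notin> X" "insert x A - insert x X = A - X"
      using assms finite_subset by auto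
    then show "p ^ card (insert x X) * (1 - p) ^ card (insert x A - insert x X) * f (insert x X)
      = p * (p ^ card X * (1 - p) ^ card (A - X) * f (insert x X))" by simp
  qed
  finally have 1: "(\<Sum>X\<in>insert x ` Pow A. p ^ card X * (1 - p) ^ card (insert x A - X) * f X)
    = p * expect A p (\<lambda>X. f (insert x X))" by (simp add: expect_def sum_distrib_left)
  have "(\<Sum>X\<in>Pow A. p ^ card X * (1 - p) ^ card (insert x A - X) * f X)
      = (\<Sum>X\<in>Pow A. (1 - p) * (p ^ card X * (1 - p) ^ card (A - X) * f X))"
  proof (rule sum.cong[OF refl])
    fix X assume "X \<in> Pow A"
    then have "finite (A - X)" "x \<notin> A - X" "insert x A - X = insert x (A - X)"
      using assms by auto
    then show "p ^ card X * (1 - p) ^ card (insert x A - X) * f X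
      = (1 - p) * (p ^ card X * (1 - p) ^ card (A - X) * f X)" by simp
  qed
  then have 2: "(\<Sum>X\<in>Pow A. p ^ card X * (1 - p) ^ card (insert x A - X) * f X)
    = (1 - p) * expect A p f" by (simp add: expect_def sum_distrib_left)
  show ?thesis
    unfolding expect_def Pow_insert
    using 1 2 disj assms by (subst sum.union_disjoint) (auto simp: expect_def)
qed

lemma expect_remove:
  assumes "finite A" "x \<in> A"
  shows "expect A p f =
    p * expect (A - {x}) p (\<lambda>X. f (insert x X)) + (1 - p) * expect (A - {x}) p f"
  using expect_insert[of "A - {x}" x p f] assms by (simp add: insert_absorb)

lemma expect_cong: "(\<And>X. X \<subseteq> A \<Longrightarrow> f X = g X) \<Longrightarrow> expect A p f = expect A p g"
  unfolding expect_def by (intro sum.cong) auto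

lemma expect_mono:
  assumes "0 \<le> p" "p \<le> 1" "\<And>X. X \<subseteq> A \<Longrightarrow> f X \<le> g X"
  shows "expect A p f \<le> expect A p g"
  unfolding expect_def using assms by (intro sum_mono mult_left_mono) auto

lemma expect_nonneg:
  assumes "0 \<le> p" "p \<le> 1" "\<And>X. X \<subseteq> A \<Longrightarrow> 0 \<le> f X"
  shows "0 \<le> expect A p f"
  unfolding expect_def using assms by (intro sum_nonneg mult_nonneg_nonneg) auto

lemma expect_const [simp]:
  assumes "finite A"
  shows "expect A p (\<lambda>_. c) = c"
  using assms by (induction A) (auto simp: expect_insert algebra_simps)

lemma expect_add: "expect A p (\<lambda>X. f X + g X) = expect A p f + expect A p g"
  by (simp add: expect_def sum.distrib algebra_simps)

lemma expect_diff: "expect A p (\<lambda>X. f X - g X) = expect A p f - expect A p g"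
  by (simp add: expect_def sum_subtractf algebra_simps)

lemma expect_cmult: "expect A p (\<lambda>X. c * f X) = c * expect A p f"
  by (simp add: expect_def sum_distrib_left algebra_simps)

lemma expect_sum: "expect A p (\<lambda>X. \<Sum>i\<in>I. f i X) = (\<Sum>i\<in>I. expect A p (f i))"
  unfolding expect_def by (subst sum.swap) (simp add: sum_distrib_left)

lemma probab_le_1:
  assumes "finite A" "0 \<le> p" "p \<le> 1"
  shows "probab A p P \<le> 1"
  using expect_mono[OF assms(2,3), of A "\<lambda>X. of_bool (P X)" "\<lambda>_. 1"] assms by simp

lemma probab_not:
  assumes "finite A"
  shows "probab A p (\<lambda>X. \<not> P X) = 1 - probab A p P"
proof -
  have "probab A p (\<lambda>X. \<not> P X) = expect A p (\<lambda>X. 1 - of_bool (P X))"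
    by (intro expect_cong) auto
  then show ?thesis using assms by (simp add: expect_diff)
qed

lemma probab_mono:
  assumes "0 \<le> p" "p \<le> 1" "\<And>X. X \<subseteq> A \<Longrightarrow> P X \<Longrightarrow> Q X"
  shows "probab A p P \<le> probab A p Q"
  using assms by (intro expect_mono) auto

lemma probab_disj_le:
  assumes "0 \<le> p" "p \<le> 1"
  shows "probab A p (\<lambda>X. P X \<or> Q X) \<le> probab A p P + probab A p Q"
  unfolding expect_add[symmetric] using assms by (intro expect_mono) auto

lemma probab_Bex_le:
  assumes "0 \<le> p" "p \<le> 1" "finite I"
  shows "probab A p (\<lambda>X. \<exists>i\<in>I. P i X) \<le> (\<Sum>i\<in>I. probab A p (P i))"
  unfolding expect_sum[symmetric]
proof (rule expect_mono[OF assms(1,2)])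
  fix X
  show "of_bool (\<exists>i\<in>I. P i X) \<le> (\<Sum>i\<in>I. of_bool (P i X) :: real)"
  proof (cases "\<exists>i\<in>I. P i X")
    case True
    then obtain i where "i \<in> I" "P i X" by auto
    then show ?thesis using member_le_sum[of i I "\<lambda>i. of_bool (P i X) :: real"] assms by auto
  qed (auto intro: sum_nonneg)
qed

text \<open>Fubini for two disjoint, hence independent, parts of the ground set. It later allows the
  edges inside \<open>{1..m}\<close> to be exposed before the others.\<close>

lemma expect_Un:
  assumes "finite A" "finite B" "A \<inter> B = {}"
  shows "expect (A \<union> B) p f = expect A p (\<lambda>X. expect B p (\<lambda>Y. f (X \<union> Y)))"
  using assms(1,3)
proof (induction A arbitrary: f)
  case (insert x A)
  have "expect (insert x A \<union> B) p f = expect (insert x (A \<union> B)) p f" by simp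
  also have "\<dots> = p * expect (A \<union> B) p (\<lambda>X. f (insert x X)) + (1 - p) * expect (A \<union> B) p f"
    using insert assms by (intro expect_insert) auto
  also have "\<dots> = expect (insert x A) p (\<lambda>X. expect B p (\<lambda>Y. f (X \<union> Y)))"
    using insert by (subst expect_insert) auto
  finally show ?case .
qed auto

section \<open>Tail bounds and positive correlation\<close>

lemma probab_markov:
  assumes "0 \<le> p" "p \<le> 1" "0 < c" "\<And>X. X \<subseteq> A \<Longrightarrow> 0 \<le> f X"
    and "\<And>X. X \<subseteq> A \<Longrightarrow> P X \<Longrightarrow> c \<le> f X"
  shows "probab A p P \<le> expect A p f / c"
proof -
  have "c * probab A p P \<le> expect A p f"
    unfolding expect_cmult[symmetric] using assms by (intro expect_mono) auto
  then show ?thesis using assms(3) by (simp add: field_simps)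
qed

lemma expect_chebyshev:
  assumes "finite A" "0 \<le> p" "p \<le> 1" "0 < c"
  shows "probab A p (\<lambda>X. f X \<ge> expect A p f + c)
    \<le> (expect A p (\<lambda>X. (f X)\<^sup>2) - (expect A p f)\<^sup>2) / c\<^sup>2"
proof -
  let ?m = "expect A p f"
  have "probab A p (\<lambda>X. f X \<ge> ?m + c) \<le> expect A p (\<lambda>X. (f X - ?m)\<^sup>2) / c\<^sup>2"
    using assms by (intro probab_markov) (auto intro!: power_mono)
  also have "expect A p (\<lambda>X. (f X - ?m)\<^sup>2)
    = expect A p (\<lambda>X. (f X)\<^sup>2 + ((- 2 * ?m) * f X + ?m\<^sup>2))"
    by (intro expect_cong) (simp add: power2_eq_square algebra_simps)
  also have "\<dots> = expect A p (\<lambda>X. (f X)\<^sup>2) - ?m\<^sup>2"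
    by (simp only: expect_add expect_cmult expect_const[OF assms(1)]) (simp add: power2_eq_square)
  finally show ?thesis .
qed

text \<open>After conditioning on \<open>x\<close>, the inductive bounds leave the surplus
  \<open>p (1 - p) (F0 - F1) (G0 - G1)\<close>, which is nonnegative because both factors decrease
  when \<open>x\<close> is added. Decreasing functions are the natural case, as the events to be
  correlated are extinctions.\<close>

lemma harris:
  assumes "finite A" "0 \<le> p" "p \<le> 1"
    and "\<And>X Y. X \<subseteq> Y \<Longrightarrow> Y \<subseteq> A \<Longrightarrow> f Y \<le> f X" "\<And>X Y. X \<subseteq> Y \<Longrightarrow> Y \<subseteq> A \<Longrightarrow> g Y \<le> g X"
  shows "expect A p f * expect A p g \<le> expect A p (\<lambda>X. f X * g X)"
  using assms(1,4,5)
proof (induction A arbitrary: f g)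
  case (insert x A)
  let ?F1 = "expect A p (\<lambda>X. f (insert x X))" and ?F0 = "expect A p f"
  let ?G1 = "expect A p (\<lambda>X. g (insert x X))" and ?G0 = "expect A p g"
  have 1: "?F1 * ?G1 \<le> expect A p (\<lambda>X. f (insert x X) * g (insert x X))"
    by (intro insert.IH insert.prems) auto
  have 0: "?F0 * ?G0 \<le> expect A p (\<lambda>X. f X * g X)"
    by (intro insert.IH insert.prems) auto
  have "?F1 \<le> ?F0" "?G1 \<le> ?G0"
    by (intro expect_mono assms insert.prems; auto)+
  then have "0 \<le> p * (1 - p) * ((?F0 - ?F1) * (?G0 - ?G1))"
    using assms by (intro mult_nonneg_nonneg) auto
  moreover have "p * (?F1 * ?G1) \<le> p * expect A p (\<lambda>X. f (insert x X) * g (insert x X))"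
    "(1 - p) * (?F0 * ?G0) \<le> (1 - p) * expect A p (\<lambda>X. f X * g X)"
    using 0 1 assms by (auto intro: mult_left_mono)
  ultimately show ?case
    using insert.hyps by (simp add: expect_insert algebra_simps)
qed auto

lemma harris_prod:
  assumes "finite A" "0 \<le> p" "p \<le> 1" "finite I"
    and "\<And>i X Y. i \<in> I \<Longrightarrow> X \<subseteq> Y \<Longrightarrow> Y \<subseteq> A \<Longrightarrow> P i Y \<Longrightarrow> P i X"
  shows "(\<Prod>i\<in>I. probab A p (P i)) \<le> probab A p (\<lambda>X. \<forall>i\<in>I. P i X)"
  using assms(4,5)
proof (induction I)
  case empty
  then show ?case using assms by simp
next
  case (insert i I)
  have "(\<Prod>j\<in>insert i I. probab A p (P j)) = probab A p (P i) * (\<Prod>j\<in>I. probab A p (P j))"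
    using insert by simp
  also have "\<dots> \<le> probab A p (P i) * probab A p (\<lambda>X. \<forall>j\<in>I. P j X)"
    using insert.prems assms by (intro mult_left_mono insert.IH expect_nonneg) auto
  also have "\<dots> \<le> expect A p (\<lambda>X. of_bool (P i X) * of_bool (\<forall>j\<in>I. P j X))"
    using insert.prems assms(1-3) by (intro harris) (auto simp: of_bool_def)
  also have "\<dots> = probab A p (\<lambda>X. \<forall>j\<in>insert i I. P j X)"
    by (intro expect_cong) auto
  finally show ?case .
qed

section \<open>The BK inequality\<close>

text \<open>The van den Berg--Kesten inequality, by passing one coordinate at a time to an
  independent copy \<open>Y\<close> that serves the second event only.\<close>

definition box :: "('a set \<Rightarrow> bool) \<Rightarrow> ('a set \<Rightarrow> bool) \<Rightarrow> 'a set \<Rightarrow> bool" where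
  "box P Q X \<longleftrightarrow> (\<exists>a b. a \<inter> b = {} \<and> a \<union> b \<subseteq> X \<and> P a \<and> Q b)"

text \<open>Events are given by a family \<open>R\<close> of pairs of certificates, so that fixing a
  coordinate merely passes to a subfamily; hence the induction over arbitrary \<open>R\<close>. All
  conditions are intersected with \<open>A\<close>, so a coordinate that has been removed is
  forgotten without changing the certificates.\<close>

lemma bk_aux:
  assumes "finite A" "0 \<le> p" "p \<le> 1"
  shows "probab A p (\<lambda>X. \<exists>(a, b)\<in>R. a \<inter> b \<inter> A = {} \<and> (a \<union> b) \<inter> A \<subseteq> X)
    \<le> expect A p (\<lambda>X. probab A p (\<lambda>Y. \<exists>(a, b)\<in>R. a \<inter> A \<subseteq> X \<and> b \<inter> A \<subseteq> Y))"
  using assms(1)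
proof (induction A arbitrary: R)
  case empty
  then show ?case by simp
next
  case (insert x A)
  let ?D = "\<lambda>R X. \<exists>(a, b)\<in>R. a \<inter> b \<inter> A = {} \<and> (a \<union> b) \<inter> A \<subseteq> X"
  let ?E = "\<lambda>R X Y. \<exists>(a, b)\<in>R. a \<inter> A \<subseteq> X \<and> b \<inter> A \<subseteq> Y"
  \<comment> \<open>With two copies, the usable pairs are all of \<open>R\<close> if
    \<open>x\<close> lies in both, \<open>Ra\<close> if only in the first, \<open>Rb\<close> if only
    in the second, and \<open>R0\<close> if in neither. With a single copy containing
    \<open>x\<close>, disjointness lets at most one certificate use \<open>x\<close>, which leaves
    \<open>R1\<close>.\<close>
  define R0 where "R0 = {(a, b) \<in> R. x \<notin> a \<and> x \<notin> b}"
  define Ra where "Ra = {(a, b) \<in> R. x \<notin> b}"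
  define Rb where "Rb = {(a, b) \<in> R. x \<notin> a}"
  define R1 where "R1 = Ra \<union> Rb"
  have i1: "s \<inter> insert x A \<subseteq> insert x X \<longleftrightarrow> s \<inter> A \<subseteq> X" if "X \<subseteq> A" for s X
    using that insert.hyps(2) by blast
  have i2: "s \<inter> insert x A \<subseteq> X \<longleftrightarrow> s \<inter> A \<subseteq> X \<and> x \<notin> s" if "X \<subseteq> A" for s X
    using that insert.hyps(2) by blast
  have i3: "a \<inter> b \<inter> insert x A = {} \<longleftrightarrow> a \<inter> b \<inter> A = {} \<and> \<not> (x \<in> a \<and> x \<in> b)" for a b
    by blast
  have L1: "probab A p (\<lambda>X. \<exists>(a, b)\<in>R. a \<inter> b \<inter> insert x A = {} \<and> (a \<union> b) \<inter> insert x A \<subseteq> insert x X)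
    = probab A p (?D R1)"
    by (intro expect_cong arg_cong[where f = of_bool])
      (simp only: i1 i3, simp add: R1_def Ra_def Rb_def, blast)
  have L0: "probab A p (\<lambda>X. \<exists>(a, b)\<in>R. a \<inter> b \<inter> insert x A = {} \<and> (a \<union> b) \<inter> insert x A \<subseteq> X)
    = probab A p (?D R0)"
    by (intro expect_cong arg_cong[where f = of_bool])
      (simp only: i2 i3, simp add: R0_def, blast)
  let ?e = "\<lambda>R. expect A p (\<lambda>X. probab A p (?E R X))"
  have R11: "expect A p (\<lambda>X. probab A p (\<lambda>Y. \<exists>(a, b)\<in>R. a \<inter> insert x A \<subseteq> insert x X \<and> b \<inter> insert x A \<subseteq> insert x Y))
    = ?e R"
    by (intro expect_cong arg_cong[where f = of_bool]) (simp only: i1)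
  have R10: "expect A p (\<lambda>X. probab A p (\<lambda>Y. \<exists>(a, b)\<in>R. a \<inter> insert x A \<subseteq> insert x X \<and> b \<inter> insert x A \<subseteq> Y))
    = ?e Ra"
    by (intro expect_cong arg_cong[where f = of_bool])
      (simp only: i1 i2, simp add: Ra_def, blast)
  have R01: "expect A p (\<lambda>X. probab A p (\<lambda>Y. \<exists>(a, b)\<in>R. a \<inter> insert x A \<subseteq> X \<and> b \<inter> insert x A \<subseteq> insert x Y))
    = ?e Rb"
    by (intro expect_cong arg_cong[where f = of_bool])
      (simp only: i1 i2, simp add: Rb_def, blast)
  have R00: "expect A p (\<lambda>X. probab A p (\<lambda>Y. \<exists>(a, b)\<in>R. a \<inter> insert x A \<subseteq> X \<and> b \<inter> insert x A \<subseteq> Y))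
    = ?e R0"
    by (intro expect_cong arg_cong[where f = of_bool])
      (simp only: i2, simp add: R0_def, blast)
  \<comment> \<open>The event for \<open>R1\<close> is the union of those for \<open>Ra\<close> and
    \<open>Rb\<close>, and the event for \<open>R0\<close> is contained in both.\<close>
  have le1: "?e R1 + ?e R0 \<le> ?e Ra + ?e Rb"
    unfolding expect_add[symmetric]
  proof (intro expect_mono assms)
    fix X Y
    have "?E R1 X Y \<longleftrightarrow> ?E Ra X Y \<or> ?E Rb X Y" by (auto simp: R1_def)
    moreover have "?E R0 X Y \<longrightarrow> ?E Ra X Y \<and> ?E Rb X Y" by (auto simp: R0_def Ra_def Rb_def)
    ultimately show "of_bool (?E R1 X Y) + of_bool (?E R0 X Y)
      \<le> (of_bool (?E Ra X Y) + of_bool (?E Rb X Y) :: real)" by auto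
  qed
  have le2: "?e R1 \<le> ?e R"
    by (intro expect_mono assms) (auto simp: R1_def Ra_def Rb_def)
  \<comment> \<open>The single coordinate is doubled by writing \<open>p\<close> as
    \<open>p\<^sup>2 + p (1 - p)\<close> and \<open>1 - p\<close> as
    \<open>p (1 - p) + (1 - p)\<^sup>2\<close>; the mixed weight occurs twice, which is where
    \<open>le1\<close> applies.\<close>
  have "p * (p * ?e R1) + p * ((1 - p) * (?e R1 + ?e R0)) + (1 - p) * ((1 - p) * ?e R0)
    \<le> p * (p * ?e R) + p * ((1 - p) * (?e Ra + ?e Rb)) + (1 - p) * ((1 - p) * ?e R0)"
  proof -
    have "p * (p * ?e R1) \<le> p * (p * ?e R)"
      using assms(2) by (intro mult_left_mono le2)
    moreover have "p * ((1 - p) * (?e R1 + ?e R0)) \<le> p * ((1 - p) * (?e Ra + ?e Rb))"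
      using assms(2,3) by (intro mult_left_mono le1) auto
    ultimately show ?thesis by linarith
  qed
  moreover have "p * ?e R1 + (1 - p) * ?e R0
    = p * (p * ?e R1) + p * ((1 - p) * (?e R1 + ?e R0)) + (1 - p) * ((1 - p) * ?e R0)"
    by (simp add: algebra_simps)
  moreover have "p * probab A p (?D R1) + (1 - p) * probab A p (?D R0)
    \<le> p * ?e R1 + (1 - p) * ?e R0"
    using assms by (intro add_mono mult_left_mono insert.IH) auto
  ultimately have "p * probab A p (?D R1) + (1 - p) * probab A p (?D R0)
    \<le> p * (p * ?e R) + p * ((1 - p) * (?e Ra + ?e Rb)) + (1 - p) * ((1 - p) * ?e R0)"
    by linarith
  also have "\<dots> = p * (p * ?e R + (1 - p) * ?e Rb) + (1 - p) * (p * ?e Ra + (1 - p) * ?e R0)"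
    by (simp add: algebra_simps)
  finally show ?case
    by (simp only: expect_insert[OF insert.hyps] expect_add expect_cmult L1 L0 R11 R10 R01 R00)
qed

text \<open>An increasing event is certified by the sets that satisfy it, so \<open>R\<close>
  consists of all pairs of such sets. On the side with two copies the certificates no longer
  interact, and the probability factorizes.\<close>

lemma bk:
  assumes "finite A" "0 \<le> p" "p \<le> 1"
    and P: "\<And>X Y. X \<subseteq> Y \<Longrightarrow> P X \<Longrightarrow> P Y" and Q: "\<And>X Y. X \<subseteq> Y \<Longrightarrow> Q X \<Longrightarrow> Q Y"
  shows "probab A p (box P Q) \<le> probab A p P * probab A p Q"
proof -
  let ?R = "{(a, b). a \<subseteq> A \<and> b \<subseteq> A \<and> P a \<and> Q b}"
  have "probab A p (box P Q)
    \<le> probab A p (\<lambda>X. \<exists>(a, b)\<in>?R. a \<inter> b \<inter> A = {} \<and> (a \<union> b) \<inter> A \<subseteq> X)"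
  proof (intro probab_mono assms)
    fix X assume "X \<subseteq> A" "box P Q X"
    then obtain a b where ab: "a \<inter> b = {}" "a \<union> b \<subseteq> X" "P a" "Q b" unfolding box_def by auto
    then have "(a, b) \<in> ?R" using \<open>X \<subseteq> A\<close> by auto
    moreover have "a \<inter> b \<inter> A = {} \<and> (a \<union> b) \<inter> A \<subseteq> X" using ab by auto
    ultimately show "\<exists>(a, b)\<in>?R. a \<inter> b \<inter> A = {} \<and> (a \<union> b) \<inter> A \<subseteq> X" by blast
  qed
  also have "\<dots> \<le> expect A p (\<lambda>X. probab A p (\<lambda>Y. \<exists>(a, b)\<in>?R. a \<inter> A \<subseteq> X \<and> b \<inter> A \<subseteq> Y))"
    by (rule bk_aux[OF assms(1-3)])
  also have "\<dots> \<le> expect A p (\<lambda>X. expect A p (\<lambda>Y. of_bool (P X) * of_bool (Q Y)))"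
  proof (intro expect_mono assms)
    fix X Y
    have "P X \<and> Q Y" if "\<exists>(a, b)\<in>?R. a \<inter> A \<subseteq> X \<and> b \<inter> A \<subseteq> Y"
    proof -
      from that obtain a b where "a \<subseteq> A" "b \<subseteq> A" "P a" "Q b" "a \<inter> A \<subseteq> X" "b \<inter> A \<subseteq> Y" by auto
      then show ?thesis using P[of a X] Q[of b Y] by (simp add: Int_absorb2)
    qed
    then show "of_bool (\<exists>(a, b)\<in>?R. a \<inter> A \<subseteq> X \<and> b \<inter> A \<subseteq> Y)
      \<le> (of_bool (P X) * of_bool (Q Y) :: real)" by auto
  qed
  also have "\<dots> = probab A p P * probab A p Q"
    by (simp only: expect_cmult mult.commute[of _ "probab A p Q"])
  finally show ?thesis .
qed

section \<open>The random hypergraph\<close>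

lemma expectation_random_subset:
  fixes f :: "'a set \<Rightarrow> real"
  assumes "finite A" "0 \<le> p" "p \<le> 1"
  shows "measure_pmf.expectation
    (map_pmf (\<lambda>X. {e \<in> A. X e}) (Pi_pmf A False (\<lambda>_. bernoulli_pmf p))) f = expect A p f"
  using assms(1)
proof (induction A arbitrary: f)
  case (insert x A)
  let ?M = "\<lambda>A. map_pmf (\<lambda>X. {e \<in> A. X e}) (Pi_pmf A False (\<lambda>_. bernoulli_pmf p))"
  have "?M (insert x A) = bind_pmf (bernoulli_pmf p) (\<lambda>b. map_pmf (\<lambda>Y. if b then insert x Y else Y) (?M A))"
    unfolding Pi_pmf_insert'[OF insert.hyps] map_bind_pmf pmf.map_comp o_def map_return_pmf
    unfolding map_pmf_def bind_assoc_pmf bind_return_pmf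
  proof (intro bind_pmf_cong refl arg_cong[where f = return_pmf])
    fix b f
    show "{e \<in> insert x A. (f(x := b)) e} = (if b then insert x {e \<in> A. f e} else {e \<in> A. f e})"
      using insert.hyps by auto
  qed
  moreover have "finite (set_pmf (?M A))"
    by (rule finite_subset[of _ "Pow A"]) (use insert.hyps in auto)
  ultimately have "measure_pmf.expectation (?M (insert x A)) f
    = (\<Sum>b\<in>UNIV. pmf (bernoulli_pmf p) b *\<^sub>R
        measure_pmf.expectation (map_pmf (\<lambda>Y. if b then insert x Y else Y) (?M A)) f)"
    by (simp only:) (rule pmf_expectation_bind, auto)
  also have "\<dots> = p * measure_pmf.expectation (?M A) (\<lambda>Y. f (insert x Y)) + (1 - p) * measure_pmf.expectation (?M A) f"
    using assms by (simp add: UNIV_bool)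
  finally show ?case
    by (simp only: insert.IH expect_insert[OF insert.hyps])
qed simp

text \<open>The only passage from \<open>random_hypergraph\<close> to finite sums. The bounds on
  \<open>p\<close> make sure that \<open>bernoulli_pmf\<close> does not clip it.\<close>

lemma prob_random_hypergraph:
  assumes "0 \<le> p" "p \<le> 1"
  shows "measure_pmf.prob (random_hypergraph r n p) {E. P E} = probab (complete_edges r n) p P"
proof -
  have fin: "finite (complete_edges r n)"
    by (rule finite_subset[of _ "Pow {1..n}"]) (auto simp: complete_edges_def)
  have "measure_pmf.prob (random_hypergraph r n p) {E. P E}
    = measure_pmf.expectation (random_hypergraph r n p) (\<lambda>E. of_bool (P E))"
    by (simp add: flip: indicator_def[of "{E. P E}", simplified])
  then show ?thesis
    unfolding random_hypergraph_def using expectation_random_subset[OF fin assms] by simp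
qed

lemma finite_complete_edges [simp]: "finite (complete_edges r n)"
  by (rule finite_subset[of _ "Pow {1..n}"]) (auto simp: complete_edges_def)

lemma card_complete_edges: "card (complete_edges r n) = n choose r"
  unfolding complete_edges_def using n_subsets[of "{1..n}" r] by simp

lemma degree_complete_edges:
  assumes "r \<ge> 1"
  shows "card {e \<in> complete_edges r n. u \<in> e} \<le> (n - 1) choose (r - 1)"
proof (cases "u \<in> {1..n}")
  case True
  have "card {e \<in> complete_edges r n. u \<in> e} \<le> card {B. B \<subseteq> {1..n} - {u} \<and> card B = r - 1}"
  proof (rule card_inj_on_le[where f = "\<lambda>e. e - {u}"])
    show "inj_on (\<lambda>e. e - {u}) {e \<in> complete_edges r n. u \<in> e}"
      by (auto simp: inj_on_def)
    show "(\<lambda>e. e - {u}) ` {e \<in> complete_edges r n. u \<in> e} \<subseteq> {B. B \<subseteq> {1..n} - {u} \<and> card B = r - 1}"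
      by (auto simp: complete_edges_def card_Diff_singleton_if)
  qed auto
  also have "\<dots> = (n - 1) choose (r - 1)"
    using True by (subst n_subsets) auto
  finally show ?thesis .
next
  case False
  then have "{e \<in> complete_edges r n. u \<in> e} = {}" by (auto simp: complete_edges_def)
  then show ?thesis by (simp only: card.empty)
qed

section \<open>Trails and branching processes\<close>

text \<open>Weaker than a loose path: only the edges have to be distinct, not the vertices.\<close>

fun trail :: "nat \<Rightarrow> 'v \<Rightarrow> 'v set set \<Rightarrow> bool" where
  "trail 0 u X = True"
| "trail (Suc k) u X = (\<exists>e\<in>X. u \<in> e \<and> (\<exists>w\<in>e - {u}. trail k w (X - {e})))"

lemma trail_mono: "X \<subseteq> Y \<Longrightarrow> trail k u X \<Longrightarrow> trail k u Y"
proof (induction k arbitrary: u X Y)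
  case (Suc k)
  then obtain e w where "e \<in> X" "u \<in> e" "w \<in> e - {u}" "trail k w (X - {e})" by auto
  moreover from this have "trail k w (Y - {e})" using Suc.IH[of "X - {e}" "Y - {e}" w] Suc.prems by blast
  ultimately show ?case using Suc.prems by auto
qed auto

text \<open>Survival up to generation \<open>k\<close> of the branching process in which an individual has binomially
  many (with parameters \<open>M\<close> and \<open>p\<close>) litters of size \<open>d\<close>.\<close>

primrec survival :: "real \<Rightarrow> nat \<Rightarrow> nat \<Rightarrow> nat \<Rightarrow> real" where
  "survival p M d 0 = 1"
| "survival p M d (Suc k) = 1 - (1 - p * (1 - (1 - survival p M d k) ^ d)) ^ M"

lemma survival_bounds:
  assumes "0 \<le> p" "p \<le> 1"
  shows "0 \<le> survival p M d k \<and> survival p M d k \<le> 1"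
proof (induction k)
  case (Suc k)
  have "0 \<le> (1 - survival p M d k) ^ d" "(1 - survival p M d k) ^ d \<le> 1"
    using Suc by (auto intro: power_le_one)
  then have "0 \<le> p * (1 - (1 - survival p M d k) ^ d)" "p * (1 - (1 - survival p M d k) ^ d) \<le> 1"
    using assms by (auto intro!: mult_le_one)
  then show ?case by (auto intro: power_le_one)
qed auto

text \<open>By Harris' inequality the extinction events at the different edges, and at the different
  vertices of one edge, are positively correlated; hence a trail is at most as likely as survival
  of the branching process.\<close>

lemma probab_trail_le:
  assumes "r \<ge> 1" "0 \<le> p" "p \<le> 1" "A \<subseteq> complete_edges r n"
  shows "probab A p (trail k u) \<le> survival p ((n - 1) choose (r - 1)) (r - 1) k"
  using assms(4)
\<comment> \<open>The edge set \<open>A\<close> varies because only \<open>A - {e}\<close> is left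
  once a trail has used \<open>e\<close>.\<close>
proof (induction k arbitrary: u A)
  case 0
  have "finite A" using 0 by (rule finite_subset) simp
  then show ?case by simp
next
  case (Suc k)
  let ?M = "(n - 1) choose (r - 1)"
  let ?s = "survival p ?M (r - 1) k"
  have fin: "finite A" using Suc.prems by (rule finite_subset) simp
  let ?I = "{e \<in> A. u \<in> e}"
  \<comment> \<open>\<open>F e X\<close> says that no trail of length \<open>Suc k\<close> from
    \<open>u\<close> begins with \<open>e\<close>; it is decreasing in \<open>X\<close>.\<close>
  define F where "F = (\<lambda>e (X :: nat set set). \<not> (e \<in> X \<and> (\<exists>w\<in>e - {u}. trail k w (X - {e}))))"
  have s: "0 \<le> ?s" "?s \<le> 1" using survival_bounds assms by auto
  define q where "q = 1 - p * (1 - (1 - ?s) ^ (r - 1))"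
  have q: "0 \<le> q" "q \<le> 1"
  proof -
    have "0 \<le> (1 - ?s) ^ (r - 1)" "(1 - ?s) ^ (r - 1) \<le> 1"
      using s by (auto intro: power_le_one)
    then have "0 \<le> p * (1 - (1 - ?s) ^ (r - 1))" "p * (1 - (1 - ?s) ^ (r - 1)) \<le> 1"
      using assms by (auto intro!: mult_le_one)
    then show "0 \<le> q" "q \<le> 1" unfolding q_def by auto
  qed
  \<comment> \<open>Either \<open>e\<close> is absent, or no other vertex of \<open>e\<close> starts
    a trail in the rest. The second alternative has conditional probability at least
    \<open>(1 - ?s) ^ (r - 1)\<close> by Harris' inequality.\<close>
  have edge: "q \<le> probab A p (F e)" if e: "e \<in> ?I" for e
  proof -
    have ce: "card (e - {u}) = r - 1" "finite e"
      using e Suc.prems by (auto simp: complete_edges_def dest: finite_subset)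
    have "(1 - ?s) ^ (r - 1) = (\<Prod>w\<in>e - {u}. 1 - ?s)" using ce by simp
    also have "\<dots> \<le> (\<Prod>w\<in>e - {u}. probab (A - {e}) p (\<lambda>X. \<not> trail k w X))"
    proof (rule prod_mono)
      fix w
      have "probab (A - {e}) p (trail k w) \<le> ?s" using Suc.prems by (intro Suc.IH) auto
      then show "0 \<le> 1 - ?s \<and> 1 - ?s \<le> probab (A - {e}) p (\<lambda>X. \<not> trail k w X)"
        using s fin by (subst probab_not) auto
    qed
    also have "\<dots> \<le> probab (A - {e}) p (\<lambda>X. \<forall>w\<in>e - {u}. \<not> trail k w X)"
      using assms fin ce by (intro harris_prod) (auto dest: trail_mono)
    finally have le: "(1 - ?s) ^ (r - 1) \<le> probab (A - {e}) p (\<lambda>X. \<forall>w\<in>e - {u}. \<not> trail k w X)" .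
    have "probab A p (F e) = p * probab (A - {e}) p (\<lambda>X. F e (insert e X)) + (1 - p) * probab (A - {e}) p (F e)"
      using e fin by (intro expect_remove) auto
    also have "probab (A - {e}) p (\<lambda>X. F e (insert e X)) = probab (A - {e}) p (\<lambda>X. \<forall>w\<in>e - {u}. \<not> trail k w X)"
    proof (intro expect_cong arg_cong[where f = of_bool])
      fix X assume "X \<subseteq> A - {e}"
      then have "insert e X - {e} = X" by auto
      then show "F e (insert e X) = (\<forall>w\<in>e - {u}. \<not> trail k w X)" by (simp add: F_def)
    qed
    also have "probab (A - {e}) p (F e) = probab (A - {e}) p (\<lambda>X. True)"
      by (intro expect_cong arg_cong[where f = of_bool]) (auto simp: F_def)
    also have "\<dots> = 1" using fin by simp
    finally show ?thesis
      unfolding q_def using mult_left_mono[OF le assms(2)] by (simp add: algebra_simps)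
  qed
  have "card ?I \<le> ?M"
    using card_mono[of "{e \<in> complete_edges r n. u \<in> e}" ?I] Suc.prems degree_complete_edges[OF assms(1), of n u]
    by (fastforce intro: order_trans)
  then have "q ^ ?M \<le> q ^ card ?I" using q by (intro power_decreasing)
  also have "\<dots> = (\<Prod>e\<in>?I. q)" by simp
  also have "\<dots> \<le> (\<Prod>e\<in>?I. probab A p (F e))"
    using q edge by (intro prod_mono) auto
  also have "\<dots> \<le> probab A p (\<lambda>X. \<forall>e\<in>?I. F e X)"
  proof (rule harris_prod)
    fix e X Y
    assume "X \<subseteq> Y" "F e Y"
    then show "F e X" unfolding F_def using trail_mono[of "X - {e}" "Y - {e}"] by blast
  qed (use fin assms in auto)
  also have "\<dots> = probab A p (\<lambda>X. \<not> trail (Suc k) u X)"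
    by (intro expect_cong arg_cong[where f = of_bool]) (auto simp: F_def)
  also have "\<dots> = 1 - probab A p (trail (Suc k) u)"
    using fin by (rule probab_not)
  finally show ?case unfolding q_def by simp
qed

lemma probab_mem:
  assumes "finite A" "e \<in> A"
  shows "probab A p (\<lambda>X. e \<in> X) = p"
proof -
  have "probab (A - {e}) p (\<lambda>X. e \<in> X) = probab (A - {e}) p (\<lambda>X. False)"
    by (intro expect_cong arg_cong[where f = of_bool]) auto
  then show ?thesis using assms by (simp add: expect_remove)
qed

section \<open>Bridges\<close>

text \<open>The condition \<open>u < w\<close> makes the union bound range over unordered pairs.\<close>

definition bridge :: "nat \<Rightarrow> 'v::linorder set \<Rightarrow> 'v set set \<Rightarrow> bool" where
  "bridge k e X \<longleftrightarrow> e \<in> X \<and> (\<exists>u\<in>e. \<exists>w\<in>e. u < w \<and>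
     (\<exists>a b. e \<notin> a \<union> b \<and> a \<inter> b = {} \<and> a \<union> b \<subseteq> X \<and> trail k u a \<and> trail k w b))"

lemma bridge_mono: "X \<subseteq> Y \<Longrightarrow> bridge k e X \<Longrightarrow> bridge k e Y"
  unfolding bridge_def by (meson subset_iff)

text \<open>For a fixed pair of vertices the certificates \<open>{e}\<close>, \<open>a\<close> and
  \<open>b\<close> are disjoint. Two nested applications of \<open>bk\<close> bound the probability
  by \<open>p * ?s * ?s\<close>, and there are at most \<open>r choose 2\<close> pairs.\<close>

lemma probab_bridge_le:
  assumes "r \<ge> 1" "0 \<le> p" "p \<le> 1" "e \<in> complete_edges r n"
  shows "probab (complete_edges r n) p (bridge k e)
    \<le> p * real (r choose 2) * (survival p ((n - 1) choose (r - 1)) (r - 1) k)\<^sup>2"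
proof -
  let ?A = "complete_edges r n" and ?s = "survival p ((n - 1) choose (r - 1)) (r - 1) k"
  define I where "I = {(u, w). u \<in> e \<and> w \<in> e \<and> u < w}"
  let ?B = "\<lambda>(u, w). box (\<lambda>X. e \<in> X) (box (trail k u) (trail k w))"
  have fe: "finite e" "card e = r"
    using assms by (auto simp: complete_edges_def dest: finite_subset)
  have finI: "finite I" by (rule finite_subset[of _ "e \<times> e"]) (use fe in \<open>auto simp: I_def\<close>)
  have "card I \<le> card {B. B \<subseteq> e \<and> card B = 2}"
  proof (rule card_inj_on_le[where f = "\<lambda>(u, w). {u, w}"])
    show "inj_on (\<lambda>(u, w). {u, w}) I"
      by (auto simp: inj_on_def I_def doubleton_eq_iff)
    show "(\<lambda>(u, w). {u, w}) ` I \<subseteq> {B. B \<subseteq> e \<and> card B = 2}"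
      by (auto simp: I_def)
  qed (use fe in auto)
  then have cardI: "card I \<le> r choose 2" using fe by (simp add: n_subsets)
  have "probab ?A p (bridge k e) \<le> probab ?A p (\<lambda>X. \<exists>i\<in>I. ?B i X)"
  proof (rule probab_mono[OF assms(2,3)])
    fix X assume "bridge k e X"
    then obtain u w a b where uw: "u \<in> e" "w \<in> e" "u < w" "e \<in> X" "e \<notin> a \<union> b"
      "a \<inter> b = {}" "a \<union> b \<subseteq> X" "trail k u a" "trail k w b"
      unfolding bridge_def by blast
    then have "box (trail k u) (trail k w) (a \<union> b)" unfolding box_def by blast
    then have "box (\<lambda>X. e \<in> X) (box (trail k u) (trail k w)) X"
      unfolding box_def[of "\<lambda>X. e \<in> X"] using uw by (intro exI[of _ "{e}"] exI[of _ "a \<union> b"]) auto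
    then show "\<exists>i\<in>I. ?B i X" using uw by (auto simp: I_def)
  qed
  also have "\<dots> \<le> (\<Sum>i\<in>I. probab ?A p (?B i))"
    using assms finI by (intro probab_Bex_le)
  also have "\<dots> \<le> (\<Sum>i\<in>I. p * ?s\<^sup>2)"
  proof (rule sum_mono)
    fix i assume "i \<in> I"
    obtain u w where i: "i = (u, w)" by force
    have mono: "X \<subseteq> Y \<Longrightarrow> box (trail k u) (trail k w) X \<Longrightarrow> box (trail k u) (trail k w) Y" for X Y :: "nat set set"
      unfolding box_def by (meson order_trans)
    have "probab ?A p (?B i) \<le> probab ?A p (\<lambda>X. e \<in> X) * probab ?A p (box (trail k u) (trail k w))"
      unfolding i prod.case using assms mono by (intro bk) auto
    also have "\<dots> \<le> probab ?A p (\<lambda>X. e \<in> X) * (probab ?A p (trail k u) * probab ?A p (trail k w))"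
      using assms by (intro mult_left_mono bk expect_nonneg) (auto dest: trail_mono)
    also have "\<dots> \<le> p * (?s * ?s)"
      unfolding probab_mem[OF finite_complete_edges assms(4)]
      using assms survival_bounds[OF assms(2,3)]
      by (intro mult_left_mono mult_mono probab_trail_le expect_nonneg) auto
    finally show "probab ?A p (?B i) \<le> p * ?s\<^sup>2" by (simp add: power2_eq_square)
  qed
  also have "\<dots> = p * real (card I) * ?s\<^sup>2" by simp
  also have "\<dots> \<le> p * real (r choose 2) * ?s\<^sup>2"
    using cardI assms by (intro mult_right_mono mult_left_mono) auto
  finally show ?thesis .
qed

section \<open>Locality of bridges and walks between edges\<close>

text \<open>The line graph of \<open>X\<close>, with loops at nonempty edges; its relational powers
  are walks and measure distances between edges.\<close>

definition adj :: "'v set set \<Rightarrow> 'v set rel" where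
  "adj X = {(g, h). g \<in> X \<and> h \<in> X \<and> g \<inter> h \<noteq> {}}"

lemma adj_relpow_mono:
  assumes "X \<subseteq> Y" "(g, h) \<in> adj X ^^ i"
  shows "(g, h) \<in> adj Y ^^ i"
proof -
  have "adj X \<subseteq> adj Y" using assms(1) by (auto simp: adj_def)
  then show ?thesis using assms(2) relpowp_mono[to_set, of "adj X" "adj Y"] by blast
qed

lemma adj_relpow_sym: "(g, h) \<in> adj X ^^ i \<Longrightarrow> (h, g) \<in> adj X ^^ i"
proof (induction i arbitrary: g h)
  case (Suc i)
  then obtain f where "(g, f) \<in> adj X ^^ i" "(f, h) \<in> adj X" by auto
  then have "(f, g) \<in> adj X ^^ i" "(h, f) \<in> adj X" using Suc.IH by (auto simp: adj_def)
  then show ?case by (rule relpow_Suc_I2[rotated])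
qed auto

text \<open>Keeping just the edges that a trail traverses gives a certificate that stays close to
  \<open>u\<close>. This localization is what limits the dependence between bridges.\<close>

lemma trail_witness:
  assumes "trail k u X"
  shows "\<exists>a\<subseteq>X. trail k u a \<and> (\<forall>h\<in>a. \<exists>i<k. \<exists>g\<in>a. u \<in> g \<and> (g, h) \<in> adj a ^^ i)"
  using assms
proof (induction k arbitrary: u X)
  case (Suc k)
  then obtain e w where e: "e \<in> X" "u \<in> e" "w \<in> e" "w \<noteq> u" "trail k w (X - {e})" by auto
  from Suc.IH[OF e(5)] obtain a where a: "a \<subseteq> X - {e}" "trail k w a"
    and conn: "\<And>h. h \<in> a \<Longrightarrow> \<exists>i<k. \<exists>g\<in>a. w \<in> g \<and> (g, h) \<in> adj a ^^ i" by auto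
  have "insert e a - {e} = a" using a by auto
  then have "trail (Suc k) u (insert e a)" using e a by auto
  moreover have "\<exists>i<Suc k. \<exists>g\<in>insert e a. u \<in> g \<and> (g, h) \<in> adj (insert e a) ^^ i"
    if "h \<in> insert e a" for h
  proof (cases "h = e")
    case True
    then show ?thesis using e by (intro exI[of _ 0] conjI) auto
  next
    case False
    then have "h \<in> a" using that by simp
    then obtain i g where g: "i < k" "g \<in> a" "w \<in> g" "(g, h) \<in> adj a ^^ i" using conn by blast
    then have "(e, g) \<in> adj (insert e a)" using e by (auto simp: adj_def)
    moreover have "(g, h) \<in> adj (insert e a) ^^ i" using g(4) by (rule adj_relpow_mono[rotated]) auto
    ultimately have "(e, h) \<in> adj (insert e a) ^^ Suc i" by (rule relpow_Suc_I2)
    then show ?thesis using g(1) e(2) by (intro exI[of _ "Suc i"]) auto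
  qed
  ultimately show ?case using a e by (intro exI[of _ "insert e a"]) auto
qed auto

text \<open>The two localized trails together with \<open>e\<close> form a certificate of radius
  \<open>k\<close> around \<open>e\<close>. Intersecting certificates of two bridges therefore force
  the bridges to be within distance \<open>2 * k\<close>.\<close>

lemma bridge_witness:
  assumes "bridge k e X"
  shows "\<exists>c\<subseteq>X. bridge k e c \<and> (\<forall>h\<in>c. \<exists>i\<le>k. (e, h) \<in> adj c ^^ i)"
proof -
  obtain u w a0 b0 where uw: "u \<in> e" "w \<in> e" "u < w" "e \<in> X" "e \<notin> a0 \<union> b0"
      "a0 \<inter> b0 = {}" "a0 \<union> b0 \<subseteq> X" "trail k u a0" "trail k w b0"
    using assms unfolding bridge_def by blast
  obtain a where a: "a \<subseteq> a0" "trail k u a"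
    and ca: "\<And>h. h \<in> a \<Longrightarrow> \<exists>i<k. \<exists>g\<in>a. u \<in> g \<and> (g, h) \<in> adj a ^^ i"
    using trail_witness[OF uw(8)] by blast
  obtain b where b: "b \<subseteq> b0" "trail k w b"
    and cb: "\<And>h. h \<in> b \<Longrightarrow> \<exists>i<k. \<exists>g\<in>b. w \<in> g \<and> (g, h) \<in> adj b ^^ i"
    using trail_witness[OF uw(9)] by blast
  let ?c = "insert e (a \<union> b)"
  have step: "\<exists>i\<le>k. (e, h) \<in> adj ?c ^^ i"
    if d: "d \<subseteq> ?c" and g: "g \<in> d" "x \<in> g" "(g, h) \<in> adj d ^^ i" "i < k" "x \<in> e" for d g h i x
  proof -
    have "(e, g) \<in> adj ?c" using d g by (auto simp: adj_def)
    moreover have "(g, h) \<in> adj ?c ^^ i" using g(3) by (rule adj_relpow_mono[rotated]) (rule d)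
    ultimately have "(e, h) \<in> adj ?c ^^ Suc i" by (rule relpow_Suc_I2)
    then show ?thesis using g(4) by (intro exI[of _ "Suc i"]) auto
  qed
  have "\<exists>i\<le>k. (e, h) \<in> adj ?c ^^ i" if "h \<in> ?c" for h
  proof -
    consider "h = e" | "h \<in> a" | "h \<in> b" using \<open>h \<in> ?c\<close> by auto
    then show ?thesis
    proof cases
      case 1
      then show ?thesis by (intro exI[of _ 0]) auto
    next
      case 2
      then obtain i g where "i < k" "g \<in> a" "u \<in> g" "(g, h) \<in> adj a ^^ i" using ca by blast
      then show ?thesis using uw(1) by (intro step[of a g u h i]) auto
    next
      case 3
      then obtain i g where "i < k" "g \<in> b" "w \<in> g" "(g, h) \<in> adj b ^^ i" using cb by blast
      then show ?thesis using uw(2) by (intro step[of b g w h i]) auto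
    qed
  qed
  moreover have "bridge k e ?c"
    unfolding bridge_def
  proof (intro conjI bexI exI)
    show "u < w" "trail k u a" "trail k w b" "u \<in> e" "w \<in> e" by fact+
    show "e \<notin> a \<union> b" "a \<inter> b = {}" "a \<union> b \<subseteq> ?c" using a b uw by auto
  qed simp
  moreover have "?c \<subseteq> X" using a b uw by auto
  ultimately show ?thesis by (intro exI[of _ ?c]) blast
qed

text \<open>Walks in the line graph that never reuse an edge. Since every edge is deleted when it is
  left, each contributes an independent factor \<open>p\<close>.\<close>

fun link :: "nat \<Rightarrow> 'v set \<Rightarrow> 'v set \<Rightarrow> 'v set set \<Rightarrow> bool" where
  "link 0 e f X = (e = f \<and> e \<in> X)"
| "link (Suc j) e f X = (e \<in> X \<and> (\<exists>g\<in>X - {e}. g \<inter> e \<noteq> {} \<and> link j g f (X - {e})))"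

lemma link_mem: "link j e f X \<Longrightarrow> f \<in> X"
  by (induction j arbitrary: e X) auto

text \<open>A walk either avoids \<open>e\<close> or can be cut at a visit to \<open>e\<close>, and
  the part from there on is no longer than the walk.\<close>

lemma adj_relpow_avoid:
  "(g, f) \<in> adj X ^^ j \<Longrightarrow> (g, f) \<in> adj (X - {e}) ^^ j \<or> (\<exists>i\<le>j. (e, f) \<in> adj X ^^ i)"
proof (induction j arbitrary: g)
  case (Suc j)
  show ?case
  proof (cases "g = e")
    case True
    then show ?thesis using Suc.prems by blast
  next
    case ge: False
    from Suc.prems obtain h where h: "(g, h) \<in> adj X" "(h, f) \<in> adj X ^^ j"
      by (meson relpow_Suc_D2)
    from Suc.IH[OF h(2)] show ?thesis
    proof
      assume *: "(h, f) \<in> adj (X - {e}) ^^ j"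
      show ?thesis
      proof (cases "h = e")
        case True
        then show ?thesis using h(2) by (meson le_SucI order_refl)
      next
        case False
        then have "(g, h) \<in> adj (X - {e})" using h(1) ge by (auto simp: adj_def)
        then show ?thesis using * by (meson relpow_Suc_I2)
      qed
    qed (meson le_SucI)
  qed
qed auto

text \<open>Loop erasure: if the walk returns to its first edge, cut out the loop; otherwise it
  continues with that edge deleted. Cutting may shorten the walk by any amount, hence the strong
  induction.\<close>

lemma adj_relpow_imp_link:
  "(e, f) \<in> adj X ^^ j \<Longrightarrow> e \<in> X \<Longrightarrow> \<exists>i\<le>j. link i e f X"
proof (induction j arbitrary: e X rule: less_induct)
  case (less j)
  show ?case
  proof (cases j)
    case 0
    then show ?thesis using less.prems by auto
  next
    case (Suc m)
    from less.prems(1) obtain g where g: "(e, g) \<in> adj X" "(g, f) \<in> adj X ^^ m"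
      unfolding Suc by (meson relpow_Suc_D2)
    from adj_relpow_avoid[OF g(2), of e] have "(\<exists>i\<le>m. (e, f) \<in> adj X ^^ i) \<or> (g \<noteq> e \<and> (g, f) \<in> adj (X - {e}) ^^ m)"
      using g(2) by blast
    then show ?thesis
    proof (elim disjE exE conjE)
      fix i assume "i \<le> m" "(e, f) \<in> adj X ^^ i"
      then show ?thesis using less.IH[of i e X] less.prems Suc by (meson le_SucI le_trans less_Suc_eq_le)
    next
      assume *: "g \<noteq> e" "(g, f) \<in> adj (X - {e}) ^^ m"
      then have "g \<in> X - {e}" "g \<inter> e \<noteq> {}" using g(1) by (auto simp: adj_def)
      moreover obtain i where "i \<le> m" "link i g f (X - {e})"
        using less.IH[of m g "X - {e}"] * Suc calculation by auto
      ultimately have "link (Suc i) e f X" "Suc i \<le> j" using less.prems Suc by auto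
      then show ?thesis by blast
    qed
  qed
qed

text \<open>A first-moment count of self-avoiding walks: each step has at most
  \<open>r * ((n - 1) choose (r - 1))\<close> continuations, and each new edge costs a factor
  \<open>p\<close>. At the edge probability of the theorem the ratio does not depend on
  \<open>n\<close>.\<close>

lemma sum_probab_link_le:
  assumes "r \<ge> 1" "0 \<le> p" "p \<le> 1" "A \<subseteq> complete_edges r n" "e \<in> A"
  shows "(\<Sum>f\<in>A. probab A p (link j e f)) \<le> p * (p * r * ((n - 1) choose (r - 1))) ^ j"
  using assms(4,5)
proof (induction j arbitrary: e A)
  case 0
  have fin: "finite A" using 0(1) by (rule finite_subset) simp
  have "(\<Sum>f\<in>A. probab A p (link 0 e f)) = (\<Sum>f\<in>A. if f = e then p else 0)"
    using fin by (intro sum.cong refl) (auto simp: probab_mem 0(2))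
  then show ?case using fin 0 by simp
next
  case (Suc j)
  let ?D = "(n - 1) choose (r - 1)"
  let ?A = "A - {e}"
  let ?N = "{g \<in> ?A. g \<inter> e \<noteq> {}}"
  have fin: "finite A" using Suc.prems(1) by (rule finite_subset) simp
  have e: "finite e" "card e = r"
    using Suc.prems by (auto simp: complete_edges_def dest: finite_subset)
  have "card ?N \<le> card (\<Union>u\<in>e. {g \<in> complete_edges r n. u \<in> g})"
    using Suc.prems e by (intro card_mono) auto
  also have "\<dots> \<le> (\<Sum>u\<in>e. card {g \<in> complete_edges r n. u \<in> g})"
    using e by (intro card_UN_le)
  also have "\<dots> \<le> (\<Sum>u\<in>e. ?D)"
    using assms by (intro sum_mono degree_complete_edges)
  finally have N: "card ?N \<le> r * ?D" using e by simp
  have step: "probab A p (link (Suc j) e f) \<le> p * (\<Sum>g\<in>?N. probab ?A p (link j g f))" for f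
  proof -
    have "probab A p (link (Suc j) e f)
      = p * probab ?A p (\<lambda>X. link (Suc j) e f (insert e X)) + (1 - p) * probab ?A p (link (Suc j) e f)"
      using Suc.prems fin by (intro expect_remove)
    also have "probab ?A p (link (Suc j) e f) = probab ?A p (\<lambda>X. False)"
      by (intro expect_cong arg_cong[where f = of_bool]) auto
    also have "probab ?A p (\<lambda>X. link (Suc j) e f (insert e X)) \<le> probab ?A p (\<lambda>X. \<exists>g\<in>?N. link j g f X)"
    proof (rule probab_mono[OF assms(2,3)])
      fix X assume X: "X \<subseteq> ?A" "link (Suc j) e f (insert e X)"
      then have "insert e X - {e} = X" by auto
      then show "\<exists>g\<in>?N. link j g f X" using X by auto
    qed
    also have "\<dots> \<le> (\<Sum>g\<in>?N. probab ?A p (link j g f))"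
      using fin assms by (intro probab_Bex_le) auto
    finally show ?thesis using assms fin by (simp add: mult_left_mono)
  qed
  have zero: "probab ?A p (link j g e) = 0" for g
  proof -
    have "probab ?A p (link j g e) = probab ?A p (\<lambda>X. False)"
      by (intro expect_cong arg_cong[where f = of_bool]) (auto dest: link_mem)
    then show ?thesis using fin by simp
  qed
  have "(\<Sum>f\<in>A. probab A p (link (Suc j) e f)) \<le> (\<Sum>f\<in>A. p * (\<Sum>g\<in>?N. probab ?A p (link j g f)))"
    by (intro sum_mono step)
  also have "\<dots> = (\<Sum>f\<in>?A. p * (\<Sum>g\<in>?N. probab ?A p (link j g f)))"
    using fin Suc.prems by (subst sum.remove[of A e]) (auto simp: zero)
  also have "\<dots> = p * (\<Sum>g\<in>?N. \<Sum>f\<in>?A. probab ?A p (link j g f))"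
    by (subst sum.swap) (simp add: sum_distrib_left)
  also have "\<dots> \<le> p * (\<Sum>g\<in>?N. p * (p * r * ?D) ^ j)"
    using assms Suc.prems by (intro mult_left_mono sum_mono Suc.IH) auto
  also have "\<dots> = p * (real (card ?N) * (p * (p * r * ?D) ^ j))" by simp
  also have "\<dots> \<le> p * (real (r * ?D) * (p * (p * r * ?D) ^ j))"
    using of_nat_mono[OF N, where 'a = real] assms by (intro mult_left_mono mult_right_mono) auto
  finally show ?case by (simp add: algebra_simps)
qed

section \<open>First and second moment of the number of bridges\<close>

definition bridges :: "nat \<Rightarrow> 'v::linorder set set \<Rightarrow> 'v set set \<Rightarrow> real" where
  "bridges k A X = (\<Sum>e\<in>A. of_bool (bridge k e X))"

lemma expect_bridges_le:
  assumes "r \<ge> 1" "0 \<le> p" "p \<le> 1"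
  shows "expect (complete_edges r n) p (bridges k (complete_edges r n))
    \<le> real (n choose r) * (p * real (r choose 2) * (survival p ((n - 1) choose (r - 1)) (r - 1) k)\<^sup>2)"
proof -
  have "expect (complete_edges r n) p (bridges k (complete_edges r n))
    = (\<Sum>e\<in>complete_edges r n. probab (complete_edges r n) p (bridge k e))"
    unfolding bridges_def by (rule expect_sum)
  also have "\<dots> \<le> (\<Sum>e\<in>complete_edges r n. p * real (r choose 2) * (survival p ((n - 1) choose (r - 1)) (r - 1) k)\<^sup>2)"
    using assms by (intro sum_mono probab_bridge_le)
  also have "\<dots> = real (n choose r) * (p * real (r choose 2) * (survival p ((n - 1) choose (r - 1)) (r - 1) k)\<^sup>2)"
    by (simp add: card_complete_edges)
  finally show ?thesis .
qed

text \<open>If the localized certificates are disjoint, they witness disjoint occurrence; a common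
  edge instead gives a walk of length at most \<open>k + k\<close> between the two bridges.\<close>

lemma bridge_pair_cases:
  assumes "bridge k e X" "bridge k f X"
  shows "box (bridge k e) (bridge k f) X \<or> (\<exists>j\<in>{..2 * k}. link j e f X)"
proof -
  obtain c where c: "c \<subseteq> X" "bridge k e c" "\<And>h. h \<in> c \<Longrightarrow> \<exists>i\<le>k. (e, h) \<in> adj c ^^ i"
    using bridge_witness[OF assms(1)] by blast
  obtain d where d: "d \<subseteq> X" "bridge k f d" "\<And>h. h \<in> d \<Longrightarrow> \<exists>i\<le>k. (f, h) \<in> adj d ^^ i"
    using bridge_witness[OF assms(2)] by blast
  show ?thesis
  proof (cases "c \<inter> d = {}")
    case True
    then have "box (bridge k e) (bridge k f) X"
      unfolding box_def using c(1,2) d(1,2) by (intro exI[of _ c] exI[of _ d]) simp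
    then show ?thesis ..
  next
    case False
    then obtain h where h: "h \<in> c" "h \<in> d" by auto
    from c(3)[OF h(1)] d(3)[OF h(2)] obtain i j
      where ij: "i \<le> k" "j \<le> k" "(e, h) \<in> adj c ^^ i" "(f, h) \<in> adj d ^^ j"
      by (elim exE conjE) (rule that)
    have "(e, h) \<in> adj X ^^ i" "(h, f) \<in> adj X ^^ j"
      by (rule adj_relpow_mono[OF c(1) ij(3)], rule adj_relpow_mono[OF d(1) adj_relpow_sym[OF ij(4)]])
    then have "(e, f) \<in> adj X ^^ (i + j)" by (auto simp: relpow_add)
    moreover have "e \<in> X" using assms(1) by (simp add: bridge_def)
    ultimately obtain l where "l \<le> i + j" "link l e f X"
      using adj_relpow_imp_link by metis
    then show ?thesis using ij(1,2) by (intro disjI2 bexI[of _ l]) auto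
  qed
qed

text \<open>Disjoint occurrences contribute at most the product of the probabilities, by the BK
  inequality; hence only pairs of edges at bounded distance matter.\<close>

lemma variance_bridges_le:
  fixes r n :: nat
  assumes "r \<ge> 1" "0 \<le> p" "p \<le> 1"
  defines "A \<equiv> complete_edges r n"
  shows "expect A p (\<lambda>X. (bridges k A X)\<^sup>2) - (expect A p (bridges k A))\<^sup>2
    \<le> real (n choose r) * p * (\<Sum>j\<le>2 * k. (p * r * ((n - 1) choose (r - 1))) ^ j)"
proof -
  let ?l = "p * r * ((n - 1) choose (r - 1))"
  let ?P = "\<lambda>e. probab A p (bridge k e)"
  have fin: "finite A" by (simp add: A_def)
  have pair: "probab A p (\<lambda>X. bridge k e X \<and> bridge k f X)
    \<le> ?P e * ?P f + (\<Sum>j\<le>2 * k. probab A p (link j e f))" for e f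
  proof -
    have "probab A p (\<lambda>X. bridge k e X \<and> bridge k f X)
      \<le> probab A p (\<lambda>X. box (bridge k e) (bridge k f) X \<or> (\<exists>j\<in>{..2 * k}. link j e f X))"
      by (rule probab_mono[OF assms(2,3)]) (elim conjE, rule bridge_pair_cases)
    also have "\<dots> \<le> probab A p (box (bridge k e) (bridge k f)) + probab A p (\<lambda>X. \<exists>j\<in>{..2 * k}. link j e f X)"
      by (rule probab_disj_le[OF assms(2,3)])
    also have "\<dots> \<le> ?P e * ?P f + (\<Sum>j\<le>2 * k. probab A p (link j e f))"
      by (rule add_mono[OF bk[OF fin assms(2,3) bridge_mono bridge_mono]
            probab_Bex_le[OF assms(2,3) finite_atMost]])
    finally show ?thesis .
  qed
  have "expect A p (\<lambda>X. (bridges k A X)\<^sup>2)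
    = expect A p (\<lambda>X. \<Sum>e\<in>A. \<Sum>f\<in>A. of_bool (bridge k e X \<and> bridge k f X))"
    unfolding bridges_def power2_eq_square sum_product of_bool_conj ..
  also have "\<dots> = (\<Sum>e\<in>A. \<Sum>f\<in>A. probab A p (\<lambda>X. bridge k e X \<and> bridge k f X))"
    by (simp only: expect_sum)
  also have "\<dots> \<le> (\<Sum>e\<in>A. \<Sum>f\<in>A. ?P e * ?P f + (\<Sum>j\<le>2 * k. probab A p (link j e f)))"
    by (intro sum_mono pair)
  also have "\<dots> = (\<Sum>e\<in>A. ?P e)\<^sup>2 + (\<Sum>e\<in>A. \<Sum>j\<le>2 * k. \<Sum>f\<in>A. probab A p (link j e f))"
    unfolding sum.distrib power2_eq_square sum_product
    by (intro arg_cong2[where f = "(+)"] refl sum.cong sum.swap)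
  also have "(\<Sum>e\<in>A. ?P e) = expect A p (bridges k A)"
    unfolding bridges_def by (rule expect_sum[symmetric])
  also have "(\<Sum>e\<in>A. \<Sum>j\<le>2 * k. \<Sum>f\<in>A. probab A p (link j e f)) \<le> (\<Sum>e\<in>A. \<Sum>j\<le>2 * k. p * ?l ^ j)"
    using assms unfolding A_def by (intro sum_mono sum_probab_link_le) auto
  also have "\<dots> = real (n choose r) * p * (\<Sum>j\<le>2 * k. ?l ^ j)"
    by (simp add: A_def card_complete_edges sum_distrib_left mult.assoc)
  finally show ?thesis by simp
qed

section \<open>Loose paths and cycles\<close>

text \<open>The form in which loose paths supply trails: edge \<open>e i\<close> is entered at
  \<open>c (i - 1)\<close> and left at \<open>c i\<close>.\<close>

lemma trail_image:
  assumes "inj_on e {1..k}" "\<And>i. i \<in> {1..k} \<Longrightarrow> c (i - 1) \<in> e i \<and> c i \<in> e i \<and> c (i - 1) \<noteq> c i"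
  shows "trail k (c 0) (e ` {1..k})"
  using assms
proof (induction k arbitrary: c e)
  case (Suc k)
  have "trail k (c 1) ((\<lambda>i. e (Suc i)) ` {1..k})"
  proof -
    have "trail k ((\<lambda>i. c (Suc i)) 0) ((\<lambda>i. e (Suc i)) ` {1..k})"
    proof (rule Suc.IH)
      show "inj_on (\<lambda>i. e (Suc i)) {1..k}" using Suc.prems(1) by (intro inj_onI) (auto dest: inj_onD)
      fix i assume "i \<in> {1..k}"
      then show "c (Suc (i - 1)) \<in> e (Suc i) \<and> c (Suc i) \<in> e (Suc i) \<and> c (Suc (i - 1)) \<noteq> c (Suc i)"
        using Suc.prems(2)[of "Suc i"] by simp
    qed
    then show ?thesis by simp
  qed
  moreover have "(\<lambda>i. e (Suc i)) ` {1..k} \<subseteq> e ` {1..Suc k} - {e 1}"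
    by (auto dest!: inj_onD[OF Suc.prems(1)])
  ultimately have "trail k (c 1) (e ` {1..Suc k} - {e 1})" by (rule trail_mono[rotated])
  moreover have "c 0 \<in> e 1" "c 1 \<in> e 1" "c 0 \<noteq> c 1" using Suc.prems(2)[of 1] by auto
  ultimately show ?case
    unfolding trail.simps by (intro bexI[of _ "e 1"] conjI bexI[of _ "c 1"]) auto
qed auto

lemma loose_path_inj_edges:
  assumes "r \<ge> 2" "loose_path r V E l v e"
  shows "inj_on e {1..l}"
proof (rule inj_onI)
  fix i j assume ij: "i \<in> {1..l}" "j \<in> {1..l}" "e i = e j"
  let ?I = "\<lambda>i. {(i - 1) * (r - 1) + 1..(i - 1) * (r - 1) + r}"
  have sub: "?I i \<subseteq> {1..l * (r - 1) + 1}" if "i \<in> {1..l}" for i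
  proof -
    have "(i - 1) * (r - 1) + (r - 1) \<le> l * (r - 1)"
      using that mult_le_mono1[of i l "r - 1"] by (cases i) auto
    then show ?thesis using assms(1) by auto
  qed
  have "v ` ?I i = v ` ?I j" using assms(2) ij unfolding loose_path_def by metis
  then have "?I i = ?I j"
    using inj_on_image_eq_iff[OF _ sub[OF ij(1)] sub[OF ij(2)]] assms(2) unfolding loose_path_def by blast
  then have "(i - 1) * (r - 1) = (j - 1) * (r - 1)"
    using assms(1) by (auto simp: Icc_eq_Icc)
  then show "i = j" using assms(1) ij by auto
qed

lemma loose_path_length:
  assumes "finite V" "loose_path r V E l v e"
  shows "l * (r - 1) + 1 \<le> card V"
proof -
  have "v ` {1..l * (r - 1) + 1} \<subseteq> V" "inj_on v {1..l * (r - 1) + 1}"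
    using assms(2) unfolding loose_path_def by blast+
  then have "card {1..l * (r - 1) + 1} \<le> card V" using assms(1) by (metis card_inj_on_le)
  then show ?thesis by simp
qed

lemma loose_path_bridges:
  fixes v :: "nat \<Rightarrow> 'v::linorder"
  assumes "r \<ge> 2" "loose_path r V E l v e" "E \<subseteq> A" "finite A"
  shows "real l \<le> bridges k A E + 2 * real k"
proof -
  \<comment> \<open>The vertices at which consecutive edges meet, together with the two endpoints
    \<open>c 0\<close> and \<open>c l\<close>.\<close>
  define c where "c = (\<lambda>i. v (i * (r - 1) + 1))"
  note inj = loose_path_inj_edges[OF assms(1,2)]
  have vinj: "inj_on v {1..l * (r - 1) + 1}" using assms(2) by (simp add: loose_path_def)
  have conn: "c (i - 1) \<in> e i \<and> c i \<in> e i \<and> c (i - 1) \<noteq> c i \<and> e i \<in> E" if i: "i \<in> {1..l}" for i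
  proof -
    obtain j where j: "i = Suc j" using i by (cases i) auto
    have e: "e i = v ` {(i - 1) * (r - 1) + 1..(i - 1) * (r - 1) + r}" "e i \<in> E"
      using assms(2) i unfolding loose_path_def by blast+
    have "i * (r - 1) \<le> l * (r - 1)" using i by (intro mult_le_mono1) auto
    moreover have "(i - 1) * (r - 1) < i * (r - 1)" using assms(1) j by simp
    ultimately have "c (i - 1) \<noteq> c i"
      unfolding c_def by (subst inj_on_eq_iff[OF vinj]) (simp_all del: mult_less_cancel2 mult_le_cancel2)
    then show ?thesis using e assms(1) j by (auto simp: c_def)
  qed
  have br: "bridge k (e i) E" if i: "i \<in> {k + 1..l - k}" for i
  proof -
    have L: "trail k (c (i - 1)) ((\<lambda>j. e (i - j)) ` {1..k})"
    proof -
      have "trail k ((\<lambda>j. c (i - 1 - j)) 0) ((\<lambda>j. e (i - j)) ` {1..k})"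
      proof (rule trail_image)
        show "inj_on (\<lambda>j. e (i - j)) {1..k}"
        proof (rule inj_onI)
          fix x y assume xy: "x \<in> {1..k}" "y \<in> {1..k}" "e (i - x) = e (i - y)"
          have "i - x = i - y" by (rule inj_onD[OF inj xy(3)]) (use xy i in auto)
          then show "x = y" using xy i by auto
        qed
        fix j assume j: "j \<in> {1..k}"
        then have "i - j \<in> {1..l}" using i by auto
        from conn[OF this] j show "c (i - 1 - (j - 1)) \<in> e (i - j) \<and> c (i - 1 - j) \<in> e (i - j) \<and> c (i - 1 - (j - 1)) \<noteq> c (i - 1 - j)"
          using i by auto
      qed
      then show ?thesis by simp
    qed
    have R: "trail k (c i) ((\<lambda>j. e (i + j)) ` {1..k})"
    proof -
      have "trail k ((\<lambda>j. c (i + j)) 0) ((\<lambda>j. e (i + j)) ` {1..k})"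
      proof (rule trail_image)
        show "inj_on (\<lambda>j. e (i + j)) {1..k}"
        proof (rule inj_onI)
          fix x y assume xy: "x \<in> {1..k}" "y \<in> {1..k}" "e (i + x) = e (i + y)"
          have "i + x = i + y" by (rule inj_onD[OF inj xy(3)]) (use xy i in auto)
          then show "x = y" using xy i by auto
        qed
        fix j assume j: "j \<in> {1..k}"
        then have "i + j \<in> {1..l}" using i by auto
        from conn[OF this] j show "c (i + (j - 1)) \<in> e (i + j) \<and> c (i + j) \<in> e (i + j) \<and> c (i + (j - 1)) \<noteq> c (i + j)"
          using i by auto
      qed
      then show ?thesis by simp
    qed
    let ?a = "(\<lambda>j. e (i - j)) ` {1..k}" and ?b = "(\<lambda>j. e (i + j)) ` {1..k}"
    have ne: "e x \<noteq> e y" if "x \<noteq> y" "x \<in> {1..l}" "y \<in> {1..l}" for x y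
      using inj_onD[OF inj, of x y] that by auto
    have "e (i - x) \<noteq> e (i + y)" if "x \<in> {1..k}" "y \<in> {1..k}" for x y
      by (rule ne) (use that i in auto)
    then have ab: "?a \<inter> ?b = {}" by blast
    have "e i \<noteq> e (i - x)" "e i \<noteq> e (i + x)" if "x \<in> {1..k}" for x
      by (rule ne; use that i in auto)+
    then have nab: "e i \<notin> ?a" "e i \<notin> ?b" by blast+
    have rng: "i - x \<in> {1..l}" "i + x \<in> {1..l}" if "x \<in> {1..k}" for x
      using that i by auto
    have sub: "?a \<subseteq> E" "?b \<subseteq> E" using conn rng by (meson image_subsetI)+
    have ci: "c (i - 1) \<in> e i" "c i \<in> e i" "e i \<in> E" "c (i - 1) \<noteq> c i"
    proof -
      have "i \<in> {1..l}" using i by auto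
      from conn[OF this] show "c (i - 1) \<in> e i" "c i \<in> e i" "e i \<in> E" "c (i - 1) \<noteq> c i" by auto
    qed
    show ?thesis
    \<comment> \<open>\<open>bridge\<close> wants its two vertices in increasing order, so the
      backward and the forward trail may have to swap roles.\<close>
    proof (cases "c (i - 1) < c i")
      case True
      show ?thesis
        unfolding bridge_def
        by (intro conjI ci bexI[OF _ ci(1)] bexI[OF _ ci(2)] True exI[of _ ?a] exI[of _ ?b] L R)
          (use ab nab sub in auto)
    next
      case False
      then have lt: "c i < c (i - 1)" using ci by auto
      show ?thesis
        unfolding bridge_def
        by (intro conjI ci bexI[OF _ ci(2)] bexI[OF _ ci(1)] lt exI[of _ ?b] exI[of _ ?a] L R)
          (use ab nab sub in auto)
    qed
  qed
  have "l - 2 * k = card {k + 1..l - k}" by simp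
  also have "\<dots> = card (e ` {k + 1..l - k})"
    by (rule card_image[symmetric], rule inj_on_subset[OF inj]) auto
  also have "\<dots> \<le> card (A \<inter> {x. bridge k x E})"
  proof (rule card_mono)
    show "finite (A \<inter> {x. bridge k x E})" using assms(4) by simp
    show "e ` {k + 1..l - k} \<subseteq> A \<inter> {x. bridge k x E}"
    proof (rule image_subsetI)
      fix i assume i: "i \<in> {k + 1..l - k}"
      then have "i \<in> {1..l}" by auto
      from conn[OF this] show "e i \<in> A \<inter> {x. bridge k x E}" using assms(3) br[OF i] by auto
    qed
  qed
  finally have "real l \<le> real (card (A \<inter> {x. bridge k x E})) + 2 * real k" by linarith
  also have "real (card (A \<inter> {x. bridge k x E})) = bridges k A E"
    using assms by (simp add: bridges_def)
  finally show ?thesis .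
qed

lemma L_P_le:
  fixes n :: nat
  assumes "r \<ge> 2" "n \<ge> 1" "\<And>l v e. loose_path r {1..n} E l v e \<Longrightarrow> l \<le> B"
  shows "L_P r {1..n} E \<le> B"
proof -
  let ?S = "{l. \<exists>v e. loose_path r {1..n} E l v e}"
  have le: "l \<le> B" if "l \<in> ?S" for l using that assms(3) by blast
  then have "finite ?S" by (intro finite_subset[of ?S "{..B}"]) auto
  moreover have "loose_path r {1..n} E 0 (\<lambda>_. 1) (\<lambda>_. {})"
    using assms(2) by (simp add: loose_path_def)
  then have "?S \<noteq> {}" by blast
  ultimately show ?thesis unfolding L_P_def using le by (subst Max_le_iff) auto
qed

lemma L_P_ge:
  fixes n :: nat
  assumes "r \<ge> 2" "loose_path r {1..n} E l v e"
  shows "l \<le> L_P r {1..n} E"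
proof -
  have "l \<le> n" if "loose_path r {1..n} E l v e" for l v e
  proof -
    have "1 \<le> r - 1" using assms(1) by simp
    then have "l * 1 \<le> l * (r - 1)" by (rule mult_le_mono2)
    also have "\<dots> \<le> n" using loose_path_length[OF _ that] by simp
    finally show ?thesis by (simp only: mult_1_right)
  qed
  then have "{l. \<exists>v e. loose_path r {1..n} E l v e} \<subseteq> {..n}" by blast
  then have "finite {l. \<exists>v e. loose_path r {1..n} E l v e}" by (rule finite_subset) simp
  then show ?thesis unfolding L_P_def using assms by (intro Max_ge) auto
qed

lemma loose_cycle_length:
  assumes "finite V" "loose_cycle r V E l v e"
  shows "l * (r - 1) \<le> card V"
proof -
  have "v ` {1..l * (r - 1) + 1} \<subseteq> V" "inj_on v {1..l * (r - 1)}"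
    using assms(2) unfolding loose_cycle_def by blast+
  moreover from this have "v ` {1..l * (r - 1)} \<subseteq> V" by auto
  ultimately have "card {1..l * (r - 1)} \<le> card V" using assms(1) by (metis card_inj_on_le)
  then show ?thesis by simp
qed

lemma finite_cycle_lengths:
  fixes n :: nat
  assumes "r \<ge> 2"
  shows "finite {l. \<exists>v e. loose_cycle r {1..n} E l v e}"
proof -
  have "l \<le> n" if "loose_cycle r {1..n} E l v e" for l v e
  proof -
    have "1 \<le> r - 1" using assms(1) by simp
    then have "l * 1 \<le> l * (r - 1)" by (rule mult_le_mono2)
    also have "\<dots> \<le> n" using loose_cycle_length[OF _ that] by simp
    finally show ?thesis by (simp only: mult_1_right)
  qed
  then have "{l. \<exists>v e. loose_cycle r {1..n} E l v e} \<subseteq> {..n}" by blast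
  then show ?thesis by (rule finite_subset) simp
qed

lemma L_C_ge:
  fixes n :: nat
  assumes "r \<ge> 2" "loose_cycle r {1..n} E l v e"
  shows "l \<le> L_C r {1..n} E"
  unfolding L_C_def using assms finite_cycle_lengths by (intro Max_ge) auto

text \<open>Deleting the last edge of a cycle leaves a loose path: its vertices are among the first
  \<open>l * (r - 1)\<close>, where the cycle is injective.\<close>

lemma L_C_le_L_P:
  fixes n :: nat
  assumes "r \<ge> 2"
  shows "L_C r {1..n} E \<le> L_P r {1..n} E + 1"
proof -
  have "L_C r {1..n} E \<in> insert 0 {l. \<exists>v e. loose_cycle r {1..n} E l v e}"
    unfolding L_C_def using finite_cycle_lengths[OF assms] by (intro Max_in) auto
  moreover have "l \<le> L_P r {1..n} E + 1" if c: "loose_cycle r {1..n} E l v e" for l v e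
  proof -
    obtain m where m: "l = Suc m" using c unfolding loose_cycle_def by (cases l) auto
    have sub: "{1..m * (r - 1) + 1} \<subseteq> {1..l * (r - 1)}" using assms m by auto
    have "loose_path r {1..n} E m v e"
      unfolding loose_path_def
    proof (intro conjI)
      show "v ` {1..m * (r - 1) + 1} \<subseteq> {1..n}" using c sub unfolding loose_cycle_def by fastforce
      show "inj_on v {1..m * (r - 1) + 1}" using c inj_on_subset[OF _ sub] unfolding loose_cycle_def by blast
      show "\<forall>i\<in>{1..m}. e i = v ` {(i - 1) * (r - 1) + 1..(i - 1) * (r - 1) + r} \<and> e i \<in> E"
        using c m unfolding loose_cycle_def by (metis atLeastAtMost_iff le_SucI)
    qed
    then show ?thesis using L_P_ge[OF assms] m by auto
  qed
  ultimately show ?thesis by auto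
qed

section \<open>The survival probability\<close>

lemma binomial_ge_linear:
  assumes "1 \<le> d" "d \<le> m"
  shows "real m / real d \<le> real (m choose d)"
proof -
  have "1 \<le> real m / real d" using assms by simp
  then have "(real m / real d) ^ 1 \<le> (real m / real d) ^ d"
    using assms by (intro power_increasing) auto
  also have "\<dots> \<le> real (m choose d)"
    using binomial_ge_n_over_k_pow_k[OF assms(2), where 'a = real] .
  finally show ?thesis by simp
qed

text \<open>The quadratic coefficient must be exact, since it enters the constant
  \<open>2 / d\<close> of the survival probability; the cubic error may be crude.\<close>

lemma one_minus_power_ge:
  fixes x :: real
  assumes "0 \<le> x" "x \<le> 1"
  shows "1 - d * x + (real d * (real d - 1) / 2) * x\<^sup>2 - real d ^ 3 * x ^ 3 \<le> (1 - x) ^ d"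
proof (induction d)
  case (Suc d)
  have "1 - Suc d * x + (real (Suc d) * (real (Suc d) - 1) / 2) * x\<^sup>2 - real (Suc d) ^ 3 * x ^ 3
    \<le> (1 - x) * (1 - d * x + (real d * (real d - 1) / 2) * x\<^sup>2 - real d ^ 3 * x ^ 3)"
  proof -
    have "(1 - x) * (1 - d * x + (real d * (real d - 1) / 2) * x\<^sup>2 - real d ^ 3 * x ^ 3)
      - (1 - Suc d * x + (real (Suc d) * (real (Suc d) - 1) / 2) * x\<^sup>2 - real (Suc d) ^ 3 * x ^ 3)
      = (3 * real d ^ 2 + 3 * real d + 1 - real d * (real d - 1) / 2) * x ^ 3 + real d ^ 3 * x ^ 4"
      by (simp add: field_simps power2_eq_square power3_eq_cube power4_eq_xxxx)
    moreover have "real d * (real d - 1) / 2 \<le> 3 * real d ^ 2 + 3 * real d + 1"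
      by (simp add: field_simps power2_eq_square)
    then have "0 \<le> (3 * real d ^ 2 + 3 * real d + 1 - real d * (real d - 1) / 2) * x ^ 3"
      using assms by (intro mult_nonneg_nonneg) auto
    ultimately show ?thesis using assms by (smt (verit) mult_nonneg_nonneg zero_le_power of_nat_0_le_iff)
  qed
  also have "\<dots> \<le> (1 - x) * (1 - x) ^ d"
    using Suc assms by (intro mult_left_mono) auto
  finally show ?case by simp
qed auto

lemma minus_ln_one_minus_ge:
  fixes x :: real
  assumes "0 \<le> x" "x < 1"
  shows "x + x\<^sup>2 / 2 \<le> - ln (1 - x)"
proof -
  let ?g = "\<lambda>t::real. - ln (1 - t) - t - t\<^sup>2 / 2"
  have "?g 0 \<le> ?g x"
  proof (rule DERIV_nonneg_imp_nondecreasing[OF assms(1)])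
    fix t assume t: "0 \<le> t" "t \<le> x"
    have "(?g has_real_derivative 1 / (1 - t) - 1 - t) (at t)"
      using t assms by (auto intro!: derivative_eq_intros simp: field_simps)
    moreover have "0 \<le> 1 / (1 - t) - 1 - t"
      using t assms by (simp add: field_simps)
    ultimately show "\<exists>y. (?g has_real_derivative y) (at t) \<and> 0 \<le> y" by blast
  qed
  then show ?thesis by simp
qed

section \<open>Comparison with Poisson branching\<close>

text \<open>Survival for \<open>k\<close> generations when the number of litters is Poisson with
  mean \<open>l\<close>. It does not involve \<open>n\<close>, so the depth \<open>k\<close> can be
  fixed before \<open>n\<close> grows.\<close>

primrec poisson_survival :: "real \<Rightarrow> nat \<Rightarrow> nat \<Rightarrow> real" where
  "poisson_survival l d 0 = 1"
| "poisson_survival l d (Suc k) = 1 - exp (- (l * (1 - (1 - poisson_survival l d k) ^ d)))"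

lemma poisson_survival_bounds:
  assumes "0 \<le> l"
  shows "0 \<le> poisson_survival l d k \<and> poisson_survival l d k \<le> 1"
proof (induction k)
  case (Suc k)
  have "(1 - poisson_survival l d k) ^ d \<le> 1" using Suc by (auto intro: power_le_one)
  then show ?case using assms by auto
qed auto

text \<open>At equal means the binomial process survives more easily than the Poisson one. The
  factor \<open>1 + 2 * p\<close> compensates, through the bound \<open>y + 2 * y\<^sup>2\<close>
  for \<open>- ln (1 - y)\<close>.\<close>

lemma survival_le_poisson_survival:
  assumes "0 \<le> p" "p \<le> 1/2" "real M * p * (1 + 2 * p) \<le> l" "0 < l"
  shows "survival p M d k \<le> poisson_survival l d k"
proof (induction k)
  case (Suc k)
  let ?s = "survival p M d k" and ?t = "poisson_survival l d k"
  define h where "h = 1 - (1 - ?s) ^ d"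
  define h' where "h' = 1 - (1 - ?t) ^ d"
  have s: "0 \<le> ?s" "?s \<le> 1" using survival_bounds[of p M d k] assms by auto
  have t: "0 \<le> ?t" "?t \<le> 1" using poisson_survival_bounds[of l d k] assms by auto
  have h: "0 \<le> h" "h \<le> 1" unfolding h_def using s by (auto intro: power_le_one)
  have hh: "h \<le> h'" unfolding h_def h'_def using Suc t by (auto intro!: power_mono)
  define y where "y = p * h"
  have y: "0 \<le> y" "y \<le> p" unfolding y_def using assms h by (auto intro: mult_left_le)
  have "- y - 2 * y\<^sup>2 \<le> ln (1 - y)" using y assms by (intro ln_one_minus_pos_lower_bound) auto
  then have "real M * (- y - 2 * y\<^sup>2) \<le> real M * ln (1 - y)" by (intro mult_left_mono) auto
  moreover have "real M * (y + 2 * y\<^sup>2) \<le> l * h'"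
  proof -
    have "real M * (y + 2 * y\<^sup>2) = real M * p * (1 + 2 * y) * h"
      by (simp add: y_def power2_eq_square algebra_simps)
    also have "\<dots> \<le> real M * p * (1 + 2 * p) * h"
      using y assms h by (intro mult_right_mono mult_left_mono) auto
    also have "\<dots> \<le> l * h'" using assms h hh by (intro mult_mono) auto
    finally show ?thesis .
  qed
  ultimately have "- (l * h') \<le> real M * ln (1 - y)" by (simp add: algebra_simps)
  then have "exp (- (l * h')) \<le> exp (real M * ln (1 - y))" by simp
  also have "\<dots> = (1 - y) ^ M" using y assms by (simp add: exp_of_nat_mult)
  finally show ?case by (simp add: y_def h_def h'_def)
qed auto

text \<open>Take logarithms in the fixed-point equation and divide by \<open>x\<close>. To first
  order this yields \<open>x \<le> 2 * e\<close>. To second order, \<open>x / 2\<close> from the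
  logarithm and \<open>(d - 1) / 2 * x\<close> from the power add up to \<open>d / 2 * x\<close>,
  which is thus at most \<open>e\<close> plus an error of order \<open>x\<^sup>2\<close>; the crude
  bound controls that error.\<close>

lemma poisson_survival_fixpoint_le:
  assumes d: "d \<ge> 1" and e: "0 < e" "e \<le> 1" and x: "0 \<le> x" "x \<le> 1"
    and fp: "x = 1 - exp (- ((1 + e) / real d * (1 - (1 - x) ^ d)))"
  shows "x \<le> 2 * e / d + 16 * d * e\<^sup>2"
proof (cases "x = 0")
  case True
  then show ?thesis using e by simp
next
  case False
  then have x0: "0 < x" using x by simp
  have ex: "1 - x = exp (- ((1 + e) / real d * (1 - (1 - x) ^ d)))" using fp by linarith
  have x1: "x < 1" using ex exp_gt_zero[of "- ((1 + e) / real d * (1 - (1 - x) ^ d))"] by linarith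
  have eq: "- ln (1 - x) = (1 + e) / real d * (1 - (1 - x) ^ d)"
    by (subst ex) (simp only: ln_exp minus_minus)
  have "1 - d * x \<le> (1 - x) ^ d"
    using Bernoulli_inequality[of "- x" d] x by simp
  then have "(1 + e) / real d * (1 - (1 - x) ^ d) \<le> (1 + e) / real d * (d * x)"
    using e d by (intro mult_left_mono) auto
  then have "x + x\<^sup>2 / 2 \<le> (1 + e) * x"
    using minus_ln_one_minus_ge[OF x(1) x1] eq d by simp
  then have "x * (x / 2) \<le> x * e" by (simp add: power2_eq_square algebra_simps)
  then have crude: "x \<le> 2 * e" using x0 by simp
  have "1 - (1 - x) ^ d \<le> d * x - (real d * (real d - 1) / 2) * x\<^sup>2 + real d ^ 3 * x ^ 3"
    using one_minus_power_ge[OF x, of d] d by (simp add: of_nat_diff)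
  then have "(1 + e) / real d * (1 - (1 - x) ^ d)
    \<le> (1 + e) / real d * (d * x - (real d * (real d - 1) / 2) * x\<^sup>2 + real d ^ 3 * x ^ 3)"
    using e d by (intro mult_left_mono) auto
  also have "\<dots> = x * ((1 + e) * (1 - (real d - 1) / 2 * x + real d ^ 2 * x ^ 2))"
    using d by (simp add: of_nat_diff field_simps power2_eq_square power3_eq_cube)
  finally have "- ln (1 - x) \<le> x * ((1 + e) * (1 - (real d - 1) / 2 * x + real d ^ 2 * x ^ 2))"
    unfolding eq .
  moreover have "x * (1 + x / 2) = x + x\<^sup>2 / 2" by (simp add: power2_eq_square algebra_simps)
  ultimately have "x * (1 + x / 2) \<le> x * ((1 + e) * (1 - (real d - 1) / 2 * x + real d ^ 2 * x ^ 2))"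
    using minus_ln_one_minus_ge[OF x(1) x1] by linarith
  then have "1 + x / 2 \<le> (1 + e) * (1 - (real d - 1) / 2 * x + real d ^ 2 * x ^ 2)"
    using x0 by simp
  moreover define P where "P = (real d - 1) / 2 * x"
  moreover define Q where "Q = real d ^ 2 * x ^ 2"
  ultimately have "1 + x / 2 \<le> (1 + e) * (1 - P + Q)" by (simp only: P_def Q_def)
  moreover have "(1 + e) * (1 - P + Q) = (1 + e) - (1 + e) * P + (1 + e) * Q"
    by (simp add: algebra_simps)
  moreover have "1 * P \<le> (1 + e) * P"
    unfolding P_def using e d x by (intro mult_right_mono) auto
  moreover have "(1 + e) * Q \<le> 2 * (real d ^ 2 * (2 * e) ^ 2)"
    unfolding Q_def using e crude x by (intro mult_mono power_mono) auto
  ultimately have "x / 2 + P \<le> e + 2 * (real d ^ 2 * (2 * e) ^ 2)" by linarith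
  moreover have "x / 2 + P = d / 2 * x" by (simp add: P_def field_simps)
  ultimately have "d / 2 * x \<le> e + 8 * real d ^ 2 * e\<^sup>2" by (simp add: power_mult_distrib)
  then show ?thesis using d by (simp add: field_simps power2_eq_square)
qed

text \<open>The sequence decreases, and by continuity its limit is a fixed point of the
  recursion.\<close>

lemma poisson_survival_eventually_le:
  assumes d: "d \<ge> 1" and e: "0 < e" "e \<le> 1" and "0 < c"
  shows "\<exists>k. poisson_survival ((1 + e) / real d) d k \<le> 2 * e / d + 16 * d * e\<^sup>2 + c"
proof -
  let ?l = "(1 + e) / real d"
  let ?s = "poisson_survival ?l d"
  have l: "0 \<le> ?l" using e by simp
  note b = poisson_survival_bounds[OF l, of d]
  have dec: "?s (Suc k) \<le> ?s k" for k
  proof (induction k)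
    case 0
    then show ?case using b[of "Suc 0"] by simp
  next
    case (Suc k)
    have "(1 - ?s k) ^ d \<le> (1 - ?s (Suc k)) ^ d"
      using Suc b[of k] by (intro power_mono) auto
    then have "?l * (1 - (1 - ?s (Suc k)) ^ d) \<le> ?l * (1 - (1 - ?s k) ^ d)"
      using l by (intro mult_left_mono) auto
    then show ?case by (simp only: poisson_survival.simps(2)) simp
  qed
  have "decseq ?s" using dec by (rule decseq_SucI)
  moreover have "\<forall>k. 0 \<le> ?s k" using b by blast
  ultimately obtain x where x: "?s \<longlonglongrightarrow> x" "\<forall>k. x \<le> ?s k"
    by (rule decseq_convergent)
  have "0 \<le> x" using x(1) b by (intro LIMSEQ_le_const[of ?s]) auto
  moreover have "x \<le> 1" using x(2) b[of 0] by (metis order_trans)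
  moreover have "(\<lambda>k. ?s (Suc k)) \<longlonglongrightarrow> 1 - exp (- (?l * (1 - (1 - x) ^ d)))"
    unfolding poisson_survival.simps(2) by (intro tendsto_intros x(1))
  then have "x = 1 - exp (- (?l * (1 - (1 - x) ^ d)))"
    using LIMSEQ_unique LIMSEQ_Suc[OF x(1)] by blast
  ultimately have "x \<le> 2 * e / d + 16 * d * e\<^sup>2"
    using d e by (intro poisson_survival_fixpoint_le) auto
  then have "x < 2 * e / d + 16 * d * e\<^sup>2 + c" using assms(4) by simp
  then have "eventually (\<lambda>k. ?s k < 2 * e / d + 16 * d * e\<^sup>2 + c) sequentially"
    using x(1) by (intro order_tendstoD)
  then show ?thesis by (auto simp: eventually_sequentially intro: less_imp_le)
qed

section \<open>The upper tail\<close>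

definition edge_prob :: "nat \<Rightarrow> real \<Rightarrow> nat \<Rightarrow> real" where
  "edge_prob r \<epsilon> n = (1 + \<epsilon>) / ((real r - 1) * real ((n - 1) choose (r - 1)))"

lemma edge_prob_degree:
  assumes "r \<ge> 2" "r \<le> n"
  shows "real ((n - 1) choose (r - 1)) * edge_prob r \<epsilon> n = (1 + \<epsilon>) / (real r - 1)"
proof -
  have "0 < (n - 1) choose (r - 1)" using assms by simp
  then show ?thesis by (simp add: edge_prob_def)
qed

lemma edge_prob_edges:
  assumes "r \<ge> 2" "r \<le> n"
  shows "real (n choose r) * edge_prob r \<epsilon> n = real n * ((1 + \<epsilon>) / (real r * (real r - 1)))"
proof -
  have "r * (n choose r) = n * ((n - 1) choose (r - 1))"
    using assms by (intro times_binomial_minus1_eq) auto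
  then have "real r * real (n choose r) = real n * real ((n - 1) choose (r - 1))"
    by (metis of_nat_mult)
  then have "real r * (real (n choose r) * edge_prob r \<epsilon> n)
    = real n * (real ((n - 1) choose (r - 1)) * edge_prob r \<epsilon> n)"
    by (metis mult.assoc)
  also have "\<dots> = real n * ((1 + \<epsilon>) / (real r - 1))"
    using edge_prob_degree[OF assms] by simp
  finally show ?thesis using assms by (simp add: field_simps)
qed

lemma edge_prob_bounds:
  assumes "r \<ge> 2" "r \<le> n" "0 < \<epsilon>"
  shows "0 < edge_prob r \<epsilon> n" "edge_prob r \<epsilon> n \<le> (1 + \<epsilon>) / real (n - 1)"
proof -
  have pos: "0 < real ((n - 1) choose (r - 1))" using assms by simp
  then show "0 < edge_prob r \<epsilon> n" using assms by (simp add: edge_prob_def)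
  have "real (n - 1) / real (r - 1) \<le> real ((n - 1) choose (r - 1))"
    using assms by (intro binomial_ge_linear) auto
  then have "real (n - 1) \<le> (real r - 1) * real ((n - 1) choose (r - 1))"
    using assms by (simp add: field_simps of_nat_diff)
  then show "edge_prob r \<epsilon> n \<le> (1 + \<epsilon>) / real (n - 1)"
    unfolding edge_prob_def using assms pos by (intro divide_left_mono) auto
qed

lemma L_P_le_bridges:
  fixes n :: nat
  assumes "r \<ge> 2" "n \<ge> 1" "E \<subseteq> complete_edges r n"
  shows "real (L_P r {1..n} E) \<le> bridges k (complete_edges r n) E + 2 * real k"
proof -
  let ?x = "bridges k (complete_edges r n) E + 2 * real k"
  have "0 \<le> ?x" by (simp add: bridges_def sum_nonneg)
  have "L_P r {1..n} E \<le> nat \<lfloor>?x\<rfloor>"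
    using assms loose_path_bridges[OF assms(1) _ assms(3)]
    by (intro L_P_le le_nat_floor) auto
  then have "real (L_P r {1..n} E) \<le> real (nat \<lfloor>?x\<rfloor>)" by simp
  also have "\<dots> \<le> ?x" using \<open>0 \<le> ?x\<close> by (intro of_nat_floor)
  finally show ?thesis .
qed

lemma upper_tail:
  fixes r :: nat
  assumes "r \<ge> 3"
  shows "\<exists>K>0. \<forall>\<epsilon>::real. 0 < \<epsilon> \<longrightarrow> \<epsilon> \<le> 1/2 \<longrightarrow>
    (\<lambda>n. probab (complete_edges r n) (edge_prob r \<epsilon> n)
       (\<lambda>E. \<not> real (L_P r {1..n} E + 1) \<le> (2 * \<epsilon>\<^sup>2 / (real r - 1)\<^sup>2 + K * \<epsilon> ^ 3) * real n))
      \<longlonglongrightarrow> 0"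
proof -
  define d where "d = real (r - 1)"
  have d: "d = real r - 1" "d \<ge> 2" using assms by (auto simp: d_def of_nat_diff)
  \<comment> \<open>\<open>36 * d\<close> is \<open>16 * d * (3/2)\<^sup>2\<close>; the two further
    units pay for \<open>2 / d \<le> 1\<close> and for the slack \<open>\<epsilon>\<^sup>2\<close>
    in the choice of \<open>k\<close>. The value of \<open>K0\<close> is
    \<open>1 + (2 * B + B\<^sup>2)\<close>, as collected in \<open>mean\<close>.\<close>
  define B where "B = 36 * d + 2"
  define K0 where "K0 = (1 + B)\<^sup>2"
  show ?thesis
  proof (intro exI[of _ "K0 + 1"] conjI allI impI)
    show "0 < K0 + 1" unfolding K0_def by (simp add: add_nonneg_pos)
  next
    fix \<epsilon> :: real assume e: "0 < \<epsilon>" "\<epsilon> \<le> 1/2"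
    \<comment> \<open>The extra \<open>\<epsilon>\<^sup>2\<close> pays for the factor
      \<open>1 + 2 * p\<close> in the Poisson comparison as soon as
      \<open>2 * (1 + \<epsilon>) * p \<le> \<epsilon>\<^sup>2\<close>.\<close>
    define e' where "e' = \<epsilon> + \<epsilon>\<^sup>2"
    have "\<epsilon> * \<epsilon> \<le> 1/2 * (1/2)" using e by (intro mult_mono) auto
    then have e': "0 < e'" "e' \<le> 1"
      using e by (auto simp: e'_def power2_eq_square intro!: add_pos_pos)
    let ?l = "(1 + e') / real (r - 1)"
    have "1 \<le> r - 1" "0 < \<epsilon>\<^sup>2" using assms e by auto
    from poisson_survival_eventually_le[OF this(1) e' this(2)]
    obtain k where "poisson_survival ?l (r - 1) k \<le> 2 * e' / real (r - 1) + 16 * real (r - 1) * e'\<^sup>2 + \<epsilon>\<^sup>2"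
      by (auto simp only:)
    moreover define t where "t = poisson_survival ?l (r - 1) k"
    ultimately have t1: "t \<le> 2 * e' / d + 16 * d * e'\<^sup>2 + \<epsilon>\<^sup>2" by (simp add: d_def)
    have t0: "0 \<le> t" unfolding t_def using poisson_survival_bounds[of ?l] e' by auto
    have t2: "t \<le> 2 * \<epsilon> / d + B * \<epsilon>\<^sup>2"
    proof -
      have "e' = \<epsilon> * (1 + \<epsilon>)" by (simp add: e'_def power2_eq_square algebra_simps)
      then have "e'\<^sup>2 = \<epsilon>\<^sup>2 * (1 + \<epsilon>)\<^sup>2" by (simp add: power_mult_distrib)
      also have "\<dots> \<le> \<epsilon>\<^sup>2 * (3/2)\<^sup>2" using e by (intro mult_left_mono power_mono) auto
      finally have "16 * d * e'\<^sup>2 \<le> 16 * d * (\<epsilon>\<^sup>2 * (3/2)\<^sup>2)" using d by (intro mult_left_mono) auto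
      moreover have "2 * e' / d = 2 * \<epsilon> / d + 2 / d * \<epsilon>\<^sup>2" by (simp add: e'_def add_divide_distrib)
      moreover have "2 / d * \<epsilon>\<^sup>2 \<le> 1 * \<epsilon>\<^sup>2" using d by (intro mult_right_mono) auto
      ultimately show ?thesis using t1 by (simp add: B_def power2_eq_square algebra_simps)
    qed
    have mean: "(1 + \<epsilon>) / 2 * t\<^sup>2 \<le> 2 * \<epsilon>\<^sup>2 / d\<^sup>2 + K0 * \<epsilon> ^ 3"
    proof -
      have "t\<^sup>2 \<le> (2 * \<epsilon> / d + B * \<epsilon>\<^sup>2)\<^sup>2" using t0 t2 by (intro power_mono)
      also have "\<dots> = 4 * \<epsilon>\<^sup>2 / d\<^sup>2 + 4 / d * B * \<epsilon> ^ 3 + B\<^sup>2 * \<epsilon> ^ 4"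
        by (simp add: power2_eq_square power3_eq_cube power4_eq_xxxx algebra_simps)
      also have "\<dots> \<le> 4 * \<epsilon>\<^sup>2 / d\<^sup>2 + 2 * B * \<epsilon> ^ 3 + B\<^sup>2 * \<epsilon> ^ 3"
      proof (intro add_mono order_refl mult_right_mono mult_left_mono)
        show "\<epsilon> ^ 4 \<le> \<epsilon> ^ 3" using e by (intro power_decreasing) auto
        show "4 / d \<le> 2" using d(2) by (simp add: field_simps)
      qed (use d e in \<open>auto simp: B_def\<close>)
      finally have "(1 + \<epsilon>) / 2 * t\<^sup>2 \<le> (1 + \<epsilon>) / 2 * (4 * \<epsilon>\<^sup>2 / d\<^sup>2 + 2 * B * \<epsilon> ^ 3 + B\<^sup>2 * \<epsilon> ^ 3)"
        using e by (intro mult_left_mono) auto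
      also have "\<dots> = 2 * \<epsilon>\<^sup>2 / d\<^sup>2 + 2 / d\<^sup>2 * \<epsilon> ^ 3 + (1 + \<epsilon>) / 2 * ((2 * B + B\<^sup>2) * \<epsilon> ^ 3)"
        using d(2) by (simp add: power2_eq_square power3_eq_cube field_simps)
      also have "\<dots> \<le> 2 * \<epsilon>\<^sup>2 / d\<^sup>2 + 1 * \<epsilon> ^ 3 + 1 * ((2 * B + B\<^sup>2) * \<epsilon> ^ 3)"
      proof (intro add_mono order_refl mult_right_mono)
        have "2 * 1 \<le> d * d" using d by (intro mult_mono) auto
        then show "2 / d\<^sup>2 \<le> 1" using d by (simp add: power2_eq_square)
      qed (use d e in \<open>auto simp: B_def\<close>)
      finally show ?thesis by (simp add: K0_def power2_eq_square algebra_simps)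
    qed
    define S where "S = (\<Sum>j\<le>2 * k. (real r * ((1 + \<epsilon>) / d)) ^ j)"
    define C where "C = (1 + \<epsilon>) / (real r * d) * S * 4 / \<epsilon> ^ 6"
    \<comment> \<open>The three thresholds ensure \<open>r < n\<close>, a small edge probability,
      and that the \<open>2 * k\<close> end edges plus one amount to at most
      \<open>\<epsilon> ^ 3 * n / 2\<close>.\<close>
    define n0 where "n0 = max (real r + 1) (max (5 / \<epsilon>\<^sup>2 + 1) ((4 * real k + 2) / \<epsilon> ^ 3))"
    have bound: "probab (complete_edges r n) (edge_prob r \<epsilon> n)
       (\<lambda>E. \<not> real (L_P r {1..n} E + 1) \<le> (2 * \<epsilon>\<^sup>2 / (real r - 1)\<^sup>2 + (K0 + 1) * \<epsilon> ^ 3) * real n)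
       \<le> C / real n" if n: "real n \<ge> n0" for n
    proof -
      let ?p = "edge_prob r \<epsilon> n" and ?A = "complete_edges r n" and ?M = "(n - 1) choose (r - 1)"
      let ?N = "bridges k ?A"
      have n1: "r \<le> n" "n \<ge> 1" using n assms by (auto simp: n0_def)
      have "5 / \<epsilon>\<^sup>2 \<le> real n - 1" using n by (auto simp: n0_def)
      then have n2: "5 \<le> \<epsilon>\<^sup>2 * (real n - 1)" using e by (simp add: field_simps)
      have n3: "4 * real k + 2 \<le> \<epsilon> ^ 3 * real n" using n e by (simp add: n0_def field_simps)
      have r2: "2 \<le> r" using assms by simp
      note p = edge_prob_bounds[OF r2 n1(1) e(1)]
      have nm: "real (n - 1) = real n - 1" "0 < real n - 1" using n1 assms by (auto simp: of_nat_diff)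
      have p2: "2 * (1 + \<epsilon>) * ?p \<le> \<epsilon>\<^sup>2"
      proof -
        have "2 * (1 + \<epsilon>) * ?p \<le> 2 * (1 + \<epsilon>) * ((1 + \<epsilon>) / (real n - 1))"
          using p e nm by (intro mult_left_mono) auto
        also have "\<dots> = 2 * ((1 + \<epsilon>) * (1 + \<epsilon>)) / (real n - 1)" by simp
        also have "\<dots> \<le> 5 / (real n - 1)"
        proof -
          have "(1 + \<epsilon>) * (1 + \<epsilon>) \<le> (3/2) * (3/2)" using e by (intro mult_mono) auto
          then show ?thesis using nm by (intro divide_right_mono) auto
        qed
        also have "\<dots> \<le> \<epsilon>\<^sup>2" using n2 nm by (simp add: field_simps)
        finally show ?thesis .
      qed
      have "2 * 1 * ?p \<le> 2 * (1 + \<epsilon>) * ?p" using p e by (intro mult_right_mono mult_left_mono) auto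
      moreover have "\<epsilon>\<^sup>2 \<le> 1" using e by (simp add: power_le_one)
      ultimately have ph: "?p \<le> 1/2" using p2 by linarith
      then have p1: "0 \<le> ?p" "?p \<le> 1" using p by auto
      have deg: "real ?M * ?p = (1 + \<epsilon>) / d" using edge_prob_degree[OF r2 n1(1)] by (simp add: d)
      have "survival ?p ?M (r - 1) k \<le> t"
        unfolding t_def
      proof (rule survival_le_poisson_survival[OF p1(1) ph])
        have "real ?M * ?p * (1 + 2 * ?p) = ((1 + \<epsilon>) + 2 * (1 + \<epsilon>) * ?p) / d"
          unfolding deg using d(2) by (simp add: field_simps)
        also have "\<dots> \<le> (1 + e') / d" using p2 d by (intro divide_right_mono) (auto simp: e'_def)
        finally show "real ?M * ?p * (1 + 2 * ?p) \<le> ?l" by (simp add: d_def)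
        show "0 < ?l" using e' assms by simp
      qed
      then have st: "(survival ?p ?M (r - 1) k)\<^sup>2 \<le> t\<^sup>2"
        using survival_bounds[OF p1] by (intro power_mono) auto
      have edges: "real (n choose r) * ?p = real n * ((1 + \<epsilon>) / (real r * d))"
        using edge_prob_edges[OF r2 n1(1)] by (simp add: d)
      have r2': "real (r choose 2) = real r * d / 2"
      proof -
        have "even (r * (r - 1))" by (cases r) auto
        then have "2 * (r choose 2) = r * (r - 1)" by (simp add: choose_two)
        then have "2 * real (r choose 2) = real r * real (r - 1)"
          by (metis of_nat_mult of_nat_numeral)
        then show ?thesis by (simp add: d_def)
      qed
      have "expect ?A ?p ?N \<le> real (n choose r) * (?p * real (r choose 2) * (survival ?p ?M (r - 1) k)\<^sup>2)"
        using assms p1 by (intro expect_bridges_le) auto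
      also have "\<dots> \<le> real (n choose r) * (?p * real (r choose 2) * t\<^sup>2)"
        using p1 st by (intro mult_left_mono) auto
      also have "\<dots> = (real (n choose r) * ?p) * real (r choose 2) * t\<^sup>2" by simp
      also have "\<dots> = real n * ((1 + \<epsilon>) / 2 * t\<^sup>2)"
        unfolding edges r2' using d assms by (simp add: field_simps)
      also have "\<dots> \<le> real n * (2 * \<epsilon>\<^sup>2 / d\<^sup>2 + K0 * \<epsilon> ^ 3)"
        using mean by (intro mult_left_mono) auto
      finally have EN: "expect ?A ?p ?N \<le> real n * (2 * \<epsilon>\<^sup>2 / d\<^sup>2 + K0 * \<epsilon> ^ 3)" .
      \<comment> \<open>The additional \<open>\<epsilon> ^ 3 * n\<close> of the bound is split
        evenly between the fluctuation of the number of bridges and the ends of the path.\<close>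
      have "probab ?A ?p (\<lambda>E. \<not> real (L_P r {1..n} E + 1) \<le> (2 * \<epsilon>\<^sup>2 / (real r - 1)\<^sup>2 + (K0 + 1) * \<epsilon> ^ 3) * real n)
        \<le> probab ?A ?p (\<lambda>E. ?N E \<ge> expect ?A ?p ?N + \<epsilon> ^ 3 * real n / 2)"
      proof (rule probab_mono[OF p1], rule ccontr)
        fix E assume E: "E \<subseteq> ?A"
          "\<not> real (L_P r {1..n} E + 1) \<le> (2 * \<epsilon>\<^sup>2 / (real r - 1)\<^sup>2 + (K0 + 1) * \<epsilon> ^ 3) * real n"
          "\<not> ?N E \<ge> expect ?A ?p ?N + \<epsilon> ^ 3 * real n / 2"
        have "real (L_P r {1..n} E + 1) \<le> ?N E + 2 * real k + 1"
          using L_P_le_bridges[OF r2 n1(2) E(1), of k] by simp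
        also have "\<dots> \<le> real n * (2 * \<epsilon>\<^sup>2 / d\<^sup>2 + K0 * \<epsilon> ^ 3) + \<epsilon> ^ 3 * real n"
          using E(3) EN n3 by linarith
        finally show False using E(2) by (simp add: d algebra_simps)
      qed
      also have "\<dots> \<le> (expect ?A ?p (\<lambda>X. (?N X)\<^sup>2) - (expect ?A ?p ?N)\<^sup>2) / (\<epsilon> ^ 3 * real n / 2)\<^sup>2"
        using p1 e n1 by (intro expect_chebyshev) auto
      also have "\<dots> \<le> (real (n choose r) * ?p * (\<Sum>j\<le>2 * k. (?p * r * ?M) ^ j)) / (\<epsilon> ^ 3 * real n / 2)\<^sup>2"
        using assms p1 by (intro divide_right_mono variance_bridges_le) auto
      also have "(\<Sum>j\<le>2 * k. (?p * r * ?M) ^ j) = S"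
        unfolding S_def deg[symmetric] by (simp add: mult_ac)
      also have "real (n choose r) * ?p * S / (\<epsilon> ^ 3 * real n / 2)\<^sup>2 = C / real n"
        unfolding edges C_def using e n1 d(2) assms
        by (simp add: field_simps power2_eq_square eval_nat_numeral)
      finally show ?thesis .
    qed
    show "(\<lambda>n. probab (complete_edges r n) (edge_prob r \<epsilon> n)
       (\<lambda>E. \<not> real (L_P r {1..n} E + 1) \<le> (2 * \<epsilon>\<^sup>2 / (real r - 1)\<^sup>2 + (K0 + 1) * \<epsilon> ^ 3) * real n))
      \<longlonglongrightarrow> 0"
    proof (rule tendsto_sandwich[OF _ _ tendsto_const lim_const_over_n[of C]])
      have "eventually (\<lambda>n. real n \<ge> max n0 (real r)) sequentially"
        by (rule eventually_compose_filterlim[OF eventually_ge_at_top filterlim_real_sequentially])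
      then show "eventually (\<lambda>n. 0 \<le> probab (complete_edges r n) (edge_prob r \<epsilon> n)
       (\<lambda>E. \<not> real (L_P r {1..n} E + 1) \<le> (2 * \<epsilon>\<^sup>2 / (real r - 1)\<^sup>2 + (K0 + 1) * \<epsilon> ^ 3) * real n)) sequentially"
      proof eventually_elim
        case (elim n)
        have n1: "r \<le> n" "2 \<le> r" using elim assms by auto
        have "edge_prob r \<epsilon> n \<le> (1 + \<epsilon>) / real (n - 1)" by (rule edge_prob_bounds[OF n1(2,1) e(1)])
        also have "\<dots> \<le> 1" using n1 assms e by simp
        finally show ?case using edge_prob_bounds(1)[OF n1(2,1) e(1)] by (intro expect_nonneg) auto
      qed
      have "eventually (\<lambda>n. real n \<ge> n0) sequentially"
        by (rule eventually_compose_filterlim[OF eventually_ge_at_top filterlim_real_sequentially])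
      then show "eventually (\<lambda>n. probab (complete_edges r n) (edge_prob r \<epsilon> n)
       (\<lambda>E. \<not> real (L_P r {1..n} E + 1) \<le> (2 * \<epsilon>\<^sup>2 / (real r - 1)\<^sup>2 + (K0 + 1) * \<epsilon> ^ 3) * real n) \<le> C / real n) sequentially"
        by eventually_elim (rule bound)
    qed
  qed
qed

section \<open>Adaptive exploration\<close>

text \<open>An adaptive exploration of a random set: a state \<open>s\<close> may query an element \<open>qry s\<close> not
  queried before, and moves on depending on the answer. The state is thus a function of the
  answers obtained so far, so the next query is independent of the past.\<close>

locale exploration =
  fixes qry :: "'s \<Rightarrow> 'e option" and stp :: "'s \<Rightarrow> bool \<Rightarrow> 's" and init :: 's
    and queried :: "'s \<Rightarrow> 'e set" and A :: "'e set"
  assumes finite_A: "finite A"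
    and queried_init: "queried init = {}"
    and queried_stp: "queried (stp s b) = (case qry s of None \<Rightarrow> queried s | Some e \<Rightarrow> insert e (queried s))"
    and qry_fresh: "qry s = Some e \<Longrightarrow> e \<in> A - queried s"
begin

primrec run :: "'e set \<Rightarrow> nat \<Rightarrow> 's" where
  "run X 0 = init"
| "run X (Suc i) = stp (run X i) (case qry (run X i) of None \<Rightarrow> False | Some e \<Rightarrow> e \<in> X)"

lemma queried_subset: "queried (run X i) \<subseteq> A"
proof (induction i)
  case (Suc i)
  then show ?case using qry_fresh by (auto simp: queried_stp split: option.splits)
qed (simp add: queried_init)

lemma finite_queried: "finite (queried (run X i))"
  using queried_subset finite_A by (rule finite_subset)

lemma run_cong: "(\<And>e. e \<in> queried (run X i) \<Longrightarrow> e \<in> X \<longleftrightarrow> e \<in> Y) \<Longrightarrow> run Y i = run X i"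
proof (induction i)
  case (Suc i)
  have *: "e \<in> X \<longleftrightarrow> e \<in> Y" if "e \<in> queried (run X i)" for e
    by (rule Suc.prems) (use that in \<open>auto simp: queried_stp split: option.splits\<close>)
  have eq: "run Y i = run X i" by (rule Suc.IH) (rule *)
  show ?case
  proof (cases "qry (run X i)")
    case (Some e)
    then have "e \<in> X \<longleftrightarrow> e \<in> Y" by (intro Suc.prems) (simp add: queried_stp)
    then show ?thesis using eq Some by simp
  qed (simp add: eq)
qed simp

text \<open>A martingale in \<open>i\<close>: each query adds its answer minus
  \<open>p\<close>.\<close>

definition discrepancy :: "real \<Rightarrow> nat \<Rightarrow> 'e set \<Rightarrow> real" where
  "discrepancy p i X = real (card (queried (run X i) \<inter> X)) - p * real (card (queried (run X i)))"

text \<open>The square of the martingale minus its predictable variation has mean zero. This holds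
  although the number of queries made by time \<open>i\<close> is itself random.\<close>

lemma expect_discrepancy_square:
  "expect A p (\<lambda>X. (discrepancy p i X)\<^sup>2 - p * (1 - p) * real (card (queried (run X i)))) = 0"
proof (induction i)
  case 0
  then show ?case using finite_A by (simp add: discrepancy_def queried_init)
next
  case (Suc i)
  let ?Z = "discrepancy p i"
  \<comment> \<open>The increment of the compensated square, charged to the element \<open>e\<close>
    that is queried next.\<close>
  define D where "D = (\<lambda>e X. if qry (run X i) = Some e
     then 2 * ?Z X * (of_bool (e \<in> X) - p) + (of_bool (e \<in> X) - p)\<^sup>2 - p * (1 - p) else 0)"
  have step: "(discrepancy p (Suc i) X)\<^sup>2 - p * (1 - p) * real (card (queried (run X (Suc i))))
    = ((?Z X)\<^sup>2 - p * (1 - p) * real (card (queried (run X i)))) + (\<Sum>e\<in>A. D e X)" for X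
  proof (cases "qry (run X i)")
    case None
    then have "queried (run X (Suc i)) = queried (run X i)" by (simp add: queried_stp)
    then show ?thesis using None by (simp add: discrepancy_def D_def)
  next
    case (Some e)
    let ?Q = "queried (run X i)"
    have e: "e \<in> A" "e \<notin> ?Q" using qry_fresh[OF Some] by auto
    have Q: "queried (run X (Suc i)) = insert e ?Q" using Some by (simp add: queried_stp)
    have "real (card (insert e ?Q \<inter> X)) = real (card (?Q \<inter> X)) + of_bool (e \<in> X)"
      using e finite_queried[of X i] by simp
    then have Z: "discrepancy p (Suc i) X = ?Z X + (of_bool (e \<in> X) - p)"
      using e finite_queried[of X i] unfolding discrepancy_def Q by (simp add: algebra_simps)
    have "(\<Sum>e\<in>A. D e X) = (\<Sum>e'\<in>A. if e' = e then D e X else 0)"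
      by (intro sum.cong refl) (auto simp: D_def Some)
    also have "\<dots> = D e X" using e finite_A by simp
    finally have S: "(\<Sum>e\<in>A. D e X) = D e X" .
    show ?thesis
      unfolding S Z Q using Some e finite_queried[of X i]
      by (simp add: D_def power2_eq_square algebra_simps)
  qed
  \<comment> \<open>Fix the set outside \<open>e\<close>. Whether \<open>e\<close> is the next
    query, and the discrepancy up to then, do not depend on \<open>e\<close>, because the run sees
    only elements already queried; averaging over the presence of \<open>e\<close> then gives
    zero.\<close>
  have zero: "expect A p (D e) = 0" if e: "e \<in> A" for e
  proof -
    have same: "run (insert e X) i = run X i"
      if "qry (run X i) = Some e \<or> qry (run (insert e X) i) = Some e" for X
      using that
    proof
      assume "qry (run X i) = Some e"
      then show ?thesis using qry_fresh by (intro run_cong) fastforce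
    next
      assume "qry (run (insert e X) i) = Some e"
      then show ?thesis using qry_fresh by (intro run_cong[symmetric]) fastforce
    qed
    have "p * D e (insert e X) + (1 - p) * D e X = 0" if X: "X \<subseteq> A - {e}" for X
    proof (cases "qry (run X i) = Some e")
      case True
      note run = same[OF disjI1[OF True]]
      have "e \<notin> queried (run X i)" using qry_fresh[OF True] by simp
      then have "queried (run X i) \<inter> insert e X = queried (run X i) \<inter> X" by auto
      then have Z: "?Z (insert e X) = ?Z X" by (simp add: discrepancy_def run)
      have "e \<notin> X" using X by auto
      then show ?thesis using True
        by (simp add: D_def run Z power2_eq_square algebra_simps)
    next
      case False
      then have "qry (run (insert e X) i) \<noteq> Some e" using same[of X] by auto
      then show ?thesis using False by (simp add: D_def)
    qed
    then have "expect (A - {e}) p (\<lambda>X. p * D e (insert e X) + (1 - p) * D e X)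
      = expect (A - {e}) p (\<lambda>_. 0)"
      by (intro expect_cong)
    then show ?thesis
      using finite_A by (simp add: expect_remove[OF finite_A e] expect_add expect_cmult)
  qed
  have "expect A p (\<lambda>X. (discrepancy p (Suc i) X)\<^sup>2 - p * (1 - p) * real (card (queried (run X (Suc i)))))
    = 0 + (\<Sum>e\<in>A. expect A p (D e))"
    unfolding step expect_add Suc expect_sum ..
  then show ?case using zero by simp
qed

lemma few_positive_answers:
  assumes "0 \<le> p" "p \<le> 1" "0 < c" "\<And>X. X \<subseteq> A \<Longrightarrow> card (queried (run X i)) \<le> N"
  shows "probab A p (\<lambda>X. real (card (queried (run X i) \<inter> X))
    \<le> p * real (card (queried (run X i))) - c) \<le> p * real N / c\<^sup>2"
proof -
  have "probab A p (\<lambda>X. real (card (queried (run X i) \<inter> X)) \<le> p * real (card (queried (run X i))) - c)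
    \<le> expect A p (\<lambda>X. (discrepancy p i X)\<^sup>2) / c\<^sup>2"
  proof (rule probab_markov)
    fix X assume "real (card (queried (run X i) \<inter> X)) \<le> p * real (card (queried (run X i))) - c"
    then have "c \<le> - discrepancy p i X" by (simp add: discrepancy_def)
    then have "c\<^sup>2 \<le> (- discrepancy p i X)\<^sup>2" using assms by (intro power_mono) auto
    then show "c\<^sup>2 \<le> (discrepancy p i X)\<^sup>2" by simp
  qed (use assms in auto)
  also have "\<dots> \<le> p * real N / c\<^sup>2"
  proof (rule divide_right_mono)
    have "expect A p (\<lambda>X. (discrepancy p i X)\<^sup>2) = expect A p (\<lambda>X. p * (1 - p) * real (card (queried (run X i))))"
      using expect_discrepancy_square[of p i] by (simp add: expect_diff)
    also have "\<dots> \<le> expect A p (\<lambda>X. p * 1 * real N)"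
      using assms by (intro expect_mono mult_mono) auto
    finally show "expect A p (\<lambda>X. (discrepancy p i X)\<^sup>2) \<le> p * real N" using finite_A by simp
  qed simp
  finally show ?thesis .
qed

end

section \<open>Depth-first search for loose paths\<close>

text \<open>A state \<open>(S, T, fs, Q)\<close> consists of the unseen vertices, the exhausted vertices, the stack
  of the search and the queried edges. A frame \<open>(x, R, B)\<close> stands for a block \<open>B\<close> of \<open>r - 1\<close> new
  vertices (or a root), entered at once; \<open>x\<close> is currently being explored and \<open>R\<close> are the vertices
  of the block that are still to be tried in place of \<open>x\<close>.\<close>

type_synonym 'v frame = "'v \<times> 'v set \<times> 'v set"
type_synonym 'v state = "'v set \<times> 'v set \<times> 'v frame list \<times> 'v set set"

fun alive :: "'v frame list \<Rightarrow> 'v set" where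
  "alive [] = {}"
| "alive ((x, R, B) # fs) = insert x R \<union> alive fs"

fun blocks :: "'v frame list \<Rightarrow> 'v set" where
  "blocks [] = {}"
| "blocks ((x, R, B) # fs) = B \<union> blocks fs"

fun num_alive :: "'v frame list \<Rightarrow> nat" where
  "num_alive [] = 0"
| "num_alive ((x, R, B) # fs) = 1 + card R + num_alive fs"

text \<open>The head of the list is the top of the stack. Each block forms an edge of
  \<open>X\<close> with the current vertex of the frame below, so the stack is a loose path read
  backwards. Trying a sibling changes \<open>x\<close> but not \<open>B\<close>, so the edge into
  the block is kept.\<close>

fun stack_ok :: "nat \<Rightarrow> 'v set set \<Rightarrow> 'v frame list \<Rightarrow> bool" where
  "stack_ok r X [] = True"
| "stack_ok r X ((x, R, B) # fs) \<longleftrightarrow> x \<in> B \<and> R \<subseteq> B - {x} \<and> finite B \<and> B \<inter> blocks fs = {} \<and>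
     stack_ok r X fs \<and>
     (case fs of [] \<Rightarrow> B = {x} | (x', _) # _ \<Rightarrow> card B = r - 1 \<and> insert x' B \<in> X)"

text \<open>\<open>N0\<close> is the budget of queries and \<open>T0\<close> the budget of exhausted
  vertices; the search halts when either is reached.\<close>

locale dfs =
  fixes V :: "'v set" and r N0 T0 :: nat
  assumes finite_V: "finite V" and r_ge_2: "r \<ge> 2"
begin

definition edges :: "'v set set" where
  "edges = {e. e \<subseteq> V \<and> card e = r}"

lemma finite_edges: "finite edges"
  by (rule finite_subset[of _ "Pow V"]) (use finite_V in \<open>auto simp: edges_def\<close>)

fun halted :: "'v state \<Rightarrow> bool" where
  "halted (S, T, fs, Q) \<longleftrightarrow> card Q \<ge> N0 \<or> card T \<ge> T0"

fun queried :: "'v state \<Rightarrow> 'v set set" where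
  "queried (S, T, fs, Q) = Q"

fun candidates :: "'v state \<Rightarrow> 'v set set" where
  "candidates (S, T, [], Q) = {}"
| "candidates (S, T, (x, R, B) # fs, Q) = {W. W \<subseteq> S \<and> card W = r - 1 \<and> insert x W \<in> edges - Q}"

fun top_vertex :: "'v state \<Rightarrow> 'v" where
  "top_vertex (S, T, [], Q) = undefined"
| "top_vertex (S, T, (x, R, B) # fs, Q) = x"

definition query :: "'v state \<Rightarrow> 'v set option" where
  "query s = (if halted s \<or> candidates s = {} then None
     else Some (insert (top_vertex s) (SOME W. W \<in> candidates s)))"

fun step :: "'v state \<Rightarrow> bool \<Rightarrow> 'v state" where
  "step (S, T, [], Q) b = (if halted (S, T, [], Q) \<or> S = {} then (S, T, [], Q)
     else let x = SOME x. x \<in> S in (S - {x}, T, [(x, {}, {x})], Q))"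
| "step (S, T, (x, R, B) # fs, Q) b =
    (let s = (S, T, (x, R, B) # fs, Q) in
     if halted s then s
     else if candidates s \<noteq> {} then
       let W = SOME W. W \<in> candidates s; y = SOME y. y \<in> W in
       if b then (S - W, T, (y, W - {y}, W) # (x, R, B) # fs, insert (insert x W) Q)
       else (S, T, (x, R, B) # fs, insert (insert x W) Q)
     else if R \<noteq> {} then let y = SOME y. y \<in> R in (S, insert x T, (y, R - {y}, B) # fs, Q)
     else (S, insert x T, fs, Q))"

definition start :: "'v state" where "start = (V, {}, [], {})"

sublocale exploration query step start queried edges
proof
  show "finite edges" by (rule finite_edges)
  show "queried start = {}" by (simp add: start_def)
  fix s b e
  show "queried (step s b) = (case query s of None \<Rightarrow> queried s | Some e \<Rightarrow> insert e (queried s))"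
    by (cases "(s, b)" rule: step.cases) (auto simp: query_def Let_def)
  assume q: "query s = Some e"
  then have "(SOME W. W \<in> candidates s) \<in> candidates s"
    by (auto simp: query_def some_in_eq split: if_splits)
  then show "e \<in> edges - queried s"
    using q by (cases s rule: candidates.cases) (auto simp: query_def split: if_splits)
qed

section \<open>Invariant and termination of the search\<close>

text \<open>The effective steps with arbitrary choices in place of \<open>SOME\<close> and with the
  answers read off from \<open>X\<close>; invariants are checked on this relation.\<close>

inductive move :: "'v set set \<Rightarrow> 'v state \<Rightarrow> 'v state \<Rightarrow> bool" for X where
  root: "x \<in> S \<Longrightarrow> move X (S, T, [], Q) (S - {x}, T, [(x, {}, {x})], Q)"
| extend: "W \<subseteq> S \<Longrightarrow> card W = r - 1 \<Longrightarrow> insert x W \<in> edges - Q \<Longrightarrow> insert x W \<in> X \<Longrightarrow> y \<in> W \<Longrightarrow>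
    move X (S, T, (x, R, B) # fs, Q) (S - W, T, (y, W - {y}, W) # (x, R, B) # fs, insert (insert x W) Q)"
| reject: "insert x W \<in> edges - Q \<Longrightarrow> insert x W \<notin> X \<Longrightarrow>
    move X (S, T, (x, R, B) # fs, Q) (S, T, (x, R, B) # fs, insert (insert x W) Q)"
| sibling: "\<forall>W. W \<subseteq> S \<longrightarrow> card W = r - 1 \<longrightarrow> insert x W \<in> edges \<longrightarrow> insert x W \<in> Q \<Longrightarrow> y \<in> R \<Longrightarrow>
    move X (S, T, (x, R, B) # fs, Q) (S, insert x T, (y, R - {y}, B) # fs, Q)"
| pop: "\<forall>W. W \<subseteq> S \<longrightarrow> card W = r - 1 \<longrightarrow> insert x W \<in> edges \<longrightarrow> insert x W \<in> Q \<Longrightarrow>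
    move X (S, T, (x, {}, B) # fs, Q) (S, insert x T, fs, Q)"

lemma run_Suc_cases:
  obtains "halted (run X i)" "run X (Suc i) = run X i"
  | T Q where "run X i = ({}, T, [], Q)" "run X (Suc i) = run X i"
  | "\<not> halted (run X i)" "move X (run X i) (run X (Suc i))"
proof -
  obtain S T fs Q where s: "run X i = (S, T, fs, Q)" by (metis prod_cases4)
  show thesis
  proof (cases "halted (run X i)")
    case True
    then have "run X (Suc i) = run X i" by (cases fs) (auto simp: s)
    then show thesis using True that by blast
  next
    case nh: False
    show thesis
    proof (cases fs)
      case Nil
      show thesis
      proof (cases "S = {}")
        case True
        then show thesis using that(2)[of T Q] s Nil by simp
      next
        case False
        then have "(SOME x. x \<in> S) \<in> S" by (simp add: some_in_eq)
        then have "move X (run X i) (run X (Suc i))"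
          using nh False by (auto simp: s Nil Let_def intro: move.root)
        then show thesis using nh that by blast
      qed
    next
      case (Cons f fs')
      obtain x R B where f: "f = (x, R, B)" by (metis prod_cases3)
      show thesis
      proof (cases "candidates (S, T, fs, Q) = {}")
        case False
        define W where "W = (SOME W. W \<in> candidates (S, T, fs, Q))"
        have "W \<in> candidates (S, T, fs, Q)" using False unfolding W_def by (simp add: some_in_eq)
        then have W: "W \<subseteq> S" "card W = r - 1" "insert x W \<in> edges - Q" by (auto simp: Cons f)
        have "W \<noteq> {}" using W(2) r_ge_2 by auto
        then have y: "(SOME y. y \<in> W) \<in> W" by (simp add: some_in_eq)
        have q: "query (run X i) = Some (insert x W)"
          using nh False unfolding query_def W_def s by (simp add: Cons f)
        have "move X (run X i) (run X (Suc i))"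
        proof (cases "insert x W \<in> X")
          case True
          then have "run X (Suc i) = (S - W, T, ((SOME y. y \<in> W), W - {SOME y. y \<in> W}, W) # (x, R, B) # fs', insert (insert x W) Q)"
            using nh False q by (simp add: s Cons f Let_def W_def del: candidates.simps)
          then show ?thesis using extend[OF W True y] by (simp add: s Cons f)
        next
          case nX: False
          then have "run X (Suc i) = (S, T, (x, R, B) # fs', insert (insert x W) Q)"
            using nh False q by (simp add: s Cons f Let_def W_def del: candidates.simps)
          then show ?thesis using reject[OF W(3) nX] by (simp add: s Cons f)
        qed
        then show thesis using nh that by blast
      next
        case True
        then have no: "\<forall>W. W \<subseteq> S \<longrightarrow> card W = r - 1 \<longrightarrow> insert x W \<in> edges \<longrightarrow> insert x W \<in> Q"
          by (auto simp: Cons f)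
        have "move X (run X i) (run X (Suc i))"
        proof (cases "R = {}")
          case True
          then show ?thesis
            using nh \<open>candidates _ = {}\<close> pop[OF no, of X T B fs']
            by (simp add: s Cons f Let_def del: candidates.simps)
        next
          case False
          then have "(SOME y. y \<in> R) \<in> R" by (simp add: some_in_eq)
          then show ?thesis
            using nh \<open>candidates _ = {}\<close> False sibling[OF no, of _ R X T B fs']
            by (simp add: s Cons f Let_def del: candidates.simps)
        qed
        then show thesis using nh that by blast
      qed
    qed
  qed
qed

text \<open>The clause on \<open>T\<close> persists because \<open>S\<close> only shrinks. The last
  clause holds because each positive answer discovers \<open>r - 1\<close> vertices, which stay
  either alive or exhausted; roots only add to the right-hand side.\<close>

fun invariant :: "'v set set \<Rightarrow> 'v state \<Rightarrow> bool" where
  "invariant X (S, T, fs, Q) \<longleftrightarrow>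
     S \<subseteq> V \<and> T \<subseteq> V - S \<and> blocks fs \<subseteq> V - S \<and> alive fs \<inter> T = {} \<and> stack_ok r X fs \<and>
     card S + card T + num_alive fs = card V \<and>
     (\<forall>t\<in>T. \<forall>W\<subseteq>S. card W = r - 1 \<longrightarrow> insert t W \<in> Q) \<and>
     Q \<subseteq> edges \<and> (r - 1) * card (Q \<inter> X) \<le> card T + num_alive fs"

lemma alive_subset_blocks: "stack_ok r X fs \<Longrightarrow> alive fs \<subseteq> blocks fs"
  by (induction fs rule: alive.induct) auto

lemma invariant_move:
  assumes "move X s s'" "invariant X s"
  shows "invariant X s'"
  using assms
proof cases
  case (root x S T Q)
  have "finite S" using assms(2) finite_V finite_subset by (auto simp: root)
  then have "card (S - {x}) + 1 = card S"
    using root(3) by (metis Suc_eq_plus1 card.remove)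
  then show ?thesis using assms(2) root(3) by (auto simp: root subset_Diff_insert)
next
  case (extend W S x Q y T R B fs)
  have fin: "finite S" "finite Q"
    using assms(2) finite_V finite_edges finite_subset by (auto simp: extend(1))
  have finW: "finite W" using extend(3) fin(1) by (rule finite_subset)
  have cS: "card (S - W) + (r - 1) = card S"
    using card_mono[OF fin(1) extend(3)] extend(4) by (simp add: card_Diff_subset[OF finW extend(3)])
  have cW: "1 + card (W - {y}) = r - 1"
    using finW extend(4,7) by (metis card.remove plus_1_eq_Suc)
  have "card (insert (insert x W) Q \<inter> X) = card (Q \<inter> X) + 1"
    using fin extend(5,6) by simp
  note cQ = this
  let ?f = "(x, R, B) # fs"
  have I: "S \<subseteq> V" "T \<subseteq> V - S" "blocks ?f \<subseteq> V - S" "alive ?f \<inter> T = {}" "stack_ok r X ?f"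
    "card S + card T + num_alive ?f = card V" "\<forall>t\<in>T. \<forall>W\<subseteq>S. card W = r - 1 \<longrightarrow> insert t W \<in> Q"
    "Q \<subseteq> edges" "(r - 1) * card (Q \<inter> X) \<le> card T + num_alive ?f"
    using assms(2) unfolding extend(1) invariant.simps by blast+
  show ?thesis
    unfolding extend(2) invariant.simps
  proof (intro conjI)
    show "S - W \<subseteq> V" "T \<subseteq> V - (S - W)" using I(1,2) by blast+
    show "blocks ((y, W - {y}, W) # ?f) \<subseteq> V - (S - W)"
      using I(1,3) extend(3) unfolding blocks.simps(2)[of y] by blast
    have "W \<inter> T = {}" using I(2) extend(3) by blast
    then show "alive ((y, W - {y}, W) # ?f) \<inter> T = {}"
      using I(4) extend(7) unfolding alive.simps(2)[of y] by blast
    have "W \<inter> blocks ?f = {}" using I(3) extend(3) by blast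
    then show "stack_ok r X ((y, W - {y}, W) # ?f)"
      using I(5) extend(4,6,7) finW unfolding stack_ok.simps(2)[of r X y] by simp
    show "card (S - W) + card T + num_alive ((y, W - {y}, W) # ?f) = card V"
      using cS cW I(6) unfolding num_alive.simps(2)[of y] by linarith
    show "\<forall>t\<in>T. \<forall>W'\<subseteq>S - W. card W' = r - 1 \<longrightarrow> insert t W' \<in> insert (insert x W) Q"
      using I(7) by blast
    show "insert (insert x W) Q \<subseteq> edges" using I(8) extend(5) by blast
    show "(r - 1) * card (insert (insert x W) Q \<inter> X) \<le> card T + num_alive ((y, W - {y}, W) # ?f)"
      using cQ cW I(9) unfolding num_alive.simps(2)[of y] by simp
  qed
next
  case (reject x W Q S T R B fs)
  have "insert (insert x W) Q \<inter> X = Q \<inter> X" using reject(4) by auto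
  then show ?thesis using assms(2) reject(3) by (auto simp: reject(1,2))
next
  case (sibling S x Q y R T B fs)
  have B: "finite B" "x \<in> B" "R \<subseteq> B - {x}" "B \<subseteq> V - S" "B \<inter> blocks fs = {}" "stack_ok r X fs"
    using assms(2) by (auto simp: sibling(1))
  have "finite R" using B finite_subset by blast
  then have cR: "1 + card (R - {y}) = card R"
    using sibling(4) by (metis card.remove plus_1_eq_Suc)
  have xT: "x \<notin> T" "x \<in> V - S" using assms(2) B by (auto simp: sibling(1))
  have "finite T" using assms(2) finite_V finite_subset by (auto simp: sibling(1))
  then have cT: "card (insert x T) = card T + 1" using xT by simp
  have "x \<notin> alive fs" using alive_subset_blocks[OF B(6)] B by auto
  moreover have "insert x W \<in> Q" if "W \<subseteq> S" "card W = r - 1" for W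
  proof -
    have "finite W" using that r_ge_2 by (intro card_ge_0_finite) auto
    moreover have "x \<notin> W" "insert x W \<subseteq> V" using that xT assms(2) by (auto simp: sibling(1))
    ultimately have "insert x W \<in> edges" using that r_ge_2 by (simp add: edges_def)
    then show ?thesis using sibling(3) that by blast
  qed
  moreover have "case fs of [] \<Rightarrow> B = {y} | (x', _) # _ \<Rightarrow> card B = r - 1 \<and> insert x' B \<in> X"
    using assms(2) sibling(4) by (cases fs) (auto simp: sibling(1))
  ultimately show ?thesis
    using assms(2) cR cT xT B sibling(4) by (auto simp: sibling(1,2))
next
  case (pop S x Q T B fs)
  have B: "finite B" "x \<in> B" "B \<subseteq> V - S" "B \<inter> blocks fs = {}" "stack_ok r X fs"
    using assms(2) by (auto simp: pop(1))
  have xT: "x \<notin> T" "x \<in> V - S" using assms(2) B by (auto simp: pop(1))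
  have "finite T" using assms(2) finite_V finite_subset by (auto simp: pop(1))
  then have cT: "card (insert x T) = card T + 1" using xT by simp
  have "x \<notin> alive fs" using alive_subset_blocks[OF B(5)] B by auto
  moreover have "insert x W \<in> Q" if "W \<subseteq> S" "card W = r - 1" for W
  proof -
    have "finite W" using that r_ge_2 by (intro card_ge_0_finite) auto
    moreover have "x \<notin> W" "insert x W \<subseteq> V" using that xT assms(2) by (auto simp: pop(1))
    ultimately have "insert x W \<in> edges" using that r_ge_2 by (simp add: edges_def)
    then show ?thesis using pop(3) that by blast
  qed
  ultimately show ?thesis
    using assms(2) cT xT B by (auto simp: pop(1,2))
qed


text \<open>Exhausting a vertex removes it from the alive ones, hence the weight 2: every move gains
  at least 1. As alive and exhausted vertices together number at most \<open>card V\<close>, the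
  potential never exceeds \<open>N0 + 2 * card V\<close>.\<close>

fun potential :: "'v state \<Rightarrow> nat" where
  "potential (S, T, fs, Q) = card Q + 2 * card T + num_alive fs"

lemma potential_move:
  assumes "move X s s'" "invariant X s"
  shows "potential s < potential s'"
  using assms
proof cases
  case (extend W S x Q y T R B fs)
  have "finite Q" using assms(2) finite_edges finite_subset by (auto simp: extend(1))
  then show ?thesis using extend(5) by (simp add: extend(1,2))
next
  case (reject x W Q S T R B fs)
  have "finite Q" using assms(2) finite_edges finite_subset by (auto simp: reject(1))
  then show ?thesis using reject(3) by (simp add: reject(1,2))
next
  case (sibling S x Q y R T B fs)
  have "finite B" "R \<subseteq> B" "x \<notin> T" using assms(2) by (auto simp: sibling(1))
  moreover have "finite T" using assms(2) finite_V finite_subset by (auto simp: sibling(1))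
  moreover have "Suc (card (R - {y})) = card R"
    using calculation(1,2) sibling(4) by (metis card.remove finite_subset)
  ultimately show ?thesis by (simp add: sibling(1,2))
next
  case (pop S x Q T B fs)
  have "x \<notin> T" using assms(2) by (auto simp: pop(1))
  moreover have "finite T" using assms(2) finite_V finite_subset by (auto simp: pop(1))
  ultimately show ?thesis by (simp add: pop(1,2))
qed auto

fun within_budget :: "'v state \<Rightarrow> bool" where
  "within_budget (S, T, fs, Q) \<longleftrightarrow> card Q \<le> N0 \<and> card T \<le> T0"

lemma within_budget_move:
  assumes "move X s s'" "\<not> halted s"
  shows "within_budget s'"
proof -
  have le: "card (insert a B) \<le> n" if "card B < n" for a :: 'v and B and n
    using that by (cases "finite B") (auto simp: card_insert_if)
  have le': "card (insert a B) \<le> n" if "card B < n" for a :: "'v set" and B and n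
    using that by (cases "finite B") (auto simp: card_insert_if)
  show ?thesis
    using assms by cases (auto simp: not_le intro: le le')
qed

lemma run_invariant:
  "invariant X (run X i) \<and> within_budget (run X i) \<and>
    (halted (run X i) \<or> (\<exists>T Q. run X i = ({}, T, [], Q)) \<or> i \<le> potential (run X i))"
proof (induction i)
  case 0
  have "run X 0 = (V, {}, [], {})" by (simp only: run.simps(1)) (simp only: start_def)
  then show ?case by (simp only:) simp
next
  case (Suc i)
  show ?case
  proof (cases rule: run_Suc_cases[where X = X and i = i])
    case 1
    then show ?thesis using Suc by (simp only: simp_thms)
  next
    case (2 T Q)
    then show ?thesis using Suc by (simp only:) blast
  next
    case 3
    have "invariant X (run X (Suc i))" using invariant_move[OF 3(2)] Suc by blast
    moreover have "within_budget (run X (Suc i))" using within_budget_move[OF 3(2,1)] .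
    moreover have "i \<le> potential (run X i)"
    proof -
      have "\<not> (\<exists>T Q. run X i = ({}, T, [], Q))"
      proof
        assume "\<exists>T Q. run X i = ({}, T, [], Q)"
        then obtain T Q where "run X i = ({}, T, [], Q)" by blast
        with 3(2) show False by (auto elim: move.cases)
      qed
      then show ?thesis using Suc 3(1) by blast
    qed
    moreover have "potential (run X i) < potential (run X (Suc i))"
      using potential_move[OF 3(2)] Suc by blast
    ultimately show ?thesis by linarith
  qed
qed

text \<open>The root frame has one alive vertex and every other frame at most \<open>r - 1\<close>;
  this turns a count of vertices into a path length.\<close>

lemma num_alive_le:
  "stack_ok r X fs \<Longrightarrow> num_alive fs \<le> 1 + (r - 1) * (length fs - 1)"
proof (induction fs rule: num_alive.induct)
  case (2 x R B fs)
  have "card R \<le> card (B - {x})" using 2 by (intro card_mono) auto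
  then have R: "card R + 1 \<le> card B" using 2 by (cases "card B") auto
  show ?case
  proof (cases fs)
    case Nil
    then show ?thesis using 2 R by simp
  next
    case (Cons f fs')
    then have "card B = r - 1" using 2 by (cases f) auto
    moreover have "num_alive fs \<le> 1 + (r - 1) * (length fs - 1)" using 2 by simp
    moreover have "length fs = Suc (length fs - 1)" by (simp add: Cons)
    then have "(r - 1) * length fs = (r - 1) + (r - 1) * (length fs - 1)"
      by (metis mult_Suc_right)
    moreover have len: "length ((x, R, B) # fs) - 1 = length fs" by simp
    ultimately show ?thesis using R unfolding num_alive.simps len by linarith
  qed
qed simp

text \<open>One of the two budgets is used up. But \<open>T0\<close> exhausted vertices would have caused more than \<open>N0\<close>
  queries, and \<open>N0\<close> queries discover more vertices than \<open>T0\<close> exhausted ones and a short stack.\<close>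

lemma long_stack:
  assumes "T0 \<le> card V" "1 \<le> tgt"
    and sparse: "N0 < T0 * ((card V - T0 - tgt) choose (r - 1))"
    and dense: "real T0 + real tgt \<le> (real r - 1) * (p * real N0 - c)"
    and typical: "p * real (card (queried (run X (N0 + 2 * card V + 1)))) - c
      < real (card (queried (run X (N0 + 2 * card V + 1)) \<inter> X))"
  shows "\<exists>fs. fs \<noteq> [] \<and> stack_ok r X fs \<and> blocks fs \<subseteq> V \<and> tgt \<le> 1 + (r - 1) * (length fs - 1)"
proof -
  obtain S T fs Q where s: "run X (N0 + 2 * card V + 1) = (S, T, fs, Q)" by (metis prod_cases4)
  note I = run_invariant[of X "N0 + 2 * card V + 1", unfolded s]
  then have inv: "invariant X (S, T, fs, Q)" by (rule conjunct1)
  have "within_budget (S, T, fs, Q)" using I by blast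
  then have bud: "card Q \<le> N0" "card T \<le> T0" by simp_all
  have alt: "halted (S, T, fs, Q) \<or> (S = {} \<and> fs = []) \<or> N0 + 2 * card V + 1 \<le> potential (S, T, fs, Q)"
    using I by blast
  have total: "card S + card T + num_alive fs = card V" using inv by simp
  \<comment> \<open>The alternatives fail: either all of \<open>V\<close> is exhausted, which meets
    the budget \<open>T0\<close>, or the potential exceeds its maximum.\<close>
  have "halted (S, T, fs, Q)"
    using alt
  proof (elim disjE)
    assume "S = {} \<and> fs = []"
    then show ?thesis using total assms(1) by simp
  next
    assume "N0 + 2 * card V + 1 \<le> potential (S, T, fs, Q)"
    then show ?thesis using total bud by simp
  qed
  then have h: "card Q = N0 \<or> card T = T0" using bud by auto
  have "tgt \<le> num_alive fs"
  proof (rule ccontr)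
    assume na: "\<not> tgt \<le> num_alive fs"
    show False
    proof (cases "card T = T0")
      case True
      have fin: "finite S" "finite T" "finite Q"
        using inv finite_V finite_edges finite_subset by auto
      have "card V - T0 - tgt \<le> card S" using na total True by linarith
      then have "(card V - T0 - tgt) choose (r - 1) \<le> card S choose (r - 1)"
        by (rule binomial_right_mono)
      also have "\<dots> = card {W. W \<subseteq> S \<and> card W = r - 1}"
        using fin by (simp add: n_subsets)
      finally have "T0 * ((card V - T0 - tgt) choose (r - 1)) \<le> card (T \<times> {W. W \<subseteq> S \<and> card W = r - 1})"
        using True by (simp add: card_cartesian_product)
      also have "\<dots> \<le> card Q"
      proof (rule card_inj_on_le[where f = "\<lambda>(t, W). insert t W"])
        have TS: "T \<inter> S = {}" using inv by auto
        show "inj_on (\<lambda>(t, W). insert t W) (T \<times> {W. W \<subseteq> S \<and> card W = r - 1})"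
        proof (rule inj_onI, clarify)
          fix t W t' W'
          assume *: "t \<in> T" "t' \<in> T" "W \<subseteq> S" "W' \<subseteq> S" "insert t W = insert t' W'"
          then have "t = t'" using TS by blast
          moreover have "t \<notin> W" "t \<notin> W'" using * TS by blast+
          then have "W = W'" using *(5) unfolding \<open>t = t'\<close> by (simp add: insert_ident)
          ultimately show "t = t' \<and> W = W'" by simp
        qed
        show "(\<lambda>(t, W). insert t W) ` (T \<times> {W. W \<subseteq> S \<and> card W = r - 1}) \<subseteq> Q"
          using inv by auto
      qed (use fin in auto)
      finally show False using sparse bud by simp
    next
      case False
      then have T: "card T < T0" and Q: "card Q = N0" using h bud by auto
      have "(real r - 1) * (p * real N0 - c) \<le> (real r - 1) * real (card (Q \<inter> X))"
        using typical r_ge_2 unfolding s by (intro mult_left_mono) (auto simp: Q)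
      also have "\<dots> = real ((r - 1) * card (Q \<inter> X))" using r_ge_2 by (simp add: of_nat_diff)
      also have "\<dots> \<le> real (card T + num_alive fs)" using inv by (simp only: invariant.simps of_nat_le_iff)
      also have "\<dots> < real T0 + real tgt" using T na by simp
      finally show False using dense by simp
    qed
  qed
  moreover have "num_alive fs \<le> 1 + (r - 1) * (length fs - 1)" using inv by (intro num_alive_le[of X]) simp
  moreover have "fs \<noteq> []" using calculation assms(2) by auto
  ultimately show ?thesis using inv by (intro exI[of _ fs]) auto
qed

end

section \<open>Closing the cycle\<close>

text \<open>A block is listed so that its current vertex comes last, the position at which the next
  edge of the path attaches.\<close>

lemma enumerate_with_last:
  assumes "finite B" "x \<in> B" "card B = k"
  obtains g where "bij_betw g {1..k} B" "g k = x"
proof -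
  have k: "k \<ge> 1" using assms by (cases k) auto
  have "card (B - {x}) = k - 1" "finite (B - {x})" using assms by auto
  then obtain h where h: "bij_betw h {1..k - 1} (B - {x})"
    using ex_bij_betw_nat_finite_1 by metis
  have "bij_betw (\<lambda>i. if i \<in> {1..k - 1} then h i else (\<lambda>_. x) i) ({1..k - 1} \<union> {k}) ((B - {x}) \<union> {x})"
    using h by (intro bij_betw_disjoint_Un) (auto simp: bij_betw_def)
  moreover have "{1..k - 1} \<union> {k} = {1..k}" "(B - {x}) \<union> {x} = B" using k assms by auto
  ultimately show thesis
    using k by (intro that[of "\<lambda>i. if i \<in> {1..k - 1} then h i else x"]) auto
qed

lemma loose_path_extend:
  assumes r: "r \<ge> 2" and path: "loose_path r V X l v e"
    and B: "finite B" "card B = r - 1" "B \<subseteq> V" "B \<inter> v ` {1..l * (r - 1) + 1} = {}"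
    and y: "y \<in> B" and edge: "insert (v (l * (r - 1) + 1)) B \<in> X"
  shows "\<exists>v' e'. loose_path r V X (Suc l) v' e' \<and>
    v' ` {1..Suc l * (r - 1) + 1} = v ` {1..l * (r - 1) + 1} \<union> B \<and> v' (Suc l * (r - 1) + 1) = y"
proof -
  obtain g where g: "bij_betw g {1..r - 1} B" "g (r - 1) = y"
    using enumerate_with_last[OF B(1) y B(2)] by metis
  define N where "N = l * (r - 1) + 1"
  define v' where "v' = (\<lambda>i. if i \<le> N then v i else g (i - N))"
  define e' where "e' = (\<lambda>i. if i \<le> l then e i else insert (v N) B)"
  have N': "Suc l * (r - 1) + 1 = N + (r - 1)" by (simp add: N_def)
  have lo: "v' ` I = v ` I" if "I \<subseteq> {..N}" for I
    using that by (intro image_cong) (auto simp: v'_def)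
  have hi: "v' ` {N + 1..N + (r - 1)} = B"
  proof -
    have "v' ` {N + 1..N + (r - 1)} = (\<lambda>i. v' (i + N)) ` {1..r - 1}"
      unfolding image_image[symmetric, of v' "\<lambda>i. i + N"] image_add_atLeastAtMost' by (simp add: add.commute)
    also have "\<dots> = g ` {1..r - 1}" by (intro image_cong) (auto simp: v'_def)
    finally show ?thesis using g by (simp add: bij_betw_def)
  qed
  have split: "{1..N + (r - 1)} = {1..N} \<union> {N + 1..N + (r - 1)}" by (auto simp: N_def)
  have img: "v' ` {1..N + (r - 1)} = v ` {1..N} \<union> B"
    unfolding split image_Un hi using lo[of "{1..N}"] by auto
  have inj_lo: "inj_on v' {1..N}"
  proof -
    have "inj_on v {1..N}" using path by (simp add: loose_path_def N_def)
    then show ?thesis by (subst inj_on_cong[of _ v' v]) (auto simp: v'_def)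
  qed
  have inj_hi: "inj_on v' {N + 1..N + (r - 1)}"
  proof (rule eq_card_imp_inj_on)
    show "card (v' ` {N + 1..N + (r - 1)}) = card {N + 1..N + (r - 1)}" unfolding hi using B by simp
  qed simp
  have inj: "inj_on v' {1..N + (r - 1)}"
    unfolding split inj_on_Un
    using inj_lo inj_hi hi lo[of "{1..N}"] B(4) unfolding N_def[symmetric] by auto
  have eX: "\<forall>i\<in>{1..l}. e i \<in> X" using path unfolding loose_path_def by blast
  have "loose_path r V X (Suc l) v' e'"
    unfolding loose_path_def N'
  proof (intro conjI ballI)
    show "v' ` {1..N + (r - 1)} \<subseteq> V"
      using img path B unfolding loose_path_def N_def by auto
    show "inj_on v' {1..N + (r - 1)}" by (rule inj)
    fix i assume i: "i \<in> {1..Suc l}"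
    show "e' i = v' ` {(i - 1) * (r - 1) + 1..(i - 1) * (r - 1) + r}"
    proof (cases "i \<le> l")
      case True
      have "(i - 1) * (r - 1) + (r - 1) = i * (r - 1)" using i by (cases i) auto
      also have "\<dots> \<le> l * (r - 1)" using True by (intro mult_le_mono1)
      finally have "{(i - 1) * (r - 1) + 1..(i - 1) * (r - 1) + r} \<subseteq> {..N}"
        using r by (auto simp: N_def)
      from lo[OF this] show ?thesis using path i True by (simp add: loose_path_def e'_def)
    next
      case False
      then have [simp]: "i = Suc l" using i by auto
      have "{l * (r - 1) + 1..l * (r - 1) + r} = {N} \<union> {N + 1..N + (r - 1)}"
        using r by (auto simp: N_def)
      then have "v' ` {l * (r - 1) + 1..l * (r - 1) + r} = insert (v' N) B"
        by (simp only: image_Un hi) simp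
      then show ?thesis by (simp add: e'_def v'_def)
    qed
    show "e' i \<in> X"
      using eX edge i by (auto simp: e'_def N_def)
  qed
  moreover have "v' (N + (r - 1)) = y"
  proof -
    have "\<not> N + (r - 1) \<le> N" using r by linarith
    then have "v' (N + (r - 1)) = g (N + (r - 1) - N)" unfolding v'_def by (rule if_not_P)
    then show ?thesis unfolding add_diff_cancel_left' g(2) .
  qed
  ultimately show ?thesis using img N' unfolding N_def by metis
qed

lemma stack_loose_path:
  assumes "r \<ge> 2"
  shows "stack_ok r X ((x, R, B) # fs) \<Longrightarrow> blocks ((x, R, B) # fs) \<subseteq> V \<Longrightarrow>
    \<exists>v e. loose_path r V X (length fs) v e \<and>
      v ` {1..length fs * (r - 1) + 1} = blocks ((x, R, B) # fs) \<and> v (length fs * (r - 1) + 1) = x"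
proof (induction fs arbitrary: x R B)
  case Nil
  then show ?case by (intro exI[of _ "\<lambda>_. x"]) (auto simp: loose_path_def)
next
  case (Cons f fs)
  obtain x' R' B' where f: "f = (x', R', B')" by (metis prod_cases3)
  obtain v e where v: "loose_path r V X (length fs) v e"
    "v ` {1..length fs * (r - 1) + 1} = blocks (f # fs)" "v (length fs * (r - 1) + 1) = x'"
    using Cons.IH[of x' R' B'] Cons.prems by (auto simp: f)
  have "\<exists>v' e'. loose_path r V X (Suc (length fs)) v' e' \<and>
    v' ` {1..Suc (length fs) * (r - 1) + 1} = v ` {1..length fs * (r - 1) + 1} \<union> B \<and>
    v' (Suc (length fs) * (r - 1) + 1) = x"
  proof (rule loose_path_extend[OF assms v(1)])
    show "finite B" "card B = r - 1" "B \<subseteq> V" "x \<in> B" using Cons.prems by (auto simp: f)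
    show "B \<inter> v ` {1..length fs * (r - 1) + 1} = {}"
      unfolding v(2) using Cons.prems by (auto simp: f)
    show "insert (v (length fs * (r - 1) + 1)) B \<in> X"
      unfolding v(3) using Cons.prems by (auto simp: f)
  qed
  then show ?case unfolding v(2) by (auto simp: Un_commute)
qed

text \<open>The vertices at which a loose path can be cut between edges; indices \<open>0\<close>
  and \<open>l\<close> give its endpoints.\<close>

definition connector :: "nat \<Rightarrow> (nat \<Rightarrow> 'v) \<Rightarrow> nat \<Rightarrow> 'v" where
  "connector r v i = v (i * (r - 1) + 1)"

text \<open>The section between two connectors consists of \<open>j - a\<close> whole edges, and one
  more edge through \<open>r - 2\<close> fresh vertices returns to its start.\<close>

lemma close_cycle:
  assumes r: "r \<ge> 3" and path: "loose_path r V' X l v e" and V': "V' \<subseteq> V"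
    and Z: "finite Z" "card Z = r - 2" "Z \<subseteq> V - V'" and aj: "a < j" "j \<le> l"
    and edge: "insert (connector r v a) (insert (connector r v j) Z) \<in> X"
  shows "\<exists>v' e'. loose_cycle r V X (j - a + 1) v' e'"
proof -
  define L where "L = j - a"
  define N where "N = L * (r - 1) + 1"
  define x where "x = connector r v a"
  define y where "y = connector r v j"
  obtain h where h: "bij_betw h {1..r - 2} Z"
    using ex_bij_betw_nat_finite_1[OF Z(1)] Z(2) by metis
  \<comment> \<open>Positions up to \<open>N\<close> run along the section, from \<open>x\<close> to
    \<open>y\<close>; the next \<open>r - 2\<close> list \<open>Z\<close>, and the last one is
    \<open>x\<close> again.\<close>
  define v' where "v' = (\<lambda>t. if t \<le> N then v (a * (r - 1) + t) else if t < N + (r - 1) then h (t - N) else x)"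
  define e' where "e' = (\<lambda>t. if t \<le> L then e (a + t) else insert x (insert y Z))"
  have aL: "a * (r - 1) + L * (r - 1) = j * (r - 1)"
    using aj by (simp add: L_def add_mult_distrib[symmetric])
  have jl: "j * (r - 1) \<le> l * (r - 1)" using aj by (intro mult_le_mono1)
  have N': "(L + 1) * (r - 1) = N + (r - 2)" "(L + 1) * (r - 1) + 1 = N + (r - 1)"
    using r by (auto simp: N_def)
  have pv: "v ` {1..l * (r - 1) + 1} \<subseteq> V'" "inj_on v {1..l * (r - 1) + 1}"
    using path by (auto simp: loose_path_def)
  have eX: "\<forall>i\<in>{1..l}. e i \<in> X" using path unfolding loose_path_def by blast
  have lo: "v' ` I = v ` ((\<lambda>t. a * (r - 1) + t) ` I)" if "I \<subseteq> {..N}" for I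
    unfolding image_image using that by (intro image_cong) (auto simp: v'_def)
  have mid: "v' ` {N + 1..N + (r - 2)} = Z"
  proof -
    have "v' ` {N + 1..N + (r - 2)} = (\<lambda>i. v' (i + N)) ` {1..r - 2}"
      unfolding image_image[symmetric, of v' "\<lambda>i. i + N"] image_add_atLeastAtMost' by (simp add: add.commute)
    also have "\<dots> = h ` {1..r - 2}" by (intro image_cong) (auto simp: v'_def)
    finally show ?thesis using h by (simp add: bij_betw_def)
  qed
  have shift: "(\<lambda>t. a * (r - 1) + t) ` {1..N} \<subseteq> {1..l * (r - 1) + 1}"
  proof (rule image_subsetI)
    fix t assume "t \<in> {1..N}"
    then show "a * (r - 1) + t \<in> {1..l * (r - 1) + 1}"
      unfolding N_def atLeastAtMost_iff using aL jl by linarith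
  qed
  have loV: "v' ` {1..N} \<subseteq> V'" using lo[of "{1..N}"] shift pv(1) by auto
  have inj_lo: "inj_on v' {1..N}"
  proof (rule inj_onI)
    fix s t assume st: "s \<in> {1..N}" "t \<in> {1..N}" "v' s = v' t"
    then have "v (a * (r - 1) + s) = v (a * (r - 1) + t)" by (simp add: v'_def)
    then have "a * (r - 1) + s = a * (r - 1) + t"
      using st shift by (intro inj_onD[OF pv(2)]) auto
    then show "s = t" by simp
  qed
  have inj_mid: "inj_on v' {N + 1..N + (r - 2)}"
    by (rule eq_card_imp_inj_on) (simp_all only: mid Z(2), simp_all)
  have split: "{1..N + (r - 2)} = {1..N} \<union> {N + 1..N + (r - 2)}" by (auto simp: N_def)
  have "\<not> N + (r - 1) \<le> N" using r by linarith
  then have last: "v' (N + (r - 1)) = x" unfolding v'_def by (simp only: if_False less_irrefl)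
  have first: "v' 1 = x" by (simp add: v'_def N_def x_def connector_def)
  have atN: "v' N = y" using aL by (simp add: v'_def y_def connector_def N_def add.assoc[symmetric])
  have full: "{1..N + (r - 1)} = {1..N + (r - 2)} \<union> {N + (r - 1)}" using r by auto
  have "loose_cycle r V X (L + 1) v' e'"
    unfolding loose_cycle_def N'(2) unfolding N'(1)
  proof (intro conjI ballI)
    show "1 \<le> L + 1" by simp
    show "v' (N + (r - 1)) = v' 1" using last first by simp
    have "1 \<in> {1..N}" by (simp add: N_def)
    then have "x \<in> v' ` {1..N}" unfolding first[symmetric] by (rule imageI)
    moreover have "v' ` {1..N + (r - 1)} = (v' ` {1..N} \<union> Z) \<union> {x}"
      by (simp only: full split image_Un mid image_insert image_empty last)
    ultimately have "v' ` {1..N + (r - 1)} = v' ` {1..N} \<union> Z" by blast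
    then show "v' ` {1..N + (r - 1)} \<subseteq> V" using loV V' Z by auto
    show "inj_on v' {1..N + (r - 2)}"
      unfolding split inj_on_Un using inj_lo inj_mid mid loV Z(3) by auto
    fix t assume t: "t \<in> {1..L + 1}"
    show "e' t \<in> X"
      using t eX edge aj by (auto simp: e'_def x_def y_def L_def)
    show "e' t = v' ` {(t - 1) * (r - 1) + 1..(t - 1) * (r - 1) + r}"
    proof (cases "t \<le> L")
      case True
      obtain u where u: "t = Suc u" using t by (cases t) auto
      have "u * (r - 1) + (r - 1) = t * (r - 1)" by (simp add: u)
      also have "\<dots> \<le> L * (r - 1)" using True by (intro mult_le_mono1)
      finally have "{(t - 1) * (r - 1) + 1..(t - 1) * (r - 1) + r} \<subseteq> {..N}"
        using r by (auto simp: N_def u)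
      then have "v' ` {(t - 1) * (r - 1) + 1..(t - 1) * (r - 1) + r}
        = v ` {(a + t - 1) * (r - 1) + 1..(a + t - 1) * (r - 1) + r}"
      proof -
        have "(\<lambda>t. a * (r - 1) + t) ` {u * (r - 1) + 1..u * (r - 1) + r}
          = {(a + u) * (r - 1) + 1..(a + u) * (r - 1) + r}"
          unfolding image_add_atLeastAtMost add_mult_distrib by (simp only: ac_simps)
        moreover have "t - 1 = u" "a + t - 1 = a + u" by (simp_all add: u)
        ultimately show ?thesis using lo[OF \<open>_ \<subseteq> {..N}\<close>] by (simp only:)
      qed
      then show ?thesis using path t True aj by (simp add: e'_def loose_path_def L_def)
    next
      case False
      then have [simp]: "t = Suc L" using t by auto
      have "{L * (r - 1) + 1..L * (r - 1) + r} = {N} \<union> {N + 1..N + (r - 2)} \<union> {N + (r - 1)}"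
        using r by (auto simp: N_def)
      then have "v' ` {L * (r - 1) + 1..L * (r - 1) + r} = {y} \<union> Z \<union> {x}"
        by (simp only: image_Un mid image_insert image_empty atN last)
      then show ?thesis by (auto simp: e'_def)
    qed
  qed
  then show ?thesis unfolding L_def by blast
qed

section \<open>The second exposure\<close>

lemma probab_avoid:
  assumes "finite A" "C \<subseteq> A"
  shows "probab A p (\<lambda>X. X \<inter> C = {}) = (1 - p) ^ card C"
proof -
  have "finite C" using assms finite_subset by blast
  then show ?thesis using assms
  proof (induction C arbitrary: A)
    case (insert c C)
    have "probab A p (\<lambda>X. X \<inter> insert c C = {})
      = p * probab (A - {c}) p (\<lambda>X. insert c X \<inter> insert c C = {})
        + (1 - p) * probab (A - {c}) p (\<lambda>X. X \<inter> insert c C = {})"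
      using insert.prems by (intro expect_remove) auto
    also have "probab (A - {c}) p (\<lambda>X. insert c X \<inter> insert c C = {}) = 0"
      using insert.prems by simp
    also have "probab (A - {c}) p (\<lambda>X. X \<inter> insert c C = {}) = probab (A - {c}) p (\<lambda>X. X \<inter> C = {})"
      by (intro expect_cong arg_cong[where f = of_bool]) auto
    also have "\<dots> = (1 - p) ^ card C"
      using insert by (intro insert.IH) auto
    finally show ?case using insert.hyps by simp
  qed simp
qed

text \<open>A single pair of ends would offer only about \<open>n ^ (r - 2)\<close> closing edges,
  too few for an edge probability of order \<open>n ^ (1 - r)\<close>. Letting both ends vary over
  \<open>s\<close> connectors, with \<open>s\<close> linear in \<open>n\<close>, gives order
  \<open>n ^ r\<close> candidates at the cost of at most \<open>2 * s\<close> edges of the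
  path.\<close>

lemma closing_edges:
  fixes v :: "nat \<Rightarrow> nat" and m n s :: nat
  assumes r: "r \<ge> 3" and path: "loose_path r {1..m} X l v e" and mn: "m \<le> n" and s: "2 * s \<le> l"
  shows "\<exists>C \<subseteq> complete_edges r n - complete_edges r m. card C = s * s * ((n - m) choose (r - 2)) \<and>
    (\<forall>f\<in>C. \<exists>l' v' e'. l - 2 * s \<le> l' \<and> loose_cycle r {1..n} (insert f X) l' v' e')"
proof -
  let ?c = "connector r v"
  let ?W = "{m + 1..n}"
  let ?I = "({..<s} \<times> {l - s<..l}) \<times> {Z. Z \<subseteq> ?W \<and> card Z = r - 2}"
  let ?f = "\<lambda>((a, j), Z). insert (?c a) (insert (?c j) Z)"
  have vm: "v ` {1..l * (r - 1) + 1} \<subseteq> {1..m}" and vinj: "inj_on v {1..l * (r - 1) + 1}"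
    using path by (auto simp: loose_path_def)
  have idx: "i * (r - 1) + 1 \<in> {1..l * (r - 1) + 1}" if "i \<le> l" for i
    using mult_le_mono1[OF that, of "r - 1"] by auto
  have cm: "?c i \<in> {1..m}" if "i \<le> l" for i
    unfolding connector_def using imageI[OF idx[OF that], of v] vm by blast
  have cinj: "i = j" if "?c i = ?c j" "i \<le> l" "j \<le> l" for i j
    using inj_onD[OF vinj _ idx[OF that(2)] idx[OF that(3)]] that(1) r by (auto simp: connector_def)
  have I: "a \<le> l" "j \<le> l" "a < j" "a < s" "l - s < j" "Z \<subseteq> ?W" "card Z = r - 2" "finite Z"
    if "((a, j), Z) \<in> ?I" for a j Z
    using that s by (auto intro: finite_subset[OF _ finite_atLeastAtMost])
  have cW: "?c i \<notin> ?W" if "i \<le> l" for i using cm[OF that] by auto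
  have inj: "inj_on ?f ?I"
  proof (rule inj_onI)
    fix i i' assume *: "i \<in> ?I" "i' \<in> ?I" "?f i = ?f i'"
    obtain a j Z where i: "i = ((a, j), Z)" by (metis prod.collapse)
    obtain a' j' Z' where i': "i' = ((a', j'), Z')" by (metis prod.collapse)
    note J = I[OF *(1)[unfolded i]] and J' = I[OF *(2)[unfolded i']]
    have eq: "insert (?c a) (insert (?c j) Z) = insert (?c a') (insert (?c j') Z')"
      using *(3) by (simp add: i i')
    have "insert (?c a) (insert (?c j) Z) \<inter> ?W = Z"
      using cW[OF J(1)] cW[OF J(2)] J(6) by auto
    moreover have "insert (?c a') (insert (?c j') Z') \<inter> ?W = Z'"
      using cW[OF J'(1)] cW[OF J'(2)] J'(6) by auto
    ultimately have Z: "Z = Z'" using eq by simp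
    have "insert (?c a) (insert (?c j) Z) - ?W = {?c a, ?c j}"
      using cW[OF J(1)] cW[OF J(2)] J(6) by auto
    moreover have "insert (?c a') (insert (?c j') Z') - ?W = {?c a', ?c j'}"
      using cW[OF J'(1)] cW[OF J'(2)] J'(6) by auto
    ultimately have "{?c a, ?c j} = {?c a', ?c j'}" using eq by simp
    then have "(?c a = ?c a' \<and> ?c j = ?c j') \<or> (?c a = ?c j' \<and> ?c j = ?c a')"
      by (simp add: doubleton_eq_iff)
    \<comment> \<open>The swapped matching is impossible, since
      \<open>a < s \<le> l - s < j'\<close>.\<close>
    then have "a = a' \<and> j = j'"
    proof
      assume "?c a = ?c j' \<and> ?c j = ?c a'"
      then have "a = j'" using cinj J(1) J'(2) by blast
      then show ?thesis using J(4) J'(5) s by linarith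
    qed (use cinj J J' in blast)
    then show "i = i'" using Z by (simp add: i i')
  qed
  have card: "card (?f ` ?I) = s * s * ((n - m) choose (r - 2))"
  proof -
    have "card (?f ` ?I) = card ?I" by (rule card_image[OF inj])
    also have "\<dots> = card {..<s} * card {l - s<..l} * card {Z. Z \<subseteq> ?W \<and> card Z = r - 2}"
      by (simp only: card_cartesian_product)
    also have "card {Z. Z \<subseteq> ?W \<and> card Z = r - 2} = (n - m) choose (r - 2)"
      by (simp add: n_subsets)
    also have "card {l - s<..l} = s" using s by simp
    finally show ?thesis by simp
  qed
  have sub: "?f ` ?I \<subseteq> complete_edges r n - complete_edges r m"
  proof (rule image_subsetI)
    fix i assume *: "i \<in> ?I"
    obtain a j Z where i: "i = ((a, j), Z)" by (metis prod.collapse)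
    note J = I[OF *[unfolded i]]
    have "?c a \<noteq> ?c j" using cinj[of a j] J(1-3) by blast
    moreover have "?c a \<notin> Z" "?c j \<notin> Z" using cW[OF J(1)] cW[OF J(2)] J(6) by auto
    ultimately have "card (?f i) = r" using J(7,8) r by (simp add: i)
    moreover have "?f i \<subseteq> {1..n}" using cm[OF J(1)] cm[OF J(2)] J(6) mn by (auto simp: i)
    moreover have "\<not> ?f i \<subseteq> {1..m}"
    proof -
      have "Z \<noteq> {}" using J(7) r by auto
      then obtain z where "z \<in> Z" by blast
      then have "z \<in> ?f i" "z \<notin> {1..m}" using J(6) by (auto simp: i)
      then show ?thesis by blast
    qed
    ultimately show "?f i \<in> complete_edges r n - complete_edges r m"
      by (simp add: complete_edges_def)
  qed
  have cyc: "\<exists>l' v' e'. l - 2 * s \<le> l' \<and> loose_cycle r {1..n} (insert f X) l' v' e'" if "f \<in> ?f ` ?I" for f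
  proof -
    from that obtain i where f: "f = ?f i" and *: "i \<in> ?I" by (rule imageE)
    obtain a j Z where i: "i = ((a, j), Z)" by (metis prod.collapse)
    note J = I[OF *[unfolded i]]
    have "loose_path r {1..m} (insert f X) l v e" using path by (auto simp: loose_path_def)
    then have "\<exists>v' e'. loose_cycle r {1..n} (insert f X) (j - a + 1) v' e'"
    proof (rule close_cycle[OF r])
      show "{1..m} \<subseteq> {1..n}" using mn by auto
      show "finite Z" "card Z = r - 2" "a < j" "j \<le> l" by (fact J)+
      show "Z \<subseteq> {1..n} - {1..m}" using J(6) by auto
      show "insert (?c a) (insert (?c j) Z) \<in> insert f X" using f by (simp add: i)
    qed
    moreover have "l - 2 * s \<le> j - a + 1" using J(4,5) by linarith
    ultimately show ?thesis by blast
  qed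
  show ?thesis
    by (rule exI[of _ "?f ` ?I"], intro conjI sub card ballI cyc)
qed

text \<open>The path depends only on edges inside \<open>{1..m}\<close>, whereas all closing edges
  contain a vertex beyond \<open>m\<close>. Given the path, they are still unexposed and
  independent.\<close>

lemma probab_short_cycle_le:
  fixes m n s :: nat
  assumes r: "r \<ge> 3" and p: "0 \<le> p" "p \<le> 1" and mn: "m \<le> n" and s: "2 * s \<le> l0"
  shows "probab (complete_edges r n) p (\<lambda>E. L_C r {1..n} E < l0 - 2 * s)
    \<le> probab (complete_edges r m) p (\<lambda>X. \<not> (\<exists>l v e. l0 \<le> l \<and> loose_path r {1..m} X l v e))
      + (1 - p) ^ (s * s * ((n - m) choose (r - 2)))"
proof -
  let ?A = "complete_edges r m" and ?B = "complete_edges r n - complete_edges r m"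
  let ?P = "\<lambda>X. \<exists>l v e. l0 \<le> l \<and> loose_path r {1..m} X l v e"
  let ?q = "(1 - p) ^ (s * s * ((n - m) choose (r - 2)))"
  have AB: "complete_edges r n = ?A \<union> ?B" using mn by (auto simp: complete_edges_def)
  have fin: "finite ?A" "finite ?B" by simp_all
  have "probab (complete_edges r n) p (\<lambda>E. L_C r {1..n} E < l0 - 2 * s)
    = expect ?A p (\<lambda>X. probab ?B p (\<lambda>Y. L_C r {1..n} (X \<union> Y) < l0 - 2 * s))"
    by (subst AB) (rule expect_Un[OF fin], blast)
  also have "\<dots> \<le> expect ?A p (\<lambda>X. of_bool (\<not> ?P X) + ?q)"
  proof (rule expect_mono[OF p])
    fix X
    show "probab ?B p (\<lambda>Y. L_C r {1..n} (X \<union> Y) < l0 - 2 * s) \<le> of_bool (\<not> ?P X) + ?q"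
    proof (cases "?P X")
      case False
      have "0 \<le> ?q" using p by simp
      then show ?thesis using False probab_le_1[OF fin(2) p, of "\<lambda>Y. L_C r {1..n} (X \<union> Y) < l0 - 2 * s"] by simp
    next
      case True
      then obtain l v e where l: "l0 \<le> l" "loose_path r {1..m} X l v e" by blast
      have "2 * s \<le> l" using s l by simp
      from closing_edges[OF r l(2) mn this] obtain C where C: "C \<subseteq> ?B"
        "card C = s * s * ((n - m) choose (r - 2))"
        "\<forall>f\<in>C. \<exists>l' v' e'. l - 2 * s \<le> l' \<and> loose_cycle r {1..n} (insert f X) l' v' e'"
        by (elim exE conjE) (rule that)
      have "probab ?B p (\<lambda>Y. L_C r {1..n} (X \<union> Y) < l0 - 2 * s) \<le> probab ?B p (\<lambda>Y. Y \<inter> C = {})"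
      proof (rule probab_mono[OF p], rule ccontr)
        fix Y assume Y: "L_C r {1..n} (X \<union> Y) < l0 - 2 * s" "Y \<inter> C \<noteq> {}"
        then obtain f where f: "f \<in> Y" "f \<in> C" by blast
        then obtain l' v' e' where c: "l - 2 * s \<le> l'" "loose_cycle r {1..n} (insert f X) l' v' e'"
          using C(3) by blast
        have "loose_cycle r {1..n} (X \<union> Y) l' v' e'"
          using c(2) f(1) by (auto simp: loose_cycle_def)
        then have "l' \<le> L_C r {1..n} (X \<union> Y)" using r by (intro L_C_ge) auto
        then show False using Y(1) c(1) l(1) by simp
      qed
      also have "\<dots> = ?q" using probab_avoid[OF fin(2) C(1)] C(2) by simp
      finally show ?thesis using True by simp
    qed
  qed
  also have "\<dots> = probab ?A p (\<lambda>X. \<not> ?P X) + ?q" using fin by (simp add: expect_add)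
  finally show ?thesis .
qed

lemma probab_no_long_path_le:
  fixes m N0 T0 tgt :: nat
  assumes r: "r \<ge> 2" and p: "0 \<le> p" "p \<le> 1" and c: "0 < c" and T0: "T0 \<le> m" and tgt: "1 \<le> tgt"
    and sparse: "N0 < T0 * ((m - T0 - tgt) choose (r - 1))"
    and dense: "real T0 + real tgt \<le> (real r - 1) * (p * real N0 - c)"
    and l0: "1 + (r - 1) * l0 \<le> tgt"
  shows "probab (complete_edges r m) p (\<lambda>X. \<not> (\<exists>l v e. l0 \<le> l \<and> loose_path r {1..m} X l v e))
    \<le> p * real N0 / c\<^sup>2"
proof -
  interpret dfs "{1..m}" r N0 T0 by unfold_locales (use r in auto)
  have edges: "edges = complete_edges r m" unfolding edges_def complete_edges_def ..
  let ?i = "N0 + 2 * card {1..m} + 1"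
  have "probab edges p (\<lambda>X. \<not> (\<exists>l v e. l0 \<le> l \<and> loose_path r {1..m} X l v e))
    \<le> probab edges p (\<lambda>X. real (card (queried (run X ?i) \<inter> X)) \<le> p * real (card (queried (run X ?i))) - c)"
  proof (rule probab_mono[OF p], rule ccontr)
    fix X assume nopath: "\<not> (\<exists>l v e. l0 \<le> l \<and> loose_path r {1..m} X l v e)"
      and typical: "\<not> real (card (queried (run X ?i) \<inter> X)) \<le> p * real (card (queried (run X ?i))) - c"
    have "\<exists>fs. fs \<noteq> [] \<and> stack_ok r X fs \<and> blocks fs \<subseteq> {1..m} \<and> tgt \<le> 1 + (r - 1) * (length fs - 1)"
      by (rule long_stack[where p = p and c = c]) (use T0 tgt sparse dense typical in \<open>simp_all only: card_atLeastAtMost diff_Suc_1 add_diff_cancel_left' not_le\<close>)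
    then obtain fs where fs: "fs \<noteq> []" "stack_ok r X fs" "blocks fs \<subseteq> {1..m}"
      "tgt \<le> 1 + (r - 1) * (length fs - 1)" by blast
    obtain x R B fs' where f: "fs = (x, R, B) # fs'" using fs(1) by (metis list.exhaust prod_cases3)
    obtain v e where "loose_path r {1..m} X (length fs') v e"
      using stack_loose_path[OF r fs(2)[unfolded f] fs(3)[unfolded f]] by blast
    moreover have "(r - 1) * l0 \<le> (r - 1) * (length fs - 1)" using l0 fs(4) by linarith
    then have "l0 \<le> length fs - 1" using r by (subst (asm) mult_le_cancel1) auto
    then have "l0 \<le> length fs'" by (simp add: f)
    ultimately show False using nopath by blast
  qed
  also have "\<dots> \<le> p * real N0 / c\<^sup>2"
  proof (rule few_positive_answers[OF p c])
    fix X
    have "within_budget (run X ?i)" using run_invariant by blast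
    then show "card (queried (run X ?i)) \<le> N0" by (cases "run X ?i") simp
  qed
  finally show ?thesis unfolding edges .
qed

section \<open>The lower tail\<close>

text \<open>Compare the products factor by factor. In this form the lemma shows that losing a small
  fraction of the vertices costs only a correspondingly small fraction of the
  \<open>d\<close>-subsets.\<close>

lemma binomial_ratio_ge:
  assumes "d \<le> a" "d \<le> b"
  shows "(real a - real d) ^ d * real (b choose d) \<le> real b ^ d * real (a choose d)"
proof -
  have alt: "real (k choose d) = (\<Prod>i<d. real (k - i) / real (d - i))" if "d \<le> k" for k
    using binomial_altdef_of_nat[OF that, where 'a = real] by (simp only: lessThan_atLeast0)
  have "(real a - real d) ^ d * real (b choose d) = (\<Prod>i<d. (real a - real d) * (real (b - i) / real (d - i)))"
    unfolding alt[OF assms(2)] prod.distrib by simp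
  also have "\<dots> \<le> (\<Prod>i<d. real b * (real (a - i) / real (d - i)))"
  proof (rule prod_mono)
    fix i assume i: "i \<in> {..<d}"
    have "(real a - real d) * real (b - i) \<le> real b * real (a - i)"
      using assms i by (subst mult.commute, intro mult_mono) auto
    then have "(real a - real d) * real (b - i) / real (d - i) \<le> real b * real (a - i) / real (d - i)"
      by (intro divide_right_mono) auto
    then show "0 \<le> (real a - real d) * (real (b - i) / real (d - i)) \<and>
      (real a - real d) * (real (b - i) / real (d - i)) \<le> real b * (real (a - i) / real (d - i))"
      using assms by simp
  qed
  also have "\<dots> = real b ^ d * real (a choose d)"
    unfolding alt[OF assms(1)] prod.distrib by simp
  finally show ?thesis .
qed

text \<open>In units of \<open>n\<close>, \<open>\<kappa>\<close> bounds the vertices removed from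
  the pool, \<open>\<theta>\<close> is the budget of exhausted vertices and \<open>A\<close> the
  target for alive ones. The leading part of \<open>A\<close> is
  \<open>\<epsilon> * \<tau> - d * \<tau>\<^sup>2\<close>, that is
  \<open>\<epsilon>\<^sup>2 / (4 * d)\<close>. The final \<open>3 * \<epsilon> ^ 3\<close> covers
  rounding and the \<open>2 * s\<close> edges lost in closing the cycle.\<close>

lemma lower_constant:
  fixes d \<epsilon> :: real
  assumes d: "2 \<le> d" and e: "0 < \<epsilon>" "\<epsilon> \<le> 1 / (2 * d)"
  defines "\<tau> \<equiv> \<epsilon> / (2 * d)"
  defines "\<kappa> \<equiv> (1 + \<epsilon>) * \<tau> + 2 * \<epsilon> ^ 3"
  defines "\<theta> \<equiv> \<tau> / (1 - d * \<kappa>) + \<epsilon> ^ 3"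
  defines "A \<equiv> (1 + \<epsilon>) * \<tau> - d * \<epsilon> ^ 3 - \<theta> - 2 * \<epsilon> ^ 3"
  shows "d * \<kappa> \<le> 1/2" "\<epsilon>\<^sup>2 / (4 * d\<^sup>2) - 6 * \<epsilon> ^ 3 \<le> A / d - 3 * \<epsilon> ^ 3"
proof -
  have de: "d * \<epsilon> \<le> 1/2" using d e by (simp add: field_simps)
  have "2 * \<epsilon> \<le> d * \<epsilon>" using d e by (intro mult_right_mono) auto
  then have e4: "\<epsilon> \<le> 1/4" using de by simp
  define x where "x = d * \<kappa>"
  have "d * \<tau> = \<epsilon> / 2" using d by (simp add: \<tau>_def)
  then have "x = (1 + \<epsilon>) * (\<epsilon> / 2) + 2 * (d * \<epsilon>) * \<epsilon>\<^sup>2"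
    unfolding x_def \<kappa>_def by (simp add: algebra_simps power2_eq_square power3_eq_cube)
  moreover have "2 * (d * \<epsilon>) * \<epsilon>\<^sup>2 \<le> 1 * \<epsilon>\<^sup>2" using de by (intro mult_right_mono) auto
  moreover have "(1 + \<epsilon>) * (\<epsilon> / 2) = \<epsilon> / 2 + 1/2 * \<epsilon>\<^sup>2"
    by (simp add: field_simps power2_eq_square)
  ultimately have x: "x \<le> \<epsilon> / 2 + 3/2 * \<epsilon>\<^sup>2" by linarith
  have ee: "\<epsilon>\<^sup>2 \<le> 1/4 * \<epsilon>" unfolding power2_eq_square using e e4 by (intro mult_right_mono) auto
  then have xe: "x \<le> \<epsilon>" using x e by linarith
  then show xh: "d * \<kappa> \<le> 1/2" using e4 by (simp add: x_def)
  have x0: "0 \<le> x" unfolding x_def \<kappa>_def \<tau>_def using d e by simp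
  have "(1 + x + 2 * x\<^sup>2) * (1 - x) = 1 + x\<^sup>2 * (1 - 2 * x)"
    by (simp add: algebra_simps power2_eq_square)
  then have "1 \<le> (1 + x + 2 * x\<^sup>2) * (1 - x)" using xh by (simp add: x_def)
  then have "1 / (1 - x) \<le> 1 + x + 2 * x\<^sup>2" using xh by (simp add: x_def pos_divide_le_eq)
  also have "\<dots> \<le> 1 + (\<epsilon> / 2 + 3/2 * \<epsilon>\<^sup>2) + 2 * \<epsilon>\<^sup>2"
    using x xe x0 by (intro add_mono mult_left_mono power_mono) auto
  finally have "\<tau> * (1 / (1 - x)) \<le> \<tau> * (1 + \<epsilon> / 2 + 7/2 * \<epsilon>\<^sup>2)"
    unfolding \<tau>_def using d e by (intro mult_left_mono) auto
  also have "\<dots> = \<tau> + \<epsilon>\<^sup>2 / (4 * d) + 7 / (4 * d) * \<epsilon> ^ 3"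
    unfolding \<tau>_def using d by (simp add: field_simps power2_eq_square power3_eq_cube)
  also have "\<dots> \<le> \<tau> + \<epsilon>\<^sup>2 / (4 * d) + 1 * \<epsilon> ^ 3"
    using d e by (intro add_left_mono mult_right_mono) auto
  finally have "\<theta> \<le> \<tau> + \<epsilon>\<^sup>2 / (4 * d) + 2 * \<epsilon> ^ 3" unfolding \<theta>_def x_def by simp
  moreover have "(1 + \<epsilon>) * \<tau> = \<tau> + 2 * (\<epsilon>\<^sup>2 / (4 * d))"
    unfolding \<tau>_def using d by (simp add: field_simps power2_eq_square)
  ultimately have "\<epsilon>\<^sup>2 / (4 * d) - (d + 4) * \<epsilon> ^ 3 \<le> A"
    unfolding A_def by (simp add: algebra_simps)
  then have "(\<epsilon>\<^sup>2 / (4 * d) - (d + 4) * \<epsilon> ^ 3) / d \<le> A / d" using d by (intro divide_right_mono) auto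
  moreover have "(\<epsilon>\<^sup>2 / (4 * d) - (d + 4) * \<epsilon> ^ 3) / d = \<epsilon>\<^sup>2 / (4 * d\<^sup>2) - (d + 4) / d * \<epsilon> ^ 3"
    using d by (simp add: field_simps power2_eq_square)
  moreover have "(d + 4) / d * \<epsilon> ^ 3 \<le> 3 * \<epsilon> ^ 3"
    using d e by (intro mult_right_mono) (auto simp: field_simps)
  ultimately show "\<epsilon>\<^sup>2 / (4 * d\<^sup>2) - 6 * \<epsilon> ^ 3 \<le> A / d - 3 * \<epsilon> ^ 3" by linarith
qed

text \<open>The parameters of the search: \<open>N0 = \<tau> n M\<close> queries with \<open>\<tau> = \<epsilon> / (2 d)\<close>, which maximises
  the resulting path length \<open>(\<epsilon> \<tau> - d \<tau>\<^sup>2) n / d\<close> up to terms of order \<open>\<epsilon>\<^sup>3\<close>; the last \<open>\<epsilon>\<^sup>3 n\<close>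
  vertices are reserved for closing the cycle.\<close>

lemma lower_tail_bound:
  fixes r n :: nat and \<epsilon> :: real
  assumes r: "r \<ge> 3" and e: "0 < \<epsilon>" "\<epsilon> \<le> 1 / (2 * (real r - 1))"
    and n: "r \<le> n" "2 * real r + 2 \<le> \<epsilon> ^ 3 * real n"
  shows "probab (complete_edges r n) (edge_prob r \<epsilon> n)
      (\<lambda>E. \<not> (\<epsilon>\<^sup>2 / (4 * (real r - 1)\<^sup>2) - 6 * \<epsilon> ^ 3) * real n \<le> real (L_C r {1..n} E))
    \<le> 1 / (\<epsilon> ^ 6 * real n)
      + exp (- ((\<epsilon> ^ 3 / 2)\<^sup>2 * (\<epsilon> ^ 3 / (2 * real (r - 2))) ^ (r - 2) / (real r - 1) * real n))"
proof -
  define d where "d = r - 1"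
  have d: "real d = real r - 1" "2 \<le> real d" "d \<ge> 2" using r by (auto simp: d_def of_nat_diff)
  define z where "z = \<epsilon> ^ 3"
  have z: "0 < z" using e by (simp add: z_def)
  define \<tau> where "\<tau> = \<epsilon> / (2 * real d)"
  define \<kappa> where "\<kappa> = (1 + \<epsilon>) * \<tau> + 2 * z"
  define \<theta> where "\<theta> = \<tau> / (1 - real d * \<kappa>) + z"
  define A where "A = (1 + \<epsilon>) * \<tau> - real d * z - \<theta> - 2 * z"
  have e': "\<epsilon> \<le> 1 / (2 * real d)" using e by (simp add: d)
  have K: "real d * \<kappa> \<le> 1/2" "\<epsilon>\<^sup>2 / (4 * (real d)\<^sup>2) - 6 * z \<le> A / real d - 3 * z"
    using lower_constant[OF d(2) e(1) e'] unfolding A_def \<theta>_def \<kappa>_def \<tau>_def z_def by auto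
  have tau: "0 < \<tau>" using e d by (simp add: \<tau>_def)
  have "2 * \<kappa> \<le> real d * \<kappa>" using d tau z e by (intro mult_right_mono) (auto simp: \<kappa>_def)
  then have kap: "\<kappa> \<le> 1/4" using K by simp
  let ?p = "edge_prob r \<epsilon> n" and ?M = "(n - 1) choose (r - 1)"
  have r2: "2 \<le> r" using r by simp
  have nz: "2 * real d + 4 \<le> z * real n" using n d by (simp add: z_def)
  have n0: "0 < real n" using n r by simp
  have ehalf: "\<epsilon> \<le> 1/4"
  proof -
    have "1 / (2 * real d) \<le> 1 / (2 * 2)" using d by (intro divide_left_mono) auto
    then show ?thesis using e' by simp
  qed
  note p = edge_prob_bounds[OF r2 n(1) e(1)]
  have p1: "?p \<le> 1"
  proof -
    have "(1 + \<epsilon>) / real (n - 1) \<le> 1" using ehalf n r by (simp add: of_nat_diff)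
    then show ?thesis using p by simp
  qed
  have deg: "real ?M * ?p = (1 + \<epsilon>) / real d" using edge_prob_degree[OF r2 n(1)] by (simp add: d)
  have M: "0 < real ?M" using n r by simp
  let ?good = "\<lambda>E. (\<epsilon>\<^sup>2 / (4 * (real r - 1)\<^sup>2) - 6 * \<epsilon> ^ 3) * real n \<le> real (L_C r {1..n} E)"
  show ?thesis
  \<comment> \<open>In the first case the claimed length is not positive and nothing has to be
    found; otherwise \<open>A\<close> is large enough for the integer parameters below.\<close>
  proof (cases "A / real d - 3 * z \<le> 0")
    case True
    then have "\<epsilon>\<^sup>2 / (4 * (real r - 1)\<^sup>2) - 6 * \<epsilon> ^ 3 \<le> 0" using K(2) d by (simp add: z_def)
    then have "(\<epsilon>\<^sup>2 / (4 * (real r - 1)\<^sup>2) - 6 * \<epsilon> ^ 3) * real n \<le> 0"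
      by (intro mult_nonpos_nonneg) auto
    then have "?good E" for E by (rule order_trans) simp
    then have "probab (complete_edges r n) ?p (\<lambda>E. \<not> ?good E) = 0" by simp
    also have "0 \<le> 1 / (\<epsilon> ^ 6 * real n)
      + exp (- ((\<epsilon> ^ 3 / 2)\<^sup>2 * (\<epsilon> ^ 3 / (2 * real (r - 2))) ^ (r - 2) / (real r - 1) * real n))"
      using e by (intro add_nonneg_nonneg) auto
    finally show ?thesis .
  next
    case False
    then have "3 * z < A / real d" by simp
    then have A3: "3 * z * real d < A" using d by (simp add: pos_less_divide_eq)
    have "3 * z * 2 \<le> 3 * z * real d" using z d by (intro mult_left_mono) auto
    then have A0: "z < A" using A3 z by linarith
    define s where "s = nat \<lfloor>z * real n\<rfloor>"
    define m where "m = n - s"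
    define N0 where "N0 = nat \<lfloor>\<tau> * real n * real ?M\<rfloor>"
    define T0 where "T0 = nat \<lceil>\<theta> * real n\<rceil>"
    define tgt where "tgt = nat \<lfloor>A * real n\<rfloor>"
    define l0 where "l0 = (tgt - 1) div d"
    have zn: "0 \<le> z * real n" using z by simp
    have s: "real s \<le> z * real n" "z * real n - 1 \<le> real s"
      using zn unfolding s_def by linarith+
    have An: "z * real n \<le> A * real n" using A0 by (intro mult_right_mono) auto
    have tgt: "real tgt \<le> A * real n" "A * real n - 1 \<le> real tgt"
      using An zn unfolding tgt_def by linarith+
    have N0: "real N0 \<le> \<tau> * real n * real ?M" "\<tau> * real n * real ?M - 1 \<le> real N0"
    proof -
      have "0 \<le> \<tau> * real n * real ?M" using tau by simp
      then show "real N0 \<le> \<tau> * real n * real ?M" "\<tau> * real n * real ?M - 1 \<le> real N0"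
        unfolding N0_def by linarith+
    qed
    have den: "0 < 1 - real d * \<kappa>" using K by simp
    then have th: "0 < \<theta>" using tau z by (simp add: \<theta>_def add_pos_pos)
    have T0: "\<theta> * real n \<le> real T0" "real T0 \<le> \<theta> * real n + 1"
    proof -
      have "0 \<le> \<theta> * real n" using th by simp
      then show "\<theta> * real n \<le> real T0" "real T0 \<le> \<theta> * real n + 1" unfolding T0_def by linarith+
    qed
    have sn: "s \<le> n"
    proof -
      have "z \<le> 1" using e ehalf by (simp add: z_def power_le_one)
      then have "z * real n \<le> 1 * real n" by (intro mult_right_mono) auto
      then have "real s \<le> real n" using s(1) by linarith
      then show ?thesis by simp
    qed
    then have m: "real m = real n - real s" "m \<le> n" "n - m = s" by (auto simp: m_def of_nat_diff)
    have sum: "\<theta> * real n + A * real n = (1 + \<epsilon>) * \<tau> * real n - real d * (z * real n) - 2 * (z * real n)"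
      unfolding A_def by (simp add: algebra_simps)
    have dz: "2 * (z * real n) \<le> real d * (z * real n)" using zn d by (intro mult_right_mono) auto
    \<comment> \<open>The \<open>\<epsilon> ^ 3\<close> terms subtracted in \<open>A\<close> pay for
      the \<open>s\<close> reserved vertices and for rounding.\<close>
    have rest: "(1 - (1 + \<epsilon>) * \<tau>) * real n \<le> real m - real T0 - real tgt"
    proof -
      have "real m - real T0 - real tgt \<ge> real n - z * real n - (\<theta> * real n + 1) - A * real n"
        using s T0 tgt m by linarith
      moreover have "real n - z * real n - (\<theta> * real n + 1) - A * real n
        = (1 - (1 + \<epsilon>) * \<tau>) * real n + real d * (z * real n) + z * real n - 1"
        using sum by (simp add: algebra_simps)
      ultimately show ?thesis using dz nz d by linarith
    qed
    have kn: "(1 - \<kappa>) * real n + real d \<le> (1 - (1 + \<epsilon>) * \<tau>) * real n"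
    proof -
      have "(1 - (1 + \<epsilon>) * \<tau>) * real n = (1 - \<kappa>) * real n + 2 * (z * real n)"
        unfolding \<kappa>_def by (simp add: algebra_simps)
      then show ?thesis using nz d by linarith
    qed
    have kpos: "0 < (1 - \<kappa>) * real n" using kap n0 by simp
    define a where "a = m - T0 - tgt"
    have a: "real a = real m - real T0 - real tgt" "T0 \<le> m"
    proof -
      have "real T0 + real tgt \<le> real m" using rest kn kpos d by linarith
      then have "T0 + tgt \<le> m" by linarith
      then show "real a = real m - real T0 - real tgt" "T0 \<le> m"
        by (auto simp: a_def of_nat_diff)
    qed
    have ad: "(1 - \<kappa>) * real n \<le> real a - real d" using rest kn a by linarith
    have da: "d \<le> a" using ad kpos by linarith
    have binom: "(1 - real d * \<kappa>) * real ?M \<le> real (a choose d)"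
    proof -
      have n1: "0 < real (n - 1)" using n r by simp
      have "(1 - real d * \<kappa>) \<le> (1 - \<kappa>) ^ d"
        using Bernoulli_inequality[of "- \<kappa>" d] kap by simp
      then have "(1 - real d * \<kappa>) * real ?M * real (n - 1) ^ d \<le> (1 - \<kappa>) ^ d * real ?M * real (n - 1) ^ d"
        by (intro mult_right_mono) auto
      also have "\<dots> = ((1 - \<kappa>) * real (n - 1)) ^ d * real ?M" by (simp add: power_mult_distrib)
      also have "\<dots> \<le> (real a - real d) ^ d * real ?M"
      proof (intro mult_right_mono power_mono)
        have "(1 - \<kappa>) * real (n - 1) \<le> (1 - \<kappa>) * real n" using kap by (intro mult_left_mono) auto
        then show "(1 - \<kappa>) * real (n - 1) \<le> real a - real d" using ad by linarith
      qed (use kap in auto)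
      also have "\<dots> \<le> real (n - 1) ^ d * real (a choose d)"
        using binomial_ratio_ge[OF da, of "n - 1"] n unfolding d_def by simp
      finally have "(1 - real d * \<kappa>) * real ?M * real (n - 1) ^ d \<le> real (a choose d) * real (n - 1) ^ d"
        by (simp add: mult.commute)
      then show ?thesis using n1 by (simp add: mult_le_cancel_right)
    qed
    have sparse: "N0 < T0 * ((m - T0 - tgt) choose (r - 1))"
    proof -
      \<comment> \<open>The summand \<open>z\<close> in \<open>\<theta>\<close> is there to make
        this comparison with \<open>\<tau>\<close> strict.\<close>
      have "\<theta> * (1 - real d * \<kappa>) = \<tau> + z * (1 - real d * \<kappa>)"
        using den by (simp add: \<theta>_def distrib_right)
      then have "\<tau> < \<theta> * (1 - real d * \<kappa>)" using z den by simp
      then have "\<tau> * (real n * real ?M) < \<theta> * (1 - real d * \<kappa>) * (real n * real ?M)"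
        using n0 M by (intro mult_strict_right_mono) auto
      also have "\<dots> = (\<theta> * real n) * ((1 - real d * \<kappa>) * real ?M)" by simp
      also have "\<dots> \<le> real T0 * real (a choose d)"
        using T0 binom den by (intro mult_mono) auto
      finally have "\<tau> * real n * real ?M < real (T0 * (a choose d))" by (simp add: mult.assoc)
      then have "real N0 < real (T0 * (a choose d))" using N0(1) by linarith
      then show ?thesis unfolding a_def d_def by linarith
    qed
    have dense: "real T0 + real tgt \<le> (real r - 1) * (?p * real N0 - z * real n)"
    proof -
      have "?p * (\<tau> * real n * real ?M - 1) \<le> ?p * real N0"
        using N0(2) p by (intro mult_left_mono) auto
      moreover have "?p * (\<tau> * real n * real ?M - 1) = \<tau> * real n * (real ?M * ?p) - ?p"
        by (simp add: algebra_simps)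
      ultimately have "\<tau> * real n * ((1 + \<epsilon>) / real d) - 1 \<le> ?p * real N0"
        unfolding deg using p1 by linarith
      then have "real d * (\<tau> * real n * ((1 + \<epsilon>) / real d) - 1) \<le> real d * (?p * real N0)"
        by (intro mult_left_mono) auto
      moreover have "real d * (\<tau> * real n * ((1 + \<epsilon>) / real d) - 1) = (1 + \<epsilon>) * \<tau> * real n - real d"
        using d by (simp add: field_simps)
      ultimately have "(1 + \<epsilon>) * \<tau> * real n - real d \<le> real d * (?p * real N0)" by simp
      then have "real T0 + real tgt \<le> real d * (?p * real N0) - real d * (z * real n)"
        using T0 tgt sum nz d by linarith
      then show ?thesis by (simp add: d algebra_simps)
    qed
    have tgt1: "1 \<le> tgt" using tgt(2) An nz d by linarith
    have l0: "1 + (r - 1) * l0 \<le> tgt"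
    proof -
      have "d * l0 \<le> tgt - 1" unfolding l0_def by (rule times_div_less_eq_dividend)
      then show ?thesis unfolding d_def[symmetric] using tgt1 by linarith
    qed
    have l0r: "real tgt / real d - 1 \<le> real l0"
    proof -
      have "tgt - 1 < (l0 + 1) * d"
        unfolding l0_def using d by (metis Suc_eq_plus1 dividend_less_div_times less_le_trans mult_Suc add.commute pos2)
      then have "tgt \<le> (l0 + 1) * d" by linarith
      then have "real tgt \<le> (real l0 + 1) * real d" by (metis of_nat_Suc of_nat_le_iff of_nat_mult Suc_eq_plus1 add.commute)
      then show ?thesis using d(2) by (simp add: field_simps)
    qed
    have l0n: "(A / real d - z) * real n \<le> real l0"
    proof -
      have "(A * real n - 1) / real d \<le> real tgt / real d"
        using tgt d by (intro divide_right_mono) auto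
      moreover have "(A * real n - 1) / real d = A / real d * real n - 1 / real d"
        by (simp add: diff_divide_distrib)
      moreover have "1 / real d \<le> 1" using d by simp
      ultimately have "A / real d * real n - 2 \<le> real l0" using l0r by linarith
      then show ?thesis using nz d by (simp add: left_diff_distrib)
    qed
    have s2: "2 * s \<le> l0"
    proof -
      have "2 * z * real n \<le> (A / real d - z) * real n" using False by (intro mult_right_mono) auto
      then have "real (2 * s) \<le> real l0" using l0n s(1) by simp
      then show ?thesis by simp
    qed
    have p0: "0 \<le> ?p" using p by simp
    have "probab (complete_edges r n) ?p (\<lambda>E. \<not> ?good E)
      \<le> probab (complete_edges r n) ?p (\<lambda>E. L_C r {1..n} E < l0 - 2 * s)"
    proof (rule probab_mono[OF p0 p1], rule ccontr)
      fix E assume E: "\<not> ?good E" "\<not> L_C r {1..n} E < l0 - 2 * s"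
      have "(\<epsilon>\<^sup>2 / (4 * (real r - 1)\<^sup>2) - 6 * \<epsilon> ^ 3) * real n \<le> (A / real d - 3 * z) * real n"
        using K(2) d by (intro mult_right_mono) (auto simp: z_def)
      also have "\<dots> = (A / real d - z) * real n - 2 * (z * real n)" by (simp add: algebra_simps)
      also have "\<dots> \<le> real l0 - real (2 * s)" using l0n s(1) by simp
      also have "\<dots> \<le> real (L_C r {1..n} E)" using E(2) by linarith
      finally show False using E(1) by simp
    qed
    also have "\<dots> \<le> probab (complete_edges r m) ?p (\<lambda>X. \<not> (\<exists>l v e. l0 \<le> l \<and> loose_path r {1..m} X l v e))
      + (1 - ?p) ^ (s * s * ((n - m) choose (r - 2)))"
      by (rule probab_short_cycle_le[OF r p0 p1 m(2) s2])
    also have "\<dots> \<le> ?p * real N0 / (z * real n)\<^sup>2 + (1 - ?p) ^ (s * s * (s choose (r - 2)))"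
      unfolding m(3) using z n0
      by (intro add_right_mono probab_no_long_path_le[OF r2 p0 p1 _ a(2) tgt1 sparse dense l0]) simp
    also have "?p * real N0 / (z * real n)\<^sup>2 \<le> 1 / (\<epsilon> ^ 6 * real n)"
    proof -
      have "?p * real N0 \<le> ?p * (\<tau> * real n * real ?M)" using N0 p0 by (intro mult_left_mono)
      also have "\<dots> = (\<tau> * ((1 + \<epsilon>) / real d)) * real n" unfolding deg[symmetric] by simp
      also have "\<dots> \<le> (1 * 1) * real n"
      proof (intro mult_right_mono mult_mono)
        show "\<tau> \<le> 1" using e d ehalf by (simp add: \<tau>_def field_simps)
        show "(1 + \<epsilon>) / real d \<le> 1" using ehalf d by (simp add: field_simps)
      qed (use e d in auto)
      finally have "?p * real N0 / (z * real n)\<^sup>2 \<le> real n / (z * real n)\<^sup>2"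
        by (intro divide_right_mono) auto
      also have "\<dots> = 1 / (\<epsilon> ^ 6 * real n)"
        using e n0 by (simp add: z_def power2_eq_square eval_nat_numeral)
      finally show ?thesis .
    qed
    also have "(1 - ?p) ^ (s * s * (s choose (r - 2)))
      \<le> exp (- ((\<epsilon> ^ 3 / 2)\<^sup>2 * (\<epsilon> ^ 3 / (2 * real (r - 2))) ^ (r - 2) / (real r - 1) * real n))"
    proof -
      let ?k = "s * s * (s choose (r - 2))"
      have sz: "z / 2 * real n \<le> real s" using s(2) nz d by linarith
      have rs: "r - 2 \<le> s"
      proof -
        have "real (r - 2) \<le> real s" using sz nz d r by (simp add: of_nat_diff)
        then show ?thesis by simp
      qed
      \<comment> \<open>There are at least order \<open>n ^ r\<close> closing edges, and the edge
        probability is at least \<open>1 / (d * n ^ d)\<close>; hence the exponent is linear in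
        \<open>n\<close>.\<close>
      have "(z / 2 * real n)\<^sup>2 * (z / (2 * real (r - 2)) * real n) ^ (r - 2) \<le> (real s)\<^sup>2 * real (s choose (r - 2))"
      proof (intro mult_mono power_mono sz)
        have "z / (2 * real (r - 2)) * real n = (z / 2 * real n) / real (r - 2)" by simp
        also have "\<dots> \<le> real s / real (r - 2)" using sz by (intro divide_right_mono) auto
        finally have "(z / (2 * real (r - 2)) * real n) ^ (r - 2) \<le> (real s / real (r - 2)) ^ (r - 2)"
          using z by (intro power_mono) auto
        also have "\<dots> \<le> real (s choose (r - 2))"
          using binomial_ge_n_over_k_pow_k[OF rs, where 'a = real] .
        finally show "(z / (2 * real (r - 2)) * real n) ^ (r - 2) \<le> real (s choose (r - 2))" .
      qed (use z in auto)
      also have "\<dots> = real ?k" by (simp add: power2_eq_square)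
      finally have k: "(z / 2)\<^sup>2 * (z / (2 * real (r - 2))) ^ (r - 2) * (real n)\<^sup>2 * real n ^ (r - 2) \<le> real ?k"
        unfolding power_mult_distrib by (simp only: mult_ac)
      have "?M \<le> (n - 1) ^ d" using binomial_le_pow[of d "n - 1"] n unfolding d_def by simp
      also have "\<dots> \<le> n ^ d" by (intro power_mono) auto
      finally have "real ?M \<le> real n ^ d" by (metis of_nat_le_iff of_nat_power)
      then have "1 / (real d * real n ^ d) \<le> (1 + \<epsilon>) / (real d * real ?M)"
        using e d M n0 by (intro frac_le mult_left_mono) auto
      then have pl: "1 / (real d * real n ^ d) \<le> ?p" by (simp add: edge_prob_def d)
      define c where "c = (z / 2)\<^sup>2 * (z / (2 * real (r - 2))) ^ (r - 2)"
      have "(real n)\<^sup>2 * real n ^ (r - 2) = real n * real n ^ d"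
        unfolding power_add[symmetric] power_Suc[symmetric] d_def using r by (intro arg_cong2[where f = "(^)"]) auto
      then have "1 / (real d * real n ^ d) * (c * (real n)\<^sup>2 * real n ^ (r - 2))
        = 1 / (real d * real n ^ d) * (c * (real n * real n ^ d))"
        by (simp only: mult.assoc)
      also have "\<dots> = c / real d * real n" using n0 d(2) by (simp add: field_simps)
      finally have "c / real d * real n = 1 / (real d * real n ^ d) * (c * (real n)\<^sup>2 * real n ^ (r - 2))" ..
      also have "\<dots> \<le> ?p * real ?k"
        using pl k z d(2) p0 unfolding c_def by (intro mult_mono) auto
      finally have ck: "c / real d * real n \<le> ?p * real ?k" .
      have "(1 - ?p) ^ ?k \<le> exp (- ?p) ^ ?k"
        using p1 exp_ge_add_one_self[of "- ?p"] by (intro power_mono) auto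
      also have "\<dots> = exp (- (?p * real ?k))" by (simp add: exp_of_nat_mult[symmetric] mult_ac)
      also have "\<dots> \<le> exp (- (c / real d * real n))" using ck by simp
      finally show ?thesis by (simp add: z_def c_def d(1))
    qed
    finally show ?thesis by simp
  qed
qed

lemma lower_tail:
  fixes r :: nat and \<epsilon> :: real
  assumes r: "r \<ge> 3" and e: "0 < \<epsilon>" "\<epsilon> \<le> 1 / (2 * (real r - 1))"
  shows "(\<lambda>n. probab (complete_edges r n) (edge_prob r \<epsilon> n)
      (\<lambda>E. \<not> (\<epsilon>\<^sup>2 / (4 * (real r - 1)\<^sup>2) - 6 * \<epsilon> ^ 3) * real n \<le> real (L_C r {1..n} E)))
    \<longlonglongrightarrow> 0"
proof (rule tendsto_sandwich[where f = "\<lambda>_. 0"])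
  let ?c = "(\<epsilon> ^ 3 / 2)\<^sup>2 * (\<epsilon> ^ 3 / (2 * real (r - 2))) ^ (r - 2) / (real r - 1)"
  define n0 where "n0 = max (2 * real r + 2) ((2 * real r + 2) / \<epsilon> ^ 3)"
  have "0 < ?c" using r e by (auto intro!: divide_pos_pos mult_pos_pos zero_less_power)
  then have "(\<lambda>n. exp (- ?c) ^ n) \<longlonglongrightarrow> 0" by (intro LIMSEQ_realpow_zero) auto
  then have "(\<lambda>n. exp (- (?c * real n))) \<longlonglongrightarrow> 0"
    by (simp add: exp_of_nat_mult[symmetric] mult.commute)
  from tendsto_add[OF lim_const_over_n[of "1 / \<epsilon> ^ 6"] this]
  show "(\<lambda>n. 1 / (\<epsilon> ^ 6 * real n) + exp (- (?c * real n))) \<longlonglongrightarrow> 0"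
    by simp
  have ev: "eventually (\<lambda>n. real n \<ge> n0) sequentially"
    by (rule eventually_compose_filterlim[OF eventually_ge_at_top filterlim_real_sequentially])
  then show "eventually (\<lambda>n. probab (complete_edges r n) (edge_prob r \<epsilon> n)
      (\<lambda>E. \<not> (\<epsilon>\<^sup>2 / (4 * (real r - 1)\<^sup>2) - 6 * \<epsilon> ^ 3) * real n \<le> real (L_C r {1..n} E))
    \<le> 1 / (\<epsilon> ^ 6 * real n) + exp (- (?c * real n))) sequentially"
  proof eventually_elim
    case (elim n)
    have "2 * real r + 2 \<le> \<epsilon> ^ 3 * real n" using elim e by (simp add: n0_def field_simps)
    then show ?case using elim by (intro lower_tail_bound[OF r e]) (auto simp: n0_def)
  qed
  from ev show "eventually (\<lambda>n. 0 \<le> probab (complete_edges r n) (edge_prob r \<epsilon> n)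
      (\<lambda>E. \<not> (\<epsilon>\<^sup>2 / (4 * (real r - 1)\<^sup>2) - 6 * \<epsilon> ^ 3) * real n \<le> real (L_C r {1..n} E))) sequentially"
  proof eventually_elim
    case (elim n)
    have n: "2 \<le> r" "r \<le> n" using elim r by (auto simp: n0_def)
    have "1 / (2 * (real r - 1)) \<le> 1" using r by (simp add: field_simps)
    then have "\<epsilon> \<le> 1" using e(2) by linarith
    then have "(1 + \<epsilon>) / real (n - 1) \<le> 1" using n r by (simp add: of_nat_diff)
    then show ?case using edge_prob_bounds[OF n e(1)] by (intro expect_nonneg) auto
  qed
qed (rule tendsto_const)

theorem theorem1p9:
  fixes r :: nat
  assumes "r \<ge> 3"
  shows "\<exists>K::real. \<forall>\<epsilon>::real. \<epsilon> > 0 \<longrightarrow>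
    (\<exists>a b :: real. \<bar>a\<bar> \<le> K * \<epsilon> ^ 3 \<and> \<bar>b\<bar> \<le> K * \<epsilon> ^ 3 \<and>
      (\<lambda>n::nat. measure_pmf.prob
          (random_hypergraph r n
             ((1 + \<epsilon>) / ((real r - 1) * real ((n - 1) choose (r - 1)))))
          {E. (\<epsilon>\<^sup>2 / (4 * (real r - 1)\<^sup>2) + a) * real n \<le> real (L_C r {1..n} E) \<and>
              L_C r {1..n} E \<le> L_P r {1..n} E + 1 \<and>
              real (L_P r {1..n} E + 1) \<le> (2 * \<epsilon>\<^sup>2 / (real r - 1)\<^sup>2 + b) * real n})
        \<longlonglongrightarrow> 1)"
proof -
  have r2: "r \<ge> 2" using assms by simp
  obtain K1 where K1: "K1 > 0" and upper: "\<And>\<epsilon>::real. 0 < \<epsilon> \<Longrightarrow> \<epsilon> \<le> 1/2 \<Longrightarrow>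
    (\<lambda>n. probab (complete_edges r n) (edge_prob r \<epsilon> n)
       (\<lambda>E. \<not> real (L_P r {1..n} E + 1) \<le> (2 * \<epsilon>\<^sup>2 / (real r - 1)\<^sup>2 + K1 * \<epsilon> ^ 3) * real n))
      \<longlonglongrightarrow> 0"
    using upper_tail[OF assms] by blast
  define d where "d = real r - 1"
  have d: "2 \<le> d" using assms by (simp add: d_def)
  \<comment> \<open>\<open>K1\<close> serves the upper bound and \<open>6\<close> the lower bound
    for small \<open>\<epsilon>\<close>; \<open>8 * d ^ 3\<close> makes
    \<open>K * \<epsilon> ^ 3 \<ge> 1\<close> once \<open>\<epsilon> > 1 / (2 * d)\<close>.\<close>
  define K where "K = K1 + 6 + 8 * d ^ 3"
  have d3: "0 \<le> d ^ 3" using d by simp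
  have main: "\<exists>a b :: real. \<bar>a\<bar> \<le> K * \<epsilon> ^ 3 \<and> \<bar>b\<bar> \<le> K * \<epsilon> ^ 3 \<and>
      (\<lambda>n::nat. measure_pmf.prob (random_hypergraph r n (edge_prob r \<epsilon> n))
          {E. (\<epsilon>\<^sup>2 / (4 * (real r - 1)\<^sup>2) + a) * real n \<le> real (L_C r {1..n} E) \<and>
              L_C r {1..n} E \<le> L_P r {1..n} E + 1 \<and>
              real (L_P r {1..n} E + 1) \<le> (2 * \<epsilon>\<^sup>2 / (real r - 1)\<^sup>2 + b) * real n})
        \<longlonglongrightarrow> 1" if e: "\<epsilon> > 0" for \<epsilon> :: real
  proof (cases "\<epsilon> \<le> 1 / (2 * d)")
    case True
    have "1 / (2 * d) \<le> 1 / (2 * 2)" using d by (intro divide_left_mono) auto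
    then have e2: "\<epsilon> \<le> 1/2" "\<epsilon> \<le> 1" using True by auto
    let ?G1 = "\<lambda>n E. (\<epsilon>\<^sup>2 / (4 * (real r - 1)\<^sup>2) - 6 * \<epsilon> ^ 3) * real n \<le> real (L_C r {1..n} E)"
    let ?G2 = "\<lambda>n E. real (L_P r {1..n} E + 1) \<le> (2 * \<epsilon>\<^sup>2 / (real r - 1)\<^sup>2 + K1 * \<epsilon> ^ 3) * real n"
    let ?P = "\<lambda>n. probab (complete_edges r n) (edge_prob r \<epsilon> n)"
    let ?\<mu> = "\<lambda>n. measure_pmf.prob (random_hypergraph r n (edge_prob r \<epsilon> n))
      {E. ?G1 n E \<and> L_C r {1..n} E \<le> L_P r {1..n} E + 1 \<and> ?G2 n E}"
    have "(\<lambda>n. 1 - (?P n (\<lambda>E. \<not> ?G1 n E) + ?P n (\<lambda>E. \<not> ?G2 n E))) \<longlonglongrightarrow> 1 - (0 + 0)"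
      using True e e2 unfolding d_def by (intro tendsto_intros lower_tail assms upper) auto
    then have lim: "(\<lambda>n. 1 - (?P n (\<lambda>E. \<not> ?G1 n E) + ?P n (\<lambda>E. \<not> ?G2 n E))) \<longlonglongrightarrow> 1" by simp
    have "?\<mu> \<longlonglongrightarrow> 1"
    proof (rule tendsto_sandwich[OF _ _ lim tendsto_const])
      show "eventually (\<lambda>n. 1 - (?P n (\<lambda>E. \<not> ?G1 n E) + ?P n (\<lambda>E. \<not> ?G2 n E)) \<le> ?\<mu> n) sequentially"
        using eventually_ge_at_top[of r]
      proof eventually_elim
        case (elim n)
        let ?p = "edge_prob r \<epsilon> n"
        have "(1 + \<epsilon>) / real (n - 1) \<le> 1" using elim e2 assms by (simp add: of_nat_diff)
        then have p: "0 \<le> ?p" "?p \<le> 1" using edge_prob_bounds[OF r2 elim e] by auto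
        have "?\<mu> n = ?P n (\<lambda>E. \<not> (\<not> ?G1 n E \<or> \<not> ?G2 n E))"
          unfolding prob_random_hypergraph[OF p] using L_C_le_L_P[OF r2] by simp
        also have "\<dots> = 1 - ?P n (\<lambda>E. \<not> ?G1 n E \<or> \<not> ?G2 n E)"
          by (rule probab_not) simp
        also have "\<dots> \<ge> 1 - (?P n (\<lambda>E. \<not> ?G1 n E) + ?P n (\<lambda>E. \<not> ?G2 n E))"
          using probab_disj_le[OF p] by (intro diff_left_mono)
        finally show ?case .
      qed
    qed (intro always_eventually allI measure_pmf.prob_le_1)
    moreover have "\<bar>- (6 * \<epsilon> ^ 3)\<bar> \<le> K * \<epsilon> ^ 3" "\<bar>K1 * \<epsilon> ^ 3\<bar> \<le> K * \<epsilon> ^ 3"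
      using e K1 d3 by (simp_all add: K_def abs_mult)
    ultimately show ?thesis
      by (intro exI[of _ "- (6 * \<epsilon> ^ 3)"] exI[of _ "K1 * \<epsilon> ^ 3"] conjI)
        (simp_all only: add_uminus_conv_diff)
  next
    case False
    \<comment> \<open>For large \<open>\<epsilon>\<close> both bounds are deterministic: the error
      term cancels the lower bound to 0, and the upper bound is at least \<open>n\<close>, which
      exceeds every path length. This covers edge probabilities that are clipped to 1 as
      well.\<close>
    then have de: "1 \<le> 2 * d * \<epsilon>" using d by (simp add: field_simps)
    have "1 ^ 3 \<le> (2 * d * \<epsilon>) ^ 3" using de by (intro power_mono) auto
    then have "1 \<le> 8 * d ^ 3 * \<epsilon> ^ 3" by (simp add: power_mult_distrib)
    also have "\<dots> \<le> K * \<epsilon> ^ 3" using e K1 by (intro mult_right_mono) (auto simp: K_def)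
    finally have Ke: "1 \<le> K * \<epsilon> ^ 3" .
    have a: "\<epsilon>\<^sup>2 / (4 * d\<^sup>2) \<le> K * \<epsilon> ^ 3"
    proof -
      have "1 / (4 * d\<^sup>2) * \<epsilon>\<^sup>2 \<le> 1 / (4 * d\<^sup>2) * \<epsilon>\<^sup>2 * (2 * d * \<epsilon>)"
        using de mult_left_mono[OF de, of "1 / (4 * d\<^sup>2) * \<epsilon>\<^sup>2"] by simp
      also have "\<dots> = 1 / (2 * d) * \<epsilon> ^ 3" using d by (simp add: field_simps power2_eq_square power3_eq_cube)
      also have "\<dots> \<le> K * \<epsilon> ^ 3"
      proof (rule mult_right_mono)
        have "1 / (2 * d) \<le> 1" using d by (simp add: field_simps)
        then show "1 / (2 * d) \<le> K" unfolding K_def using K1 d3 by linarith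
      qed (use e in simp)
      finally show ?thesis by simp
    qed
    have "eventually (\<lambda>n. measure_pmf.prob (random_hypergraph r n (edge_prob r \<epsilon> n))
          {E. (\<epsilon>\<^sup>2 / (4 * (real r - 1)\<^sup>2) + - (\<epsilon>\<^sup>2 / (4 * d\<^sup>2))) * real n \<le> real (L_C r {1..n} E) \<and>
              L_C r {1..n} E \<le> L_P r {1..n} E + 1 \<and>
              real (L_P r {1..n} E + 1) \<le> (2 * \<epsilon>\<^sup>2 / (real r - 1)\<^sup>2 + K * \<epsilon> ^ 3) * real n} = 1) sequentially"
      using eventually_ge_at_top[of 1]
    proof eventually_elim
      case (elim n)
      have "real (L_P r {1..n} E + 1) \<le> (2 * \<epsilon>\<^sup>2 / (real r - 1)\<^sup>2 + K * \<epsilon> ^ 3) * real n" for E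
      proof -
        have "l \<le> n - 1" if "loose_path r {1..n} E l v e" for l v e
        proof -
          have "l * 1 \<le> l * (r - 1)" using r2 by (intro mult_le_mono2) simp
          then show ?thesis
            using loose_path_length[OF finite_atLeastAtMost that] unfolding card_atLeastAtMost by linarith
        qed
        then have "L_P r {1..n} E \<le> n - 1" using r2 elim by (intro L_P_le)
        then have "real (L_P r {1..n} E + 1) \<le> 1 * real n" using elim by simp
        also have "\<dots> \<le> (2 * \<epsilon>\<^sup>2 / (real r - 1)\<^sup>2 + K * \<epsilon> ^ 3) * real n"
          using Ke by (intro mult_right_mono) (auto simp: add_increasing)
        finally show ?thesis .
      qed
      moreover have "L_C r {1..n} E \<le> L_P r {1..n} E + 1" for E by (rule L_C_le_L_P[OF r2])
      ultimately show ?case by (simp add: d_def)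
    qed
    then have "(\<lambda>n. measure_pmf.prob (random_hypergraph r n (edge_prob r \<epsilon> n))
          {E. (\<epsilon>\<^sup>2 / (4 * (real r - 1)\<^sup>2) + - (\<epsilon>\<^sup>2 / (4 * d\<^sup>2))) * real n \<le> real (L_C r {1..n} E) \<and>
              L_C r {1..n} E \<le> L_P r {1..n} E + 1 \<and>
              real (L_P r {1..n} E + 1) \<le> (2 * \<epsilon>\<^sup>2 / (real r - 1)\<^sup>2 + K * \<epsilon> ^ 3) * real n}) \<longlonglongrightarrow> 1"
      by (rule tendsto_eventually)
    moreover have "\<bar>- (\<epsilon>\<^sup>2 / (4 * d\<^sup>2))\<bar> \<le> K * \<epsilon> ^ 3" "\<bar>K * \<epsilon> ^ 3\<bar> \<le> K * \<epsilon> ^ 3"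
      using a Ke by simp_all
    ultimately show ?thesis by (intro exI conjI)
  qed
  show ?thesis using main unfolding edge_prob_def by blast
qed

end
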